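(* Let $\boldsymbol{oGpd}$ be the 2-category of ordered groupoids, double functors (= ordered functors) and $\Lambda$-transformations, and let $\boldsymbol{lcCat}$ be the 2-category of left-cancellative categories, functors and natural transformations. The 2-functors $\mathbf{L}\colon \boldsymbol{oGpd}\to\boldsymbol{lcCat}$ and $\mathbf{G}\colon \boldsymbol{lcCat}\to\boldsymbol{oGpd}$ (defined in the context) form a 2-adjunction between $\boldsymbol{oGpd}$ and $\boldsymbol{lcCat}$, with $\mathbf{G}$ left 2-adjoint to $\mathbf{L}$.
   Context: All categories are small. An ordered groupoid is a groupoid $\mathcal{G}$ with a partial order $\le$ on its arrows, inducing one on objects via identities ($A\le B$ iff $1_A\le 1_B$), such that: $a\le b$ implies $a^{-1}\le b^{-1}$; $a\le b$ and $c\le d$ imply $ac\le bd$ when both composites are defined; and for each $f\colon A\to B$ and $A'\le A$ there is a unique arrow $f|_{A'}\colon A'\to B'$ with domain $A'$ and $f|_{A'}\le f$. It is regarded as a double category: horizontal arrows are the groupoid arrows, there is a unique vertical arrow from $A$ to $B$ iff $A\le B$, and double cells are relations $g\le g'$ between horizontal arrows. A double functor (ordered functor) is an order-preserving functor of groupoids. For double functors $F,G\colon\mathcal{G}\to\mathcal{H}$: a horizontal transformation $\alpha\colon F\Rightarrow_h G$ is a family of horizontal arrows $\alpha_X\colon FX\to GX$ that is natural with respect to horizontal arrows and satisfies $\alpha_X\le\alpha_{Y}$ whenever $X\le Y$; a vertical transformation $F\Rightarrow_v G$ exists (uniquely) iff $F\le G$, i.e. $Fh\le Gh$ for all horizontal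 arrows $h$. A $\Lambda$-transformation $(\alpha,\le)\colon F\Rightarrow G$ consists of a double functor $G'\colon \mathcal{G}\to\mathcal{H}$ with $G'\le G$ and a horizontal transformation $\alpha\colon F\Rightarrow_h G'$. The vertical composite of $(\alpha\colon F\Rightarrow_h G'\le G)$ and $(\gamma\colon G\Rightarrow_h H'\le H)$ has components $\gamma_X|_{G'X}\circ\alpha_X$, followed by the resulting inequality. Whiskering is given by $(\beta,\le)F=(\beta F,\le)$ and $H(\alpha,\le)=(H\alpha,\le)$, and horizontal composition is derived from whiskering and vertical composition. A category is left-cancellative if all its arrows are monomorphisms. The 2-functor $\mathbf{L}$: $\mathbf{L}(\mathcal{G})$ has the objects of $\mathcal{G}$; an arrow $A\to B$ is a pair $(h,\le)$ consisting of a horizontal arrow $h\colon A\to B'$ with $B'\le B$; the composite of $(h\colon A\to B'\le B)$ and $(k\colon B\to C'\le C)$ is $(k|_{B'}\circ h,\le)$. On double functors $\mathbf{L}(F)$ is $F$ on objects and $\mathbf{L}(F)(h,\le)=(F(h),\le)$. For a $\Lambda$-transformation, $\mathbf{L}(\alpha,\le)$ has components $(\alpha_X,\le)$. The 2-functor $\mathbf{G}$: the objects of $\mathbf{G}(\mathcal{C})$ are subobjects in $\mathcal{C}$, i.e. classes $[m\colon A\to B]$ of arrows with $[m]=[m']$ iff $m=m'k$ for some isomorphism $k$. Horizontal arrows $[m]\to[n]$ are classes $[m,n]$ of spans $B\xleftarrow{m}A\xrightarrow{n}C$, with $[m,n]=[m',n']$ iff there is an isomorphism $h$ with $m=m'h$,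 $n=n'h$; the composite of $[k,m]\colon[k]\to[m]$ and $[m',n]\colon[m']\to[n]$, where $m=m'h$ with $h$ an isomorphism, is $[k,nh]$. The order is: $[n]\le[n']$ iff $n=n'h$ for some arrow $h$; $[m,n]\le[m',n']$ iff there is an arrow $h$ with $m=m'h$ and $n=n'h$. On functors, $\mathbf{G}(K)[m]=[Km]$ and $\mathbf{G}(K)[m,n]=[Km,Kn]$. For a natural transformation $\theta\colon K\Rightarrow K'$, $\mathbf{G}(\theta)$ is the $\Lambda$-transformation with components $[Km]\xrightarrow{[Km,\,K'm\circ\theta_{\mathrm{dom}(m)}]}[K'm\circ\theta_{\mathrm{dom}(m)}]\le[K'm]$, the intermediate double functor being $[m]\mapsto[K'm\circ\theta_{\mathrm{dom}(m)}]$, $[m,n]\mapsto[K'm\circ\theta_{\mathrm{dom}(m)},K'n\circ\theta_{\mathrm{dom}(n)}]$. *)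

theory Defs
  imports Main "HOL-Library.FuncSet"
begin

section \<open>Universes and smallness\<close>

text \<open>
  HOL has no type of all small categories, so smallness is relative to a type \<open>'u\<close> that plays
  the role of a universe: it contains the ordered pairs of its elements and (codes of) its small
  subsets, and smallness is stable under subsets, images and binary products.  Small categories are
  the categories whose sets of objects and arrows are small subsets of \<open>'u\<close>.
  The codes let an equivalence class of arrows, or of spans, be an object or an arrow of another
  small category.
\<close>

class universe =
  fixes small :: "'a set \<Rightarrow> bool"
    and code :: "'a set \<Rightarrow> 'a"
    and pair :: "'a \<Rightarrow> 'a \<Rightarrow> 'a"
  assumes pair_inject: "pair x y = pair x' y' \<Longrightarrow> x = x' \<and> y = y'"
    and code_inject: "\<lbrakk>small X; small Y; code X = code Y\<rbrakk> \<Longrightarrow> X = Y"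
    and small_subset: "\<lbrakk>small X; Y \<subseteq> X\<rbrakk> \<Longrightarrow> small Y"
    and small_image: "small X \<Longrightarrow> small (f ` X)"
    and small_pairs: "\<lbrakk>small X; small Y\<rbrakk> \<Longrightarrow> small {pair x y | x y. x \<in> X \<and> y \<in> Y}"

text \<open>
  There are arbitrarily large universes: for every type \<open>'k\<close> the following type is one, with the sets
  of cardinality at most that of \<open>'k list\<close> as small sets (lists make this cardinal infinite), and
  it has a small subset in bijection with \<open>'k\<close>.
\<close>

datatype 'k hset = Atom 'k | Pair "'k hset" "'k hset" | Family "'k list \<Rightarrow> 'k hset option"

instantiation hset :: (type) universe
begin

definition small_hset :: "'a hset set \<Rightarrow> bool" where
  "small_hset X \<longleftrightarrow> (\<exists>m :: 'a list \<Rightarrow> 'a hset option. ran m = X)"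

definition code_hset :: "'a hset set \<Rightarrow> 'a hset" where
  "code_hset X = Family (SOME m. ran m = X)"

definition pair_hset :: "'a hset \<Rightarrow> 'a hset \<Rightarrow> 'a hset" where
  "pair_hset = Pair"

instance
proof
  fix x y x' y' :: "'a hset"
  assume "pair x y = pair x' y'"
  then show "x = x' \<and> y = y'" by (simp add: pair_hset_def)
next
  fix X Y :: "'a hset set"
  assume X: "small X" and Y: "small Y" and eq: "code X = code Y"
  have "ran (SOME m :: 'a list \<Rightarrow> _. ran m = Z) = Z" if "small Z" for Z :: "'a hset set"
    using that unfolding small_hset_def by (rule someI_ex)
  with X Y eq show "X = Y" unfolding code_hset_def by (metis hset.inject(3))
next
  fix X Y :: "'a hset set"
  assume "small X" and sub: "Y \<subseteq> X"
  then obtain m :: "'a list \<Rightarrow> 'a hset option" where m: "ran m = X"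
    unfolding small_hset_def by blast
  have "ran (\<lambda>i. case m i of Some x \<Rightarrow> if x \<in> Y then Some x else None | None \<Rightarrow> None) = Y"
    using m sub by (fastforce simp: ran_def split: option.splits if_splits)
  then show "small Y" unfolding small_hset_def by blast
next
  fix X :: "'a hset set" and f :: "'a hset \<Rightarrow> 'a hset"
  assume "small X"
  then obtain m :: "'a list \<Rightarrow> 'a hset option" where m: "ran m = X"
    unfolding small_hset_def by blast
  have "ran (\<lambda>i. map_option f (m i)) = f ` X"
    using m by (auto simp: ran_def)
  then show "small (f ` X)" unfolding small_hset_def by blast
next
  fix X Y :: "'a hset set"
  assume "small X" "small Y"
  then obtain m n :: "'a list \<Rightarrow> 'a hset option" where m: "ran m = X" and n: "ran n = Y"
    unfolding small_hset_def by blast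
  have "(card_of ((UNIV :: 'a list set) \<times> (UNIV :: 'a list set)), card_of (UNIV :: 'a list set)) \<in> ordIso"
    by (rule card_of_Times_same_infinite) (rule infinite_UNIV_listI)
  then obtain f :: "'a list \<times> 'a list \<Rightarrow> 'a list" where "bij f"
    using card_of_ordIso by (metis UNIV_Times_UNIV)
  define g where "g = inv f"
  have g: "\<exists>i. g i = (j, k)" for j k
    using \<open>bij f\<close> unfolding g_def by (metis bij_def inv_f_f)
  define h where "h i = (case (m (fst (g i)), n (snd (g i))) of
      (Some x, Some y) \<Rightarrow> Some (pair x y) | _ \<Rightarrow> None)" for i
  have "ran h = {pair x y | x y. x \<in> X \<and> y \<in> Y}" (is "_ = ?R")
  proof (intro subset_antisym subsetI)
    fix z assume "z \<in> ran h"
    then show "z \<in> ?R"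
      using m n by (fastforce simp: ran_def h_def split: option.splits)
  next
    fix z assume "z \<in> ?R"
    then obtain x y j k where z: "z = pair x y" "m j = Some x" "n k = Some y"
      using m n by (auto simp: ran_def)
    obtain i where "g i = (j, k)" using g by blast
    then have "h i = Some z" using z by (simp add: h_def)
    then show "z \<in> ran h" by (auto simp: ran_def)
  qed
  then show "small {pair x y | x y. x \<in> X \<and> y \<in> Y}" unfolding small_hset_def by blast
qed

end

lemma small_range_Atom: "small (range (Atom :: 'k \<Rightarrow> 'k hset))"
proof -
  have "ran (\<lambda>i :: 'k list. case i of [k] \<Rightarrow> Some (Atom k) | _ \<Rightarrow> None) = range Atom" (is "ran ?m = _")
  proof (intro subset_antisym subsetI)
    fix z assume "z \<in> ran ?m"
    then obtain i where "?m i = Some z" by (auto simp: ran_def)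
    then show "z \<in> range Atom"
      by (cases i; cases "tl i") auto
  next
    fix z :: "'k hset" assume "z \<in> range Atom"
    then obtain k where "?m [k] = Some z" by auto
    then show "z \<in> ran ?m" unfolding ran_def by blast
  qed
  then show ?thesis unfolding small_hset_def by blast
qed

definition pfst :: "'u::universe \<Rightarrow> 'u" where
  "pfst p = (THE x. \<exists>y. p = pair x y)"

definition psnd :: "'u::universe \<Rightarrow> 'u" where
  "psnd p = (THE y. \<exists>x. p = pair x y)"


section \<open>Categories and functors\<close>

text \<open>Composition is in applicative order: \<open>cmp C g f\<close> is \<open>g \<circ> f\<close>.\<close>

record ('o, 'a) cat =
  obs :: "'o set"
  arrs :: "'a set"
  src :: "'a \<Rightarrow> 'o"
  trg :: "'a \<Rightarrow> 'o"
  idt :: "'o \<Rightarrow> 'a"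
  cmp :: "'a \<Rightarrow> 'a \<Rightarrow> 'a"

locale category =
  fixes C :: "('o, 'a, 'z) cat_scheme"
  assumes src_obs: "f \<in> arrs C \<Longrightarrow> src C f \<in> obs C"
    and trg_obs: "f \<in> arrs C \<Longrightarrow> trg C f \<in> obs C"
    and idt_arrs: "A \<in> obs C \<Longrightarrow> idt C A \<in> arrs C"
    and src_idt: "A \<in> obs C \<Longrightarrow> src C (idt C A) = A"
    and trg_idt: "A \<in> obs C \<Longrightarrow> trg C (idt C A) = A"
    and cmp_arrs: "\<lbrakk>g \<in> arrs C; f \<in> arrs C; src C g = trg C f\<rbrakk> \<Longrightarrow> cmp C g f \<in> arrs C"
    and src_cmp: "\<lbrakk>g \<in> arrs C; f \<in> arrs C; src C g = trg C f\<rbrakk> \<Longrightarrow> src C (cmp C g f) = src C f"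
    and trg_cmp: "\<lbrakk>g \<in> arrs C; f \<in> arrs C; src C g = trg C f\<rbrakk> \<Longrightarrow> trg C (cmp C g f) = trg C g"
    and cmp_idt_right: "f \<in> arrs C \<Longrightarrow> cmp C f (idt C (src C f)) = f"
    and cmp_idt_left: "f \<in> arrs C \<Longrightarrow> cmp C (idt C (trg C f)) f = f"
    and cmp_assoc: "\<lbrakk>h \<in> arrs C; g \<in> arrs C; f \<in> arrs C; src C h = trg C g; src C g = trg C f\<rbrakk>
      \<Longrightarrow> cmp C (cmp C h g) f = cmp C h (cmp C g f)"

locale cat_functor = C: category C + D: category D
  for C :: "('o, 'a, 'z) cat_scheme" and D :: "('p, 'b, 'y) cat_scheme" +
  fixes Fo :: "'o \<Rightarrow> 'p" and Fa :: "'a \<Rightarrow> 'b"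
  assumes map_obs: "A \<in> obs C \<Longrightarrow> Fo A \<in> obs D"
    and map_arrs: "f \<in> arrs C \<Longrightarrow> Fa f \<in> arrs D"
    and map_src: "f \<in> arrs C \<Longrightarrow> src D (Fa f) = Fo (src C f)"
    and map_trg: "f \<in> arrs C \<Longrightarrow> trg D (Fa f) = Fo (trg C f)"
    and map_idt: "A \<in> obs C \<Longrightarrow> Fa (idt C A) = idt D (Fo A)"
    and map_cmp: "\<lbrakk>g \<in> arrs C; f \<in> arrs C; src C g = trg C f\<rbrakk>
      \<Longrightarrow> Fa (cmp C g f) = cmp D (Fa g) (Fa f)"

definition is_inverse :: "('o, 'a, 'z) cat_scheme \<Rightarrow> 'a \<Rightarrow> 'a \<Rightarrow> bool" where
  "is_inverse C f g \<longleftrightarrow> f \<in> arrs C \<and> g \<in> arrs C \<and> src C g = trg C f \<and> trg C g = src C f \<and>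
     cmp C g f = idt C (src C f) \<and> cmp C f g = idt C (trg C f)"

definition iso :: "('o, 'a, 'z) cat_scheme \<Rightarrow> 'a \<Rightarrow> bool" where
  "iso C f \<longleftrightarrow> (\<exists>g. is_inverse C f g)"

definition inv_arr :: "('o, 'a, 'z) cat_scheme \<Rightarrow> 'a \<Rightarrow> 'a" where
  "inv_arr C f = (THE g. is_inverse C f g)"

definition mono_arr :: "('o, 'a, 'z) cat_scheme \<Rightarrow> 'a \<Rightarrow> bool" where
  "mono_arr C m \<longleftrightarrow> m \<in> arrs C \<and>
     (\<forall>f \<in> arrs C. \<forall>g \<in> arrs C. src C f = src C g \<longrightarrow> trg C f = src C m \<longrightarrow> trg C g = src C m \<longrightarrow>
        cmp C m f = cmp C m g \<longrightarrow> f = g)"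

definition small_cat :: "('u::universe, 'u, 'z) cat_scheme \<Rightarrow> bool" where
  "small_cat C \<longleftrightarrow> category C \<and> small (obs C) \<and> small (arrs C)"

definition left_cancellative :: "('o, 'a, 'z) cat_scheme \<Rightarrow> bool" where
  "left_cancellative C \<longleftrightarrow> (\<forall>m \<in> arrs C. mono_arr C m)"


section \<open>2-categories, 2-functors and 2-adjunctions\<close>

text \<open>
  A (strict) 2-category consists of its category \<open>cells01\<close> of 0-cells and 1-cells, the category
  \<open>cells12\<close> of 1-cells and 2-cells under vertical composition, and the horizontal composition of
  2-cells.
\<close>

record ('o, 'm, 'c) two_cat =
  cells01 :: "('o, 'm) cat"
  cells12 :: "('m, 'c) cat"
  hcmp :: "'c \<Rightarrow> 'c \<Rightarrow> 'c"

abbreviation "cells0 K \<equiv> obs (cells01 K)"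
abbreviation "cells1 K \<equiv> arrs (cells01 K)"
abbreviation "cells2 K \<equiv> arrs (cells12 K)"
abbreviation "src1 K \<equiv> src (cells01 K)"
abbreviation "trg1 K \<equiv> trg (cells01 K)"
abbreviation "idt1 K \<equiv> idt (cells01 K)"
abbreviation "cmp1 K \<equiv> cmp (cells01 K)"
abbreviation "src2 K \<equiv> src (cells12 K)"
abbreviation "trg2 K \<equiv> trg (cells12 K)"
abbreviation "idt2 K \<equiv> idt (cells12 K)"
abbreviation "vcmp K \<equiv> cmp (cells12 K)"

text \<open>\<open>\<beta>\<close> can be composed horizontally after \<open>\<alpha>\<close>.\<close>

abbreviation hcomposable :: "('o, 'm, 'c) two_cat \<Rightarrow> 'c \<Rightarrow> 'c \<Rightarrow> bool" where
  "hcomposable K \<beta> \<alpha> \<equiv> \<beta> \<in> cells2 K \<and> \<alpha> \<in> cells2 K \<and>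
     src1 K (src2 K \<beta>) = trg1 K (src2 K \<alpha>)"

locale two_category =
  fixes K :: "('o, 'm, 'c) two_cat"
  assumes category01: "category (cells01 K)"
    and category12: "category (cells12 K)"
    and obs_cells12: "obs (cells12 K) = cells1 K"
    and parallel_src: "\<alpha> \<in> cells2 K \<Longrightarrow> src1 K (src2 K \<alpha>) = src1 K (trg2 K \<alpha>)"
    and parallel_trg: "\<alpha> \<in> cells2 K \<Longrightarrow> trg1 K (src2 K \<alpha>) = trg1 K (trg2 K \<alpha>)"
    and hcmp_cells2: "hcomposable K \<beta> \<alpha> \<Longrightarrow> hcmp K \<beta> \<alpha> \<in> cells2 K"
    and src_hcmp: "hcomposable K \<beta> \<alpha> \<Longrightarrow> src2 K (hcmp K \<beta> \<alpha>) = cmp1 K (src2 K \<beta>) (src2 K \<alpha>)"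
    and trg_hcmp: "hcomposable K \<beta> \<alpha> \<Longrightarrow> trg2 K (hcmp K \<beta> \<alpha>) = cmp1 K (trg2 K \<beta>) (trg2 K \<alpha>)"
    and hcmp_assoc: "\<lbrakk>hcomposable K \<gamma> \<beta>; hcomposable K \<beta> \<alpha>\<rbrakk>
      \<Longrightarrow> hcmp K (hcmp K \<gamma> \<beta>) \<alpha> = hcmp K \<gamma> (hcmp K \<beta> \<alpha>)"
    and hcmp_unit_right: "\<alpha> \<in> cells2 K
      \<Longrightarrow> hcmp K \<alpha> (idt2 K (idt1 K (src1 K (src2 K \<alpha>)))) = \<alpha>"
    and hcmp_unit_left: "\<alpha> \<in> cells2 K
      \<Longrightarrow> hcmp K (idt2 K (idt1 K (trg1 K (src2 K \<alpha>)))) \<alpha> = \<alpha>"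
    and hcmp_idt2: "\<lbrakk>g \<in> cells1 K; f \<in> cells1 K; src1 K g = trg1 K f\<rbrakk>
      \<Longrightarrow> hcmp K (idt2 K g) (idt2 K f) = idt2 K (cmp1 K g f)"
    and interchange: "\<lbrakk>hcomposable K \<beta> \<alpha>; hcomposable K \<beta>' \<alpha>';
        src2 K \<beta>' = trg2 K \<beta>; src2 K \<alpha>' = trg2 K \<alpha>\<rbrakk>
      \<Longrightarrow> hcmp K (vcmp K \<beta>' \<beta>) (vcmp K \<alpha>' \<alpha>) = vcmp K (hcmp K \<beta>' \<alpha>') (hcmp K \<beta> \<alpha>)"

record ('o, 'm, 'c, 'p, 'n, 'd) two_fun =
  map0 :: "'o \<Rightarrow> 'p"
  map1 :: "'m \<Rightarrow> 'n"
  map2 :: "'c \<Rightarrow> 'd"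

locale two_functor = K: two_category K + M: two_category M
  for K :: "('o, 'm, 'c) two_cat" and M :: "('p, 'n, 'd) two_cat" +
  fixes F :: "('o, 'm, 'c, 'p, 'n, 'd) two_fun"
  assumes functor01: "cat_functor (cells01 K) (cells01 M) (map0 F) (map1 F)"
    and functor12: "cat_functor (cells12 K) (cells12 M) (map1 F) (map2 F)"
    and map_hcmp: "hcomposable K \<beta> \<alpha>
      \<Longrightarrow> map2 F (hcmp K \<beta> \<alpha>) = hcmp M (map2 F \<beta>) (map2 F \<alpha>)"

definition id_two_fun :: "('o, 'm, 'c, 'o, 'm, 'c) two_fun" where
  "id_two_fun = \<lparr>map0 = id, map1 = id, map2 = id\<rparr>"

definition comp_two_fun ::
  "('p, 'n, 'd, 'q, 'l, 'e) two_fun \<Rightarrow> ('o, 'm, 'c, 'p, 'n, 'd) two_fun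
    \<Rightarrow> ('o, 'm, 'c, 'q, 'l, 'e) two_fun" where
  "comp_two_fun G F =
     \<lparr>map0 = map0 G \<circ> map0 F, map1 = map1 G \<circ> map1 F, map2 = map2 G \<circ> map2 F\<rparr>"

locale two_natural = P: two_functor K M P + Q: two_functor K M Q
  for K :: "('o, 'm, 'c) two_cat" and M :: "('p, 'n, 'd) two_cat" and P Q +
  fixes \<eta> :: "'o \<Rightarrow> 'n"
  assumes component: "A \<in> cells0 K
      \<Longrightarrow> \<eta> A \<in> cells1 M \<and> src1 M (\<eta> A) = map0 P A \<and> trg1 M (\<eta> A) = map0 Q A"
    and natural1: "f \<in> cells1 K
      \<Longrightarrow> cmp1 M (map1 Q f) (\<eta> (src1 K f)) = cmp1 M (\<eta> (trg1 K f)) (map1 P f)"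
    and natural2: "\<alpha> \<in> cells2 K
      \<Longrightarrow> hcmp M (map2 Q \<alpha>) (idt2 M (\<eta> (src1 K (src2 K \<alpha>))))
        = hcmp M (idt2 M (\<eta> (trg1 K (src2 K \<alpha>)))) (map2 P \<alpha>)"

text \<open>
  The 2-adjunction \<open>F \<stileturn> U\<close> with left 2-adjoint \<open>F : K \<rightarrow> M\<close>, right 2-adjoint \<open>U : M \<rightarrow> K\<close>, unit
  \<open>\<eta> : 1 \<Rightarrow> U F\<close> and counit \<open>\<epsilon> : F U \<Rightarrow> 1\<close>.
\<close>

locale two_adjunction =
  F: two_functor K M F + U: two_functor M K U +
  unit: two_natural K K id_two_fun "comp_two_fun U F" \<eta> +
  counit: two_natural M M "comp_two_fun F U" id_two_fun \<epsilon>
  for K :: "('o, 'm, 'c) two_cat" and M :: "('p, 'n, 'd) two_cat" and F U \<eta> \<epsilon> +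
  assumes triangle_left: "A \<in> cells0 K
      \<Longrightarrow> cmp1 M (\<epsilon> (map0 F A)) (map1 F (\<eta> A)) = idt1 M (map0 F A)"
    and triangle_right: "B \<in> cells0 M
      \<Longrightarrow> cmp1 K (map1 U (\<epsilon> B)) (\<eta> (map0 U B)) = idt1 K (map0 U B)"


section \<open>The 2-category of small left-cancellative categories\<close>

text \<open>
  A functor carries its source and target; its maps are extensional (undefined outside the source),
  so that functors with the same source, target and values are equal.  Categories are not
  normalised in this way: records that differ only outside their objects and composable arrows are
  distinct but isomorphic 0-cells.  The type \<open>'c\<close> is a
  record type of categories or of ordered groupoids.
\<close>

record ('c, 'u) mor =
  msrc :: 'c
  mtrg :: 'c
  mob :: "'u \<Rightarrow> 'u"
  mar :: "'u \<Rightarrow> 'u"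

definition functor_mor :: "(('u, 'u, 'z) cat_scheme, 'u) mor \<Rightarrow> bool" where
  "functor_mor F \<longleftrightarrow> cat_functor (msrc F) (mtrg F) (mob F) (mar F) \<and>
     mob F \<in> extensional (obs (msrc F)) \<and> mar F \<in> extensional (arrs (msrc F))"

definition id_mor :: "('u, 'u, 'z) cat_scheme \<Rightarrow> (('u, 'u, 'z) cat_scheme, 'u) mor" where
  "id_mor C = \<lparr>msrc = C, mtrg = C, mob = restrict id (obs C), mar = restrict id (arrs C)\<rparr>"

definition comp_mor :: "(('u, 'u, 'z) cat_scheme, 'u) mor \<Rightarrow> (('u, 'u, 'z) cat_scheme, 'u) mor
    \<Rightarrow> (('u, 'u, 'z) cat_scheme, 'u) mor" where
  "comp_mor G F = \<lparr>msrc = msrc F, mtrg = mtrg G,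
     mob = compose (obs (msrc F)) (mob G) (mob F),
     mar = compose (arrs (msrc F)) (mar G) (mar F)\<rparr>"

definition parallel :: "('c, 'u) mor \<Rightarrow> ('c, 'u) mor \<Rightarrow> bool" where
  "parallel F G \<longleftrightarrow> msrc F = msrc G \<and> mtrg F = mtrg G"

type_synonym 'u lc_functor = "(('u, 'u) cat, 'u) mor"

definition lc_cats :: "('u::universe, 'u) cat set" where
  "lc_cats = {C. small_cat C \<and> left_cancellative C}"

definition lc_functors :: "'u::universe lc_functor set" where
  "lc_functors = {F. functor_mor F \<and> msrc F \<in> lc_cats \<and> mtrg F \<in> lc_cats}"

record 'u nat_trans =
  nsrc :: "'u lc_functor"
  ntrg :: "'u lc_functor"
  ncomp :: "'u \<Rightarrow> 'u"

definition lc_nats :: "'u::universe nat_trans set" where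
  "lc_nats = {\<theta>. nsrc \<theta> \<in> lc_functors \<and> ntrg \<theta> \<in> lc_functors \<and> parallel (nsrc \<theta>) (ntrg \<theta>) \<and>
     (let F = nsrc \<theta>; G = ntrg \<theta>; C = msrc F; D = mtrg F in
        ncomp \<theta> \<in> extensional (obs C) \<and>
        (\<forall>A \<in> obs C. ncomp \<theta> A \<in> arrs D \<and>
           src D (ncomp \<theta> A) = mob F A \<and> trg D (ncomp \<theta> A) = mob G A) \<and>
        (\<forall>f \<in> arrs C. cmp D (mar G f) (ncomp \<theta> (src C f)) = cmp D (ncomp \<theta> (trg C f)) (mar F f)))}"

definition nat_id :: "'u lc_functor \<Rightarrow> 'u nat_trans" where
  "nat_id F = \<lparr>nsrc = F, ntrg = F, ncomp = (\<lambda>A \<in> obs (msrc F). idt (mtrg F) (mob F A))\<rparr>"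

definition nat_vcomp :: "'u nat_trans \<Rightarrow> 'u nat_trans \<Rightarrow> 'u nat_trans" where
  "nat_vcomp \<phi> \<theta> = \<lparr>nsrc = nsrc \<theta>, ntrg = ntrg \<phi>,
     ncomp = (\<lambda>A \<in> obs (msrc (nsrc \<theta>)). cmp (mtrg (nsrc \<theta>)) (ncomp \<phi> A) (ncomp \<theta> A))\<rparr>"

definition nat_hcomp :: "'u nat_trans \<Rightarrow> 'u nat_trans \<Rightarrow> 'u nat_trans" where
  "nat_hcomp \<phi> \<theta> = \<lparr>nsrc = comp_mor (nsrc \<phi>) (nsrc \<theta>), ntrg = comp_mor (ntrg \<phi>) (ntrg \<theta>),
     ncomp = (\<lambda>A \<in> obs (msrc (nsrc \<theta>)).
       cmp (mtrg (nsrc \<phi>)) (ncomp \<phi> (mob (ntrg \<theta>) A)) (mar (nsrc \<phi>) (ncomp \<theta> A)))\<rparr>"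

definition lcCat :: "(('u::universe, 'u) cat, 'u lc_functor, 'u nat_trans) two_cat" where
  "lcCat =
     \<lparr>cells01 = \<lparr>obs = lc_cats, arrs = lc_functors,
        src = msrc, trg = mtrg, idt = id_mor, cmp = comp_mor\<rparr>,
      cells12 = \<lparr>obs = lc_functors, arrs = lc_nats,
        src = nsrc, trg = ntrg, idt = nat_id, cmp = nat_vcomp\<rparr>,
      hcmp = nat_hcomp\<rparr>"


section \<open>The 2-category of ordered groupoids\<close>

record ('o, 'a) ogpd = "('o, 'a) cat" +
  ale :: "'a \<Rightarrow> 'a \<Rightarrow> bool"

definition obj_le :: "('o, 'a) ogpd \<Rightarrow> 'o \<Rightarrow> 'o \<Rightarrow> bool" where
  "obj_le H A B \<longleftrightarrow> ale H (idt H A) (idt H B)"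

locale ordered_groupoid = category H for H :: "('o, 'a) ogpd" +
  assumes all_iso: "f \<in> arrs H \<Longrightarrow> iso H f"
    and ale_refl: "a \<in> arrs H \<Longrightarrow> ale H a a"
    and ale_trans: "\<lbrakk>a \<in> arrs H; b \<in> arrs H; c \<in> arrs H; ale H a b; ale H b c\<rbrakk> \<Longrightarrow> ale H a c"
    and ale_antisym: "\<lbrakk>a \<in> arrs H; b \<in> arrs H; ale H a b; ale H b a\<rbrakk> \<Longrightarrow> a = b"
    and ale_inv: "\<lbrakk>a \<in> arrs H; b \<in> arrs H; ale H a b\<rbrakk> \<Longrightarrow> ale H (inv_arr H a) (inv_arr H b)"
    and ale_cmp: "\<lbrakk>a \<in> arrs H; b \<in> arrs H; c \<in> arrs H; d \<in> arrs H; ale H a b; ale H c d;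
        src H a = trg H c; src H b = trg H d\<rbrakk> \<Longrightarrow> ale H (cmp H a c) (cmp H b d)"
    and restriction: "\<lbrakk>f \<in> arrs H; A \<in> obs H; obj_le H A (src H f)\<rbrakk>
      \<Longrightarrow> \<exists>!g. g \<in> arrs H \<and> src H g = A \<and> ale H g f"

definition restr :: "('o, 'a) ogpd \<Rightarrow> 'a \<Rightarrow> 'o \<Rightarrow> 'a" where
  "restr H f A = (THE g. g \<in> arrs H \<and> src H g = A \<and> ale H g f)"

type_synonym 'u og_functor = "(('u, 'u) ogpd, 'u) mor"

definition ogpds :: "('u::universe, 'u) ogpd set" where
  "ogpds = {H. small_cat H \<and> ordered_groupoid H}"

definition og_functors :: "'u::universe og_functor set" where
  "og_functors = {F. functor_mor F \<and> msrc F \<in> ogpds \<and> mtrg F \<in> ogpds \<and>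
     (\<forall>h \<in> arrs (msrc F). \<forall>k \<in> arrs (msrc F).
        ale (msrc F) h k \<longrightarrow> ale (mtrg F) (mar F h) (mar F k))}"

definition horizontal_trans :: "'u og_functor \<Rightarrow> 'u og_functor \<Rightarrow> ('u \<Rightarrow> 'u) \<Rightarrow> bool" where
  "horizontal_trans F G \<alpha> \<longleftrightarrow> parallel F G \<and>
     (let X = msrc F; Y = mtrg F in
        \<alpha> \<in> extensional (obs X) \<and>
        (\<forall>A \<in> obs X. \<alpha> A \<in> arrs Y \<and> src Y (\<alpha> A) = mob F A \<and> trg Y (\<alpha> A) = mob G A) \<and>
        (\<forall>f \<in> arrs X. cmp Y (mar G f) (\<alpha> (src X f)) = cmp Y (\<alpha> (trg X f)) (mar F f)) \<and>
        (\<forall>A \<in> obs X. \<forall>B \<in> obs X. obj_le X A B \<longrightarrow> ale Y (\<alpha> A) (\<alpha> B)))"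

definition functor_le :: "'u og_functor \<Rightarrow> 'u og_functor \<Rightarrow> bool" where
  "functor_le F G \<longleftrightarrow> parallel F G \<and> (\<forall>h \<in> arrs (msrc F). ale (mtrg F) (mar F h) (mar G h))"

text \<open>A \<open>\<Lambda>\<close>-transformation \<open>F \<Rightarrow> G\<close>, with intermediate double functor \<open>lmid\<close>.\<close>

record 'u lambda_trans =
  lsrc :: "'u og_functor"
  ltrg :: "'u og_functor"
  lmid :: "'u og_functor"
  lcomp :: "'u \<Rightarrow> 'u"

definition lambdas :: "'u::universe lambda_trans set" where
  "lambdas = {\<alpha>. lsrc \<alpha> \<in> og_functors \<and> ltrg \<alpha> \<in> og_functors \<and> lmid \<alpha> \<in> og_functors \<and>
     functor_le (lmid \<alpha>) (ltrg \<alpha>) \<and> horizontal_trans (lsrc \<alpha>) (lmid \<alpha>) (lcomp \<alpha>)}"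

definition lambda_id :: "'u og_functor \<Rightarrow> 'u lambda_trans" where
  "lambda_id F = \<lparr>lsrc = F, ltrg = F, lmid = F,
     lcomp = (\<lambda>A \<in> obs (msrc F). idt (mtrg F) (mob F A))\<rparr>"

text \<open>
  For \<open>\<alpha> : F \<Rightarrow> G' \<le> G\<close> and \<open>\<gamma> : G \<Rightarrow> H' \<le> H\<close>, the intermediate double functor of the vertical composite
  sends \<open>A\<close> to the target of \<open>\<gamma>\<^sub>A\<close> restricted to \<open>G'A\<close>.  As it has to lie below \<open>H'\<close>,
  it sends \<open>h : A \<rightarrow> B\<close> to the restriction of \<open>H'h\<close> to that object.
\<close>

definition lambda_vcomp :: "'u lambda_trans \<Rightarrow> 'u lambda_trans \<Rightarrow> 'u lambda_trans" where
  "lambda_vcomp \<gamma> \<alpha> =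
     (let X = msrc (lsrc \<alpha>); Y = mtrg (lsrc \<alpha>);
          \<gamma>r = (\<lambda>A. restr Y (lcomp \<gamma> A) (mob (lmid \<alpha>) A)) in
      \<lparr>lsrc = lsrc \<alpha>, ltrg = ltrg \<gamma>,
       lmid = \<lparr>msrc = X, mtrg = Y,
         mob = (\<lambda>A \<in> obs X. trg Y (\<gamma>r A)),
         mar = (\<lambda>h \<in> arrs X. restr Y (mar (lmid \<gamma>) h) (trg Y (\<gamma>r (src X h))))\<rparr>,
       lcomp = (\<lambda>A \<in> obs X. cmp Y (\<gamma>r A) (lcomp \<alpha> A))\<rparr>)"

definition lambda_whisker_right :: "'u lambda_trans \<Rightarrow> 'u og_functor \<Rightarrow> 'u lambda_trans" where
  "lambda_whisker_right \<beta> F =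
     \<lparr>lsrc = comp_mor (lsrc \<beta>) F, ltrg = comp_mor (ltrg \<beta>) F, lmid = comp_mor (lmid \<beta>) F,
      lcomp = (\<lambda>A \<in> obs (msrc F). lcomp \<beta> (mob F A))\<rparr>"

definition lambda_whisker_left :: "'u og_functor \<Rightarrow> 'u lambda_trans \<Rightarrow> 'u lambda_trans" where
  "lambda_whisker_left H \<alpha> =
     \<lparr>lsrc = comp_mor H (lsrc \<alpha>), ltrg = comp_mor H (ltrg \<alpha>), lmid = comp_mor H (lmid \<alpha>),
      lcomp = (\<lambda>A \<in> obs (msrc (lsrc \<alpha>)). mar H (lcomp \<alpha> A))\<rparr>"

definition lambda_hcomp :: "'u lambda_trans \<Rightarrow> 'u lambda_trans \<Rightarrow> 'u lambda_trans" where
  "lambda_hcomp \<beta> \<alpha> =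
     lambda_vcomp (lambda_whisker_right \<beta> (ltrg \<alpha>)) (lambda_whisker_left (lsrc \<beta>) \<alpha>)"

definition oGpd :: "(('u::universe, 'u) ogpd, 'u og_functor, 'u lambda_trans) two_cat" where
  "oGpd =
     \<lparr>cells01 = \<lparr>obs = ogpds, arrs = og_functors,
        src = msrc, trg = mtrg, idt = id_mor, cmp = comp_mor\<rparr>,
      cells12 = \<lparr>obs = og_functors, arrs = lambdas,
        src = lsrc, trg = ltrg, idt = lambda_id, cmp = lambda_vcomp\<rparr>,
      hcmp = lambda_hcomp\<rparr>"


section \<open>The 2-functor L\<close>

text \<open>The arrow \<open>(h : A \<rightarrow> B' \<le> B)\<close> is \<open>pair h B\<close>, since \<open>h\<close> determines \<open>B'\<close>.\<close>

definition L0 :: "('u::universe, 'u) ogpd \<Rightarrow> ('u, 'u) cat" where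
  "L0 H = \<lparr>obs = obs H,
     arrs = {pair h B | h B. h \<in> arrs H \<and> B \<in> obs H \<and> obj_le H (trg H h) B},
     src = (\<lambda>p. src H (pfst p)),
     trg = psnd,
     idt = (\<lambda>A. pair (idt H A) A),
     cmp = (\<lambda>q p. pair (cmp H (restr H (pfst q) (trg H (pfst p))) (pfst p)) (psnd q))\<rparr>"

definition L1 :: "'u::universe og_functor \<Rightarrow> 'u lc_functor" where
  "L1 F = \<lparr>msrc = L0 (msrc F), mtrg = L0 (mtrg F), mob = mob F,
     mar = (\<lambda>p \<in> arrs (L0 (msrc F)). pair (mar F (pfst p)) (mob F (psnd p)))\<rparr>"

definition L2 :: "'u::universe lambda_trans \<Rightarrow> 'u nat_trans" where
  "L2 \<alpha> = \<lparr>nsrc = L1 (lsrc \<alpha>), ntrg = L1 (ltrg \<alpha>),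
     ncomp = (\<lambda>A \<in> obs (msrc (lsrc \<alpha>)). pair (lcomp \<alpha> A) (mob (ltrg \<alpha>) A))\<rparr>"

definition L_functor :: "(('u::universe, 'u) ogpd, 'u og_functor, 'u lambda_trans,
    ('u, 'u) cat, 'u lc_functor, 'u nat_trans) two_fun" where
  "L_functor = \<lparr>map0 = L0, map1 = L1, map2 = L2\<rparr>"


section \<open>The 2-functor G\<close>

text \<open>The classes \<open>[m]\<close> and \<open>[m, n]\<close>, as codes of the actual equivalence classes.\<close>

definition subobj :: "('u::universe, 'u) cat \<Rightarrow> 'u \<Rightarrow> 'u" where
  "subobj C m = code {cmp C m k | k. iso C k \<and> trg C k = src C m}"

definition is_span :: "('u, 'u) cat \<Rightarrow> 'u \<Rightarrow> 'u \<Rightarrow> bool" where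
  "is_span C m n \<longleftrightarrow> m \<in> arrs C \<and> n \<in> arrs C \<and> src C m = src C n"

definition span :: "('u::universe, 'u) cat \<Rightarrow> 'u \<Rightarrow> 'u \<Rightarrow> 'u" where
  "span C m n = code {pair (cmp C m k) (cmp C n k) | k. iso C k \<and> trg C k = src C m}"

text \<open>
  The operations below are given on representatives and do not depend on their choice.  The order
  on objects is the one induced by identities: \<open>[n, n] \<le> [n', n']\<close> iff \<open>n = n' \<circ> h\<close> for some \<open>h\<close>.
\<close>

definition G0 :: "('u::universe, 'u) cat \<Rightarrow> ('u, 'u) ogpd" where
  "G0 C = \<lparr>obs = {subobj C m | m. m \<in> arrs C},
     arrs = {span C m n | m n. is_span C m n},
     src = (\<lambda>x. THE a. \<exists>m n. is_span C m n \<and> x = span C m n \<and> a = subobj C m),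
     trg = (\<lambda>x. THE b. \<exists>m n. is_span C m n \<and> x = span C m n \<and> b = subobj C n),
     idt = (\<lambda>a. THE x. \<exists>m \<in> arrs C. a = subobj C m \<and> x = span C m m),
     cmp = (\<lambda>y x. THE z. \<exists>k m m' n h. is_span C k m \<and> is_span C m' n \<and>
        x = span C k m \<and> y = span C m' n \<and>
        iso C h \<and> trg C h = src C m' \<and> m = cmp C m' h \<and> z = span C k (cmp C n h)),
     ale = (\<lambda>x y. \<exists>m n m' n' h. is_span C m n \<and> is_span C m' n' \<and>
        x = span C m n \<and> y = span C m' n' \<and>
        h \<in> arrs C \<and> trg C h = src C m' \<and> m = cmp C m' h \<and> n = cmp C n' h)\<rparr>"

text \<open>
  The ordered functor \<open>G C \<rightarrow> G D\<close> that sends \<open>[m]\<close> to \<open>[\<phi> m]\<close> and \<open>[m, n]\<close> to \<open>[\<phi> m, \<phi> n]\<close>, for an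
  operation \<open>\<phi>\<close> on arrows for which this is well defined.
\<close>

definition span_functor ::
  "('u::universe, 'u) cat \<Rightarrow> ('u, 'u) cat \<Rightarrow> ('u \<Rightarrow> 'u) \<Rightarrow> 'u og_functor" where
  "span_functor C D \<phi> = \<lparr>msrc = G0 C, mtrg = G0 D,
     mob = (\<lambda>a \<in> obs (G0 C). THE b. \<exists>m \<in> arrs C. a = subobj C m \<and> b = subobj D (\<phi> m)),
     mar = (\<lambda>x \<in> arrs (G0 C). THE y. \<exists>m n. is_span C m n \<and> x = span C m n \<and>
        y = span D (\<phi> m) (\<phi> n))\<rparr>"

definition G1 :: "'u::universe lc_functor \<Rightarrow> 'u og_functor" where
  "G1 K = span_functor (msrc K) (mtrg K) (mar K)"

definition G2 :: "'u::universe nat_trans \<Rightarrow> 'u lambda_trans" where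
  "G2 \<theta> =
     (let K = nsrc \<theta>; K' = ntrg \<theta>; C = msrc K; D = mtrg K;
          \<phi> = (\<lambda>m. cmp D (mar K' m) (ncomp \<theta> (src C m))) in
      \<lparr>lsrc = G1 K, ltrg = G1 K', lmid = span_functor C D \<phi>,
       lcomp = (\<lambda>a \<in> obs (G0 C). THE x. \<exists>m \<in> arrs C. a = subobj C m \<and> x = span D (mar K m) (\<phi> m))\<rparr>)"

definition G_functor :: "(('u::universe, 'u) cat, 'u lc_functor, 'u nat_trans,
    ('u, 'u) ogpd, 'u og_functor, 'u lambda_trans) two_fun" where
  "G_functor = \<lparr>map0 = G0, map1 = G1, map2 = G2\<rparr>"

end

theory Submission
  imports Defs
begin

text \<open>
  A \<open>\<Lambda>\<close>-transformation is determined by its source, its target and its components, because naturality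
  and the order force the intermediate double functor.  Hence \<open>\<Lambda>\<close>-transformations \<open>F \<Rightarrow> G\<close> embed into
  natural transformations \<open>L F \<Rightarrow> L G\<close>, and the 2-category laws of \<open>oGpd\<close> are reflected from \<open>lcCat\<close>.
  For the adjunction, the unit sends \<open>f : A \<rightarrow> B\<close> to \<open>([1\<^sub>A, f] : [1\<^sub>A] \<rightarrow> [f] \<le> [1\<^sub>B])\<close>.  An isomorphism
  \<open>(h, \<le>)\<close> of \<open>L H\<close> has an identity as its inequality, so a subobject in \<open>L H\<close> of \<open>B\<close> is just an object
  \<open>B' \<le> B\<close>, and the counit \<open>G (L H) \<rightarrow> H\<close> forgets \<open>B\<close>.
\<close>

section \<open>Categories, functors and natural transformations\<close>

text \<open>What makes direct calculation in \<open>oGpd\<close> unpleasant is restriction: every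
  vertical or horizontal composite of \<Lambda>-transformations restricts one component to an object
  determined by the other, and associativity or interchange would have to push these restrictions
  through composites. In \<open>L0 H\<close> that bookkeeping is part of the composition, so there
  each law is an equation between ordinary natural transformations. There is no circularity:
  faithfulness of \<open>L2\<close> and its compatibility with the operations use only that the
  cells are closed under the operations, not the laws to be proved. Inside an ordered groupoid
  nearly every equation comes from one principle: two arrows below a common arrow and with the same
  source are equal. In \<open>G0 C\<close> left cancellation does the corresponding work: the arrow
  witnessing an inequality of spans is already fixed by one leg. The unit represents
  \<open>A\<close> by its largest subobject \<open>[1]\<close>; an arrow \<open>f\<close> out of
  \<open>A\<close> then becomes a span with left leg \<open>1\<close> whose right leg only reaches
  the subobject \<open>[f]\<close>, and the inequality in \<open>L0\<close> fills the gap.\<close>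

lemma pfst_pair [simp]: "pfst (pair x y) = x"
  unfolding pfst_def by (rule the_equality) (auto dest: pair_inject)

lemma psnd_pair [simp]: "psnd (pair x y) = y"
  unfolding psnd_def by (rule the_equality) (auto dest: pair_inject)

lemma pair_eq_iff [simp]: "pair x y = pair x' y' \<longleftrightarrow> x = x' \<and> y = y'"
  by (auto dest: pair_inject)

lemmas category_simps [simp] =
  category.src_obs category.trg_obs category.idt_arrs category.src_idt category.trg_idt
  category.cmp_arrs category.src_cmp category.trg_cmp category.cmp_assoc

text \<open>The object is tied to \<open>f\<close> by a premise instead of occurring as
  \<open>src C f\<close>, so the rule still matches after the source has been simplified.\<close>

lemma cmp_idt_right' [simp]: "\<lbrakk>category C; f \<in> arrs C; src C f = A\<rbrakk> \<Longrightarrow> cmp C f (idt C A) = f"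
  using category.cmp_idt_right by fastforce

lemma cmp_idt_left' [simp]: "\<lbrakk>category C; f \<in> arrs C; trg C f = A\<rbrakk> \<Longrightarrow> cmp C (idt C A) f = f"
  using category.cmp_idt_left by fastforce

context category
begin

lemma is_inverse_unique:
  assumes "is_inverse C f g" and "is_inverse C f g'"
  shows "g = g'"
proof -
  have "g = cmp C (cmp C g f) g'"
    using assms cmp_assoc[of g f g'] cmp_idt_right[of g] by (simp add: is_inverse_def)
  also have "\<dots> = g'"
    using assms cmp_idt_left[of g'] by (simp add: is_inverse_def)
  finally show ?thesis .
qed

lemma inv_arr_eqI: "is_inverse C f g \<Longrightarrow> inv_arr C f = g"
  unfolding inv_arr_def using is_inverse_unique by blast

lemma is_inverse_iso: "is_inverse C f g \<Longrightarrow> iso C f"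
  by (auto simp: iso_def)

lemma is_inverse_inv_arr: "iso C f \<Longrightarrow> is_inverse C f (inv_arr C f)"
  unfolding iso_def using inv_arr_eqI by blast

lemma iso_arrs: "iso C f \<Longrightarrow> f \<in> arrs C"
  by (auto simp: iso_def is_inverse_def)

lemma inv_arrs: "iso C f \<Longrightarrow> inv_arr C f \<in> arrs C"
  and src_inv: "iso C f \<Longrightarrow> src C (inv_arr C f) = trg C f"
  and trg_inv: "iso C f \<Longrightarrow> trg C (inv_arr C f) = src C f"
  and inv_cmp: "iso C f \<Longrightarrow> cmp C (inv_arr C f) f = idt C (src C f)"
  and cmp_inv: "iso C f \<Longrightarrow> cmp C f (inv_arr C f) = idt C (trg C f)"
  using is_inverse_inv_arr by (auto simp: is_inverse_def)

lemma is_inverse_sym: "is_inverse C f g \<Longrightarrow> is_inverse C g f"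
  by (auto simp: is_inverse_def)

lemma iso_inv: "iso C f \<Longrightarrow> iso C (inv_arr C f)"
  by (rule is_inverse_iso[OF is_inverse_sym[OF is_inverse_inv_arr]])

lemma inv_inv: "iso C f \<Longrightarrow> inv_arr C (inv_arr C f) = f"
  using is_inverse_inv_arr is_inverse_sym inv_arr_eqI by blast

lemma is_inverse_idt: "A \<in> obs C \<Longrightarrow> is_inverse C (idt C A) (idt C A)"
  using category_axioms by (simp add: is_inverse_def)

lemma iso_idt: "A \<in> obs C \<Longrightarrow> iso C (idt C A)"
  by (rule is_inverse_iso[OF is_inverse_idt])

lemma inv_idt: "A \<in> obs C \<Longrightarrow> inv_arr C (idt C A) = idt C A"
  using is_inverse_idt inv_arr_eqI by blast

text \<open>\<open>cmp_assoc\<close> as a rewrite rule nests composites to the right, where the laws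
  for \<open>inv_arr\<close> no longer match; this and \<open>cmp_inv_cmp\<close> cancel inside such
  a composite.\<close>

lemma inv_cmp_cmp:
  assumes "iso C f" "g \<in> arrs C" "trg C g = src C f"
  shows "cmp C (inv_arr C f) (cmp C f g) = g"
  using assms category_axioms cmp_assoc[of "inv_arr C f" f g]
  by (simp add: inv_arrs src_inv trg_inv inv_cmp iso_arrs del: category_simps)

lemma cmp_inv_cmp:
  assumes "iso C f" "g \<in> arrs C" "trg C g = trg C f"
  shows "cmp C f (cmp C (inv_arr C f) g) = g"
  using inv_cmp_cmp[OF iso_inv[OF assms(1)]] assms by (simp add: inv_inv src_inv)

lemma is_inverse_cmp:
  assumes "iso C f" "iso C g" "src C g = trg C f"
  shows "is_inverse C (cmp C g f) (cmp C (inv_arr C f) (inv_arr C g))"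
  using assms category_axioms
  by (simp add: is_inverse_def iso_arrs inv_arrs src_inv trg_inv inv_cmp cmp_inv
      inv_cmp_cmp cmp_inv_cmp)

lemma iso_cmp: "\<lbrakk>iso C f; iso C g; src C g = trg C f\<rbrakk> \<Longrightarrow> iso C (cmp C g f)"
  by (rule is_inverse_iso[OF is_inverse_cmp])

lemma inv_of_cmp: "\<lbrakk>iso C f; iso C g; src C g = trg C f\<rbrakk>
    \<Longrightarrow> inv_arr C (cmp C g f) = cmp C (inv_arr C f) (inv_arr C g)"
  using is_inverse_cmp inv_arr_eqI by blast

end

lemmas iso_simps [simp] =
  category.inv_arrs category.src_inv category.trg_inv category.inv_cmp
  category.cmp_inv category.iso_inv category.inv_inv category.iso_idt category.inv_idt
  category.inv_cmp_cmp category.cmp_inv_cmp category.iso_cmp category.inv_of_cmp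

lemma (in cat_functor) map_is_inverse: "is_inverse C f g \<Longrightarrow> is_inverse D (Fa f) (Fa g)"
  unfolding is_inverse_def
  using map_cmp[of g f, symmetric] map_cmp[of f g, symmetric] C.category_axioms
  by (auto simp: map_arrs map_src map_trg map_idt)

lemma (in cat_functor) map_iso: "iso C f \<Longrightarrow> iso D (Fa f)"
  unfolding iso_def by (blast intro: map_is_inverse)

lemma (in cat_functor) map_inv: "iso C f \<Longrightarrow> Fa (inv_arr C f) = inv_arr D (Fa f)"
  using map_is_inverse C.is_inverse_inv_arr D.inv_arr_eqI by metis

section \<open>Functor records: values, equality and composition\<close>

lemma functor_mor_cat_functor: "functor_mor F \<Longrightarrow> cat_functor (msrc F) (mtrg F) (mob F) (mar F)"
  by (simp add: functor_mor_def)

lemma category_msrc [simp]: "functor_mor F \<Longrightarrow> category (msrc F)"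
  and category_mtrg [simp]: "functor_mor F \<Longrightarrow> category (mtrg F)"
  by (auto dest!: functor_mor_cat_functor simp: cat_functor_def)

text \<open>Here and below endpoints enter through equations such as \<open>mtrg F = D\<close>, so
  that the conclusion matches whatever normal form the simplifier has given to the source or target
  of a functor.\<close>

lemma mob_obs [simp]: "\<lbrakk>functor_mor F; mtrg F = D; A \<in> obs (msrc F)\<rbrakk> \<Longrightarrow> mob F A \<in> obs D"
  by (auto dest!: functor_mor_cat_functor simp: cat_functor.map_obs)

lemma mar_arrs [simp]: "\<lbrakk>functor_mor F; mtrg F = D; f \<in> arrs (msrc F)\<rbrakk> \<Longrightarrow> mar F f \<in> arrs D"
  by (auto dest!: functor_mor_cat_functor simp: cat_functor.map_arrs)

lemma src_mar [simp]: "\<lbrakk>functor_mor F; mtrg F = D; f \<in> arrs (msrc F)\<rbrakk>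
    \<Longrightarrow> src D (mar F f) = mob F (src (msrc F) f)"
  by (auto dest!: functor_mor_cat_functor simp: cat_functor.map_src)

lemma trg_mar [simp]: "\<lbrakk>functor_mor F; mtrg F = D; f \<in> arrs (msrc F)\<rbrakk>
    \<Longrightarrow> trg D (mar F f) = mob F (trg (msrc F) f)"
  by (auto dest!: functor_mor_cat_functor simp: cat_functor.map_trg)

lemma mar_idt [simp]: "\<lbrakk>functor_mor F; msrc F = C; A \<in> obs C\<rbrakk>
    \<Longrightarrow> mar F (idt C A) = idt (mtrg F) (mob F A)"
  by (auto dest!: functor_mor_cat_functor simp: cat_functor.map_idt)

lemma mar_cmp [simp]: "\<lbrakk>functor_mor F; msrc F = C; g \<in> arrs C; f \<in> arrs C; src C g = trg C f\<rbrakk>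
    \<Longrightarrow> mar F (cmp C g f) = cmp (mtrg F) (mar F g) (mar F f)"
  by (auto dest!: functor_mor_cat_functor simp: cat_functor.map_cmp)

lemma iso_mar [simp]: "\<lbrakk>functor_mor F; mtrg F = D; iso (msrc F) f\<rbrakk> \<Longrightarrow> iso D (mar F f)"
  by (auto dest!: functor_mor_cat_functor intro: cat_functor.map_iso)

lemma mar_inv [simp]: "\<lbrakk>functor_mor F; msrc F = C; iso C f\<rbrakk>
    \<Longrightarrow> mar F (inv_arr C f) = inv_arr (mtrg F) (mar F f)"
  by (auto dest!: functor_mor_cat_functor intro: cat_functor.map_inv)

lemma mob_extensional: "functor_mor F \<Longrightarrow> mob F \<in> extensional (obs (msrc F))"
  and mar_extensional: "functor_mor F \<Longrightarrow> mar F \<in> extensional (arrs (msrc F))"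
  by (auto simp: functor_mor_def)

lemma functor_mor_eqI:
  assumes "functor_mor F" "functor_mor G" "msrc F = msrc G" "mtrg F = mtrg G"
    and "\<And>A. A \<in> obs (msrc F) \<Longrightarrow> mob F A = mob G A"
    and "\<And>f. f \<in> arrs (msrc F) \<Longrightarrow> mar F f = mar G f"
  shows "F = G"
proof -
  have "mob F = mob G"
    using assms by (intro extensionalityI[of _ "obs (msrc F)"]) (auto simp: functor_mor_def)
  moreover have "mar F = mar G"
    using assms by (intro extensionalityI[of _ "arrs (msrc F)"]) (auto simp: functor_mor_def)
  ultimately show ?thesis using assms by (simp add: mor.equality)
qed

lemma id_mor_sel [simp]: "msrc (id_mor C) = C" "mtrg (id_mor C) = C"
  "A \<in> obs C \<Longrightarrow> mob (id_mor C) A = A" "f \<in> arrs C \<Longrightarrow> mar (id_mor C) f = f"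
  by (simp_all add: id_mor_def)

lemma comp_mor_sel [simp]: "msrc (comp_mor G F) = msrc F" "mtrg (comp_mor G F) = mtrg G"
  "A \<in> obs (msrc F) \<Longrightarrow> mob (comp_mor G F) A = mob G (mob F A)"
  "f \<in> arrs (msrc F) \<Longrightarrow> mar (comp_mor G F) f = mar G (mar F f)"
  by (simp_all add: comp_mor_def compose_def)

lemma functor_mor_id [simp]: "category C \<Longrightarrow> functor_mor (id_mor C)"
  unfolding functor_mor_def cat_functor_def cat_functor_axioms_def
  by (auto simp: id_mor_def)

lemma functor_mor_comp [simp]:
  "\<lbrakk>functor_mor F; functor_mor G; msrc G = mtrg F\<rbrakk> \<Longrightarrow> functor_mor (comp_mor G F)"
  unfolding functor_mor_def[of "comp_mor G F"] cat_functor_def cat_functor_axioms_def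
  by (simp add: comp_mor_def compose_def)

lemma comp_mor_id_right: "functor_mor F \<Longrightarrow> msrc F = C \<Longrightarrow> comp_mor F (id_mor C) = F"
  by (rule functor_mor_eqI) auto

lemma comp_mor_id_left: "functor_mor F \<Longrightarrow> mtrg F = C \<Longrightarrow> comp_mor (id_mor C) F = F"
  by (rule functor_mor_eqI) auto

lemma comp_mor_assoc: "\<lbrakk>functor_mor F; functor_mor G; functor_mor H; msrc H = mtrg G; msrc G = mtrg F\<rbrakk>
    \<Longrightarrow> comp_mor (comp_mor H G) F = comp_mor H (comp_mor G F)"
  by (rule functor_mor_eqI) auto

text \<open>Both 2-categories have functor records as 1-cells; the category laws are shown once, and
  each case supplies closure under identities and composition.\<close>

lemma category_of_functors:
  assumes "\<And>C. C \<in> X \<Longrightarrow> category C"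
    and "\<And>F. F \<in> Y \<Longrightarrow> functor_mor F \<and> msrc F \<in> X \<and> mtrg F \<in> X"
    and "\<And>C. C \<in> X \<Longrightarrow> id_mor C \<in> Y"
    and "\<And>F G. \<lbrakk>F \<in> Y; G \<in> Y; msrc G = mtrg F\<rbrakk> \<Longrightarrow> comp_mor G F \<in> Y"
  shows "category \<lparr>obs = X, arrs = Y, src = msrc, trg = mtrg, idt = id_mor, cmp = comp_mor\<rparr>"
  by unfold_locales (simp_all add: assms comp_mor_id_right comp_mor_id_left comp_mor_assoc)

lemma lc_functors_simps [simp]:
  assumes "F \<in> lc_functors"
  shows "functor_mor F" "msrc F \<in> lc_cats" "mtrg F \<in> lc_cats"
  using assms unfolding lc_functors_def by blast+

lemma lc_catsD [simp]: "C \<in> lc_cats \<Longrightarrow> category C"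
  by (simp add: lc_cats_def small_cat_def)

lemma lc_functorsI: "\<lbrakk>functor_mor F; msrc F \<in> lc_cats; mtrg F \<in> lc_cats\<rbrakk> \<Longrightarrow> F \<in> lc_functors"
  unfolding lc_functors_def by blast

lemma id_mor_lc [simp]: "C \<in> lc_cats \<Longrightarrow> id_mor C \<in> lc_functors"
  by (simp add: lc_functorsI)

lemma comp_mor_lc [simp]: "\<lbrakk>F \<in> lc_functors; G \<in> lc_functors; msrc G = mtrg F\<rbrakk>
    \<Longrightarrow> comp_mor G F \<in> lc_functors"
  by (simp add: lc_functorsI)

lemma category_lc_functors:
  "category \<lparr>obs = lc_cats, arrs = lc_functors, src = msrc, trg = mtrg, idt = id_mor, cmp = comp_mor\<rparr>"
  by (rule category_of_functors) auto

section \<open>Natural transformations and the 2-category \<open>lcCat\<close>\<close>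

lemma lc_natsI:
  assumes "nsrc \<theta> \<in> lc_functors" "ntrg \<theta> \<in> lc_functors"
    and "msrc (ntrg \<theta>) = msrc (nsrc \<theta>)" "mtrg (ntrg \<theta>) = mtrg (nsrc \<theta>)"
    and "ncomp \<theta> \<in> extensional (obs (msrc (nsrc \<theta>)))"
    and "\<And>A. A \<in> obs (msrc (nsrc \<theta>)) \<Longrightarrow> ncomp \<theta> A \<in> arrs (mtrg (nsrc \<theta>)) \<and>
      src (mtrg (nsrc \<theta>)) (ncomp \<theta> A) = mob (nsrc \<theta>) A \<and>
      trg (mtrg (nsrc \<theta>)) (ncomp \<theta> A) = mob (ntrg \<theta>) A"
    and "\<And>f. f \<in> arrs (msrc (nsrc \<theta>)) \<Longrightarrow>
      cmp (mtrg (nsrc \<theta>)) (mar (ntrg \<theta>) f) (ncomp \<theta> (src (msrc (nsrc \<theta>)) f))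
        = cmp (mtrg (nsrc \<theta>)) (ncomp \<theta> (trg (msrc (nsrc \<theta>)) f)) (mar (nsrc \<theta>) f)"
  shows "\<theta> \<in> lc_nats"
  unfolding lc_nats_def Let_def parallel_def
  by (intro CollectI conjI ballI) (use assms in \<open>auto simp del: lc_functors_simps\<close>)

lemma lc_nats_simps [simp]:
  assumes "\<theta> \<in> lc_nats"
  shows "nsrc \<theta> \<in> lc_functors" "ntrg \<theta> \<in> lc_functors"
    "msrc (ntrg \<theta>) = msrc (nsrc \<theta>)" "mtrg (ntrg \<theta>) = mtrg (nsrc \<theta>)"
  using assms unfolding lc_nats_def Let_def parallel_def by auto

lemma ncomp_simps [simp]:
  assumes "\<theta> \<in> lc_nats" "A \<in> obs (msrc (nsrc \<theta>))" "mtrg (nsrc \<theta>) = D"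
  shows "ncomp \<theta> A \<in> arrs D"
    "src D (ncomp \<theta> A) = mob (nsrc \<theta>) A"
    "trg D (ncomp \<theta> A) = mob (ntrg \<theta>) A"
  using assms unfolding lc_nats_def Let_def by auto

lemma lc_nats_extensional: "\<theta> \<in> lc_nats \<Longrightarrow> ncomp \<theta> \<in> extensional (obs (msrc (nsrc \<theta>)))"
  unfolding lc_nats_def Let_def by auto

lemma ncomp_natural:
  assumes "\<theta> \<in> lc_nats" "f \<in> arrs (msrc (nsrc \<theta>))" "mtrg (nsrc \<theta>) = D"
    "src (msrc (nsrc \<theta>)) f = A" "trg (msrc (nsrc \<theta>)) f = B"
  shows "cmp D (mar (ntrg \<theta>) f) (ncomp \<theta> A) = cmp D (ncomp \<theta> B) (mar (nsrc \<theta>) f)"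
  using assms unfolding lc_nats_def Let_def by auto

text \<open>Naturality inside a composite nested to the right, the form that
  \<open>cmp_assoc\<close> leaves.\<close>

lemma ncomp_natural_assoc:
  assumes "\<theta> \<in> lc_nats" "f \<in> arrs (msrc (nsrc \<theta>))" "mtrg (nsrc \<theta>) = D"
    "src (msrc (nsrc \<theta>)) f = A" "trg (msrc (nsrc \<theta>)) f = B"
    "g \<in> arrs D" "trg D g = mob (nsrc \<theta>) A"
  shows "cmp D (mar (ntrg \<theta>) f) (cmp D (ncomp \<theta> A) g)
     = cmp D (ncomp \<theta> B) (cmp D (mar (nsrc \<theta>) f) g)"
proof -
  have "cmp D (cmp D (mar (ntrg \<theta>) f) (ncomp \<theta> A)) g
     = cmp D (cmp D (ncomp \<theta> B) (mar (nsrc \<theta>) f)) g"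
    using assms by (simp add: ncomp_natural del: category.cmp_assoc)
  moreover have "category D" "A \<in> obs (msrc (nsrc \<theta>))" "B \<in> obs (msrc (nsrc \<theta>))"
    using assms by auto
  ultimately show ?thesis using assms by simp
qed

lemma lc_nats_eqI:
  assumes "\<theta> \<in> lc_nats" "\<theta>' \<in> lc_nats" "nsrc \<theta> = nsrc \<theta>'" "ntrg \<theta> = ntrg \<theta>'"
    and "\<And>A. A \<in> obs (msrc (nsrc \<theta>)) \<Longrightarrow> ncomp \<theta> A = ncomp \<theta>' A"
  shows "\<theta> = \<theta>'"
proof -
  have "ncomp \<theta> = ncomp \<theta>'"
    using assms by (intro extensionalityI[of _ "obs (msrc (nsrc \<theta>))"]) (use assms lc_nats_extensional[of \<theta>] lc_nats_extensional[of \<theta>'] in simp_all)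
  then show ?thesis using assms by simp
qed

lemma nat_id_sel [simp]: "nsrc (nat_id F) = F" "ntrg (nat_id F) = F"
  "A \<in> obs (msrc F) \<Longrightarrow> ncomp (nat_id F) A = idt (mtrg F) (mob F A)"
  by (simp_all add: nat_id_def)

lemma nat_vcomp_sel [simp]: "nsrc (nat_vcomp \<phi> \<theta>) = nsrc \<theta>" "ntrg (nat_vcomp \<phi> \<theta>) = ntrg \<phi>"
  "A \<in> obs (msrc (nsrc \<theta>)) \<Longrightarrow>
    ncomp (nat_vcomp \<phi> \<theta>) A = cmp (mtrg (nsrc \<theta>)) (ncomp \<phi> A) (ncomp \<theta> A)"
  by (simp_all add: nat_vcomp_def)

lemma nat_hcomp_sel [simp]: "nsrc (nat_hcomp \<phi> \<theta>) = comp_mor (nsrc \<phi>) (nsrc \<theta>)"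
  "ntrg (nat_hcomp \<phi> \<theta>) = comp_mor (ntrg \<phi>) (ntrg \<theta>)"
  "A \<in> obs (msrc (nsrc \<theta>)) \<Longrightarrow> ncomp (nat_hcomp \<phi> \<theta>) A =
    cmp (mtrg (nsrc \<phi>)) (ncomp \<phi> (mob (ntrg \<theta>) A)) (mar (nsrc \<phi>) (ncomp \<theta> A))"
  by (simp_all add: nat_hcomp_def)

lemma nat_id_lc [simp]: "F \<in> lc_functors \<Longrightarrow> nat_id F \<in> lc_nats"
  by (rule lc_natsI) (simp_all, simp add: nat_id_def)

lemma nat_vcomp_lc [simp]:
  assumes "\<theta> \<in> lc_nats" "\<phi> \<in> lc_nats" "nsrc \<phi> = ntrg \<theta>"
  shows "nat_vcomp \<phi> \<theta> \<in> lc_nats"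
proof (rule lc_natsI)
  have eq: "msrc (ntrg \<phi>) = msrc (nsrc \<theta>)" "mtrg (ntrg \<phi>) = mtrg (nsrc \<theta>)"
    using lc_nats_simps(3,4)[OF assms(2)] assms(1,3) by auto
  show "ncomp (nat_vcomp \<phi> \<theta>) \<in> extensional (obs (msrc (nsrc (nat_vcomp \<phi> \<theta>))))"
    by (simp add: nat_vcomp_def)
  fix f assume "f \<in> arrs (msrc (nsrc (nat_vcomp \<phi> \<theta>)))"
  then show "cmp (mtrg (nsrc (nat_vcomp \<phi> \<theta>))) (mar (ntrg (nat_vcomp \<phi> \<theta>)) f)
         (ncomp (nat_vcomp \<phi> \<theta>) (src (msrc (nsrc (nat_vcomp \<phi> \<theta>))) f)) =
        cmp (mtrg (nsrc (nat_vcomp \<phi> \<theta>)))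
         (ncomp (nat_vcomp \<phi> \<theta>) (trg (msrc (nsrc (nat_vcomp \<phi> \<theta>))) f))
         (mar (nsrc (nat_vcomp \<phi> \<theta>)) f)"
    using assms eq by (simp add: ncomp_natural_assoc ncomp_natural[of \<theta> f])
qed (use assms in simp_all)

lemma nat_hcomp_lc [simp]:
  assumes "\<theta> \<in> lc_nats" "\<phi> \<in> lc_nats" "msrc (nsrc \<phi>) = mtrg (nsrc \<theta>)"
  shows "nat_hcomp \<phi> \<theta> \<in> lc_nats"
proof (rule lc_natsI)
  show "ncomp (nat_hcomp \<phi> \<theta>) \<in> extensional (obs (msrc (nsrc (nat_hcomp \<phi> \<theta>))))"
    by (simp add: nat_hcomp_def)
  fix f assume f: "f \<in> arrs (msrc (nsrc (nat_hcomp \<phi> \<theta>)))"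
  \<comment> \<open>The source functor of \<phi> is applied to the naturality square of \<theta>;
    naturality of \<phi> itself enters only in the last step.\<close>
  have "cmp (mtrg (nsrc \<phi>)) (mar (nsrc \<phi>) (mar (ntrg \<theta>) f)) (mar (nsrc \<phi>) (ncomp \<theta> (src (msrc (nsrc \<theta>)) f)))
    = mar (nsrc \<phi>) (cmp (mtrg (nsrc \<theta>)) (mar (ntrg \<theta>) f) (ncomp \<theta> (src (msrc (nsrc \<theta>)) f)))"
    using f assms by simp
  also have "\<dots> = mar (nsrc \<phi>) (cmp (mtrg (nsrc \<theta>)) (ncomp \<theta> (trg (msrc (nsrc \<theta>)) f)) (mar (nsrc \<theta>) f))"
    using f assms by (simp add: ncomp_natural[of \<theta> f] del: mar_cmp)
  also have "\<dots> = cmp (mtrg (nsrc \<phi>)) (mar (nsrc \<phi>) (ncomp \<theta> (trg (msrc (nsrc \<theta>)) f))) (mar (nsrc \<phi>) (mar (nsrc \<theta>) f))"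
    using f assms by simp
  finally show "cmp (mtrg (nsrc (nat_hcomp \<phi> \<theta>))) (mar (ntrg (nat_hcomp \<phi> \<theta>)) f)
         (ncomp (nat_hcomp \<phi> \<theta>) (src (msrc (nsrc (nat_hcomp \<phi> \<theta>))) f)) =
        cmp (mtrg (nsrc (nat_hcomp \<phi> \<theta>)))
         (ncomp (nat_hcomp \<phi> \<theta>) (trg (msrc (nsrc (nat_hcomp \<phi> \<theta>))) f))
         (mar (nsrc (nat_hcomp \<phi> \<theta>)) f)"
    using f assms by (simp add: ncomp_natural_assoc)
qed (use assms in simp_all)

lemma category_lc_nats:
  "category \<lparr>obs = lc_functors, arrs = lc_nats, src = nsrc, trg = ntrg, idt = nat_id, cmp = nat_vcomp\<rparr>"
proof (unfold_locales, simp_all)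
  fix h g f :: "'a nat_trans"
  assume a: "h \<in> lc_nats" "g \<in> lc_nats" "f \<in> lc_nats" "nsrc h = ntrg g" "nsrc g = ntrg f"
  have "msrc (ntrg g) = msrc (nsrc f)" "mtrg (ntrg g) = mtrg (nsrc f)"
    "msrc (ntrg h) = msrc (nsrc f)" "mtrg (ntrg h) = mtrg (nsrc f)"
    using lc_nats_simps(3,4)[OF a(1)] lc_nats_simps(3,4)[OF a(2)] a by auto
  then show "nat_vcomp (nat_vcomp h g) f = nat_vcomp h (nat_vcomp g f)"
    using a by (intro lc_nats_eqI) simp_all
qed (rule lc_nats_eqI; simp)+

lemma nat_hcomp_assoc:
  assumes "\<theta> \<in> lc_nats" "\<phi> \<in> lc_nats" "\<psi> \<in> lc_nats"
    "msrc (nsrc \<phi>) = mtrg (nsrc \<theta>)" "msrc (nsrc \<psi>) = mtrg (nsrc \<phi>)"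
  shows "nat_hcomp (nat_hcomp \<psi> \<phi>) \<theta> = nat_hcomp \<psi> (nat_hcomp \<phi> \<theta>)"
  using assms by (intro lc_nats_eqI) (simp_all add: comp_mor_assoc)

text \<open>The two sides differ by exchanging a component of \<phi> with the image of a component
  of \<open>\<theta>'\<close>, which is naturality of \<phi> at that component.\<close>

lemma nat_interchange:
  assumes "\<theta> \<in> lc_nats" "\<theta>' \<in> lc_nats" "\<phi> \<in> lc_nats" "\<phi>' \<in> lc_nats"
    "msrc (nsrc \<phi>) = mtrg (nsrc \<theta>)" "nsrc \<theta>' = ntrg \<theta>" "nsrc \<phi>' = ntrg \<phi>"
  shows "nat_hcomp (nat_vcomp \<phi>' \<phi>) (nat_vcomp \<theta>' \<theta>) = nat_vcomp (nat_hcomp \<phi>' \<theta>') (nat_hcomp \<phi> \<theta>)"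
proof -
  have "msrc (ntrg \<theta>') = msrc (nsrc \<theta>)" "mtrg (ntrg \<theta>') = mtrg (nsrc \<theta>)"
    "msrc (ntrg \<phi>') = msrc (nsrc \<phi>)" "mtrg (ntrg \<phi>') = mtrg (nsrc \<phi>)"
    using lc_nats_simps(3,4)[OF assms(2)] lc_nats_simps(3,4)[OF assms(4)] assms by auto
  with assms show ?thesis
    by (intro lc_nats_eqI) (simp_all add: ncomp_natural ncomp_natural_assoc)
qed

lemma two_category_lcCat: "two_category lcCat"
  unfolding lcCat_def
proof (rule two_category.intro, simp_all add: category_lc_functors category_lc_nats nat_hcomp_assoc nat_interchange)
qed (rule lc_nats_eqI; simp add: comp_mor_id_left comp_mor_id_right)+

section \<open>Ordered groupoids and the 2-functor L\<close>

lemma ogpdsD: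
  assumes "H \<in> ogpds"
  shows "ordered_groupoid H" "small_cat H"
  using assms unfolding ogpds_def by auto

lemma ordered_groupoid_category [simp]: "ordered_groupoid H \<Longrightarrow> category H"
  by (rule ordered_groupoid.axioms)

declare ordered_groupoid.all_iso [simp] ordered_groupoid.ale_refl [simp]

section \<open>Restriction in an ordered groupoid\<close>

context ordered_groupoid
begin

lemma cat [simp]: "category H" by unfold_locales

lemma ogpd [simp]: "ordered_groupoid H" by unfold_locales

lemma isoI [simp]: "f \<in> arrs H \<Longrightarrow> iso H f" by (rule all_iso)

text \<open>\<open>obj_le\<close> compares identities, and the identity at the source is
  \<open>inv_arr H a\<close> after \<open>a\<close>; inversion and composition are monotone.\<close>

lemma ale_src:
  assumes "a \<in> arrs H" "b \<in> arrs H" "ale H a b"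
  shows "obj_le H (src H a) (src H b)"
  using assms ale_inv[OF assms] ale_cmp[of "inv_arr H a" "inv_arr H b" a b]
  by (simp add: obj_le_def)

lemma ale_trg:
  assumes "a \<in> arrs H" "b \<in> arrs H" "ale H a b"
  shows "obj_le H (trg H a) (trg H b)"
  using assms ale_inv[OF assms] ale_cmp[of a b "inv_arr H a" "inv_arr H b"]
  by (simp add: obj_le_def)

lemma obj_le_refl: "A \<in> obs H \<Longrightarrow> obj_le H A A"
  by (simp add: obj_le_def ale_refl)

lemma obj_le_trans: "\<lbrakk>obj_le H A B; obj_le H B D; A \<in> obs H; B \<in> obs H; D \<in> obs H\<rbrakk> \<Longrightarrow> obj_le H A D"
  unfolding obj_le_def by (rule ale_trans[of _ "idt H B"]) simp_all

lemma obj_le_antisym: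
  assumes "A \<in> obs H" "B \<in> obs H" "obj_le H A B" "obj_le H B A"
  shows "A = B"
proof -
  have "idt H A = idt H B"
    using assms unfolding obj_le_def by (intro ale_antisym) simp_all
  then show ?thesis using assms src_idt by metis
qed

lemma ale_idt: "obj_le H A B \<Longrightarrow> ale H (idt H A) (idt H B)"
  by (simp add: obj_le_def)

lemma restr_prop:
  assumes "f \<in> arrs H" "A \<in> obs H" "obj_le H A (src H f)"
  shows "restr H f A \<in> arrs H \<and> src H (restr H f A) = A \<and> ale H (restr H f A) f"
  unfolding restr_def by (rule theI'[OF restriction[OF assms]])

lemma restr_eqI:
  assumes "g \<in> arrs H" "f \<in> arrs H" "ale H g f" "src H g = A"
  shows "restr H f A = g"
proof -
  have "A \<in> obs H" "obj_le H A (src H f)" using assms ale_src by auto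
  from restriction[OF assms(2) this] restr_prop[OF assms(2) this] show ?thesis
    using assms by blast
qed

text \<open>Both arrows are the restriction of \<open>c\<close> to their common source. Most later
  equations in an ordered groupoid are proved this way: exhibit a common upper bound and compare
  sources.\<close>

lemma ale_same_src:
  assumes "a \<in> arrs H" "b \<in> arrs H" "c \<in> arrs H" "ale H a c" "ale H b c" "src H a = src H b"
  shows "a = b"
  using restr_eqI[of a c] restr_eqI[of b c] assms by metis

text \<open>Uniqueness of corestriction, obtained from \<open>ale_same_src\<close> by
  inversion.\<close>

lemma ale_same_trg:
  assumes "a \<in> arrs H" "b \<in> arrs H" "c \<in> arrs H" "ale H a c" "ale H b c" "trg H a = trg H b"
  shows "a = b"
proof -
  have "inv_arr H a = inv_arr H b"
    using assms by (intro ale_same_src[of _ _ "inv_arr H c"] ale_inv) simp_all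
  then show ?thesis
    using assms by (metis category.inv_inv cat isoI)
qed

lemma restr_src: "f \<in> arrs H \<Longrightarrow> src H f = A \<Longrightarrow> restr H f A = f"
  by (rule restr_eqI) (auto intro: ale_refl)

text \<open>The composite of the restrictions has source \<open>A\<close> and lies below
  \<open>cmp H g f\<close> by monotonicity, so it is the restriction.\<close>

lemma restr_cmp:
  assumes "f \<in> arrs H" "g \<in> arrs H" "src H g = trg H f" "A \<in> obs H" "obj_le H A (src H f)"
  shows "restr H (cmp H g f) A = cmp H (restr H g (trg H (restr H f A))) (restr H f A)"
proof (rule restr_eqI)
  have f: "restr H f A \<in> arrs H" "src H (restr H f A) = A" "ale H (restr H f A) f"
    using restr_prop assms by auto
  have "obj_le H (trg H (restr H f A)) (src H g)"
    using ale_trg[of "restr H f A" f] f assms by simp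
  then have g: "restr H g (trg H (restr H f A)) \<in> arrs H"
    "src H (restr H g (trg H (restr H f A))) = trg H (restr H f A)"
    "ale H (restr H g (trg H (restr H f A))) g"
    using restr_prop[of g "trg H (restr H f A)"] f assms by auto
  show "ale H (cmp H (restr H g (trg H (restr H f A))) (restr H f A)) (cmp H g f)"
    using f g assms by (intro ale_cmp) simp_all
qed (use assms restr_prop[of f A] ale_trg[of "restr H f A" f] restr_prop[of g "trg H (restr H f A)"] in auto)

lemma obj_le_trg_restr: "\<lbrakk>f \<in> arrs H; A \<in> obs H; obj_le H A (src H f)\<rbrakk>
   \<Longrightarrow> obj_le H (trg H (restr H f A)) (trg H f)"
  using restr_prop[of f A] ale_trg[of "restr H f A" f] by simp

lemma restr_idt: "\<lbrakk>A \<in> obs H; B \<in> obs H; obj_le H A B\<rbrakk> \<Longrightarrow> restr H (idt H B) A = idt H A"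
  by (intro restr_eqI ale_idt) simp_all

lemma restr_restr:
  assumes "f \<in> arrs H" "A \<in> obs H" "obj_le H A (src H f)" "B \<in> obs H" "obj_le H B A"
  shows "restr H (restr H f A) B = restr H f B"
proof -
  have f: "restr H f A \<in> arrs H" "src H (restr H f A) = A" "ale H (restr H f A) f"
    using restr_prop assms by auto
  then have "restr H (restr H f A) B \<in> arrs H \<and> src H (restr H (restr H f A) B) = B \<and>
     ale H (restr H (restr H f A) B) (restr H f A)"
    using assms by (intro restr_prop) auto
  then show ?thesis using f assms by (metis restr_eqI ale_trans)
qed

end

declare ordered_groupoid.obj_le_refl [simp]

lemma restr_simps [simp]:
  assumes "ordered_groupoid H" "f \<in> arrs H" "A \<in> obs H" "obj_le H A (src H f)"
  shows "restr H f A \<in> arrs H" "src H (restr H f A) = A" "ale H (restr H f A) f"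
  using ordered_groupoid.restr_prop[OF assms] by simp_all

lemma obj_le_trg_restr [simp]:
  assumes "ordered_groupoid H" "f \<in> arrs H" "A \<in> obs H" "obj_le H A (src H f)" "trg H f = B"
  shows "obj_le H (trg H (restr H f A)) B"
  using ordered_groupoid.obj_le_trg_restr[OF assms(1-4)] assms(5) by simp

lemma og_functors_simps [simp]:
  assumes "F \<in> og_functors"
  shows "functor_mor F" "msrc F \<in> ogpds" "mtrg F \<in> ogpds"
  using assms unfolding og_functors_def by auto

lemma og_functors_groupoid [simp]:
  assumes "F \<in> og_functors"
  shows "ordered_groupoid (msrc F)" "ordered_groupoid (mtrg F)"
  using assms by (auto intro: ogpdsD)

lemma og_functorsI: "\<lbrakk>functor_mor F; msrc F \<in> ogpds; mtrg F \<in> ogpds;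
    \<And>h k. \<lbrakk>h \<in> arrs (msrc F); k \<in> arrs (msrc F); ale (msrc F) h k\<rbrakk> \<Longrightarrow> ale (mtrg F) (mar F h) (mar F k)\<rbrakk>
   \<Longrightarrow> F \<in> og_functors"
  unfolding og_functors_def by blast

lemma mar_mono:
  assumes "F \<in> og_functors" "ale C h k" "msrc F = C" "mtrg F = D" "h \<in> arrs C" "k \<in> arrs C"
  shows "ale D (mar F h) (mar F k)"
  using assms unfolding og_functors_def by auto

lemma mob_mono:
  assumes "F \<in> og_functors" "obj_le C A B" "msrc F = C" "mtrg F = D" "A \<in> obs C" "B \<in> obs C"
  shows "obj_le D (mob F A) (mob F B)"
  using assms mar_mono[of F C "idt C A" "idt C B" D] unfolding obj_le_def by auto

text \<open>The image of the restriction lies below \<open>mar F f\<close> by monotonicity and has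
  source \<open>mob F A\<close>; restrictions are unique.\<close>

lemma mar_restr:
  assumes F: "F \<in> og_functors" and C: "msrc F = C" and D: "mtrg F = D"
    and f: "f \<in> arrs C" "A \<in> obs C" "obj_le C A (src C f)"
  shows "mar F (restr C f A) = restr D (mar F f) (mob F A)"
proof -
  have "ordered_groupoid C" "ordered_groupoid D"
    using F C D by auto
  then show ?thesis
    using assms by (intro ordered_groupoid.restr_eqI[symmetric] mar_mono[OF F]) auto
qed

lemma id_mor_og [simp]: "C \<in> ogpds \<Longrightarrow> id_mor C \<in> og_functors"
  by (rule og_functorsI) (auto dest: ogpdsD)

lemma comp_mor_og [simp]: "\<lbrakk>F \<in> og_functors; G \<in> og_functors; msrc G = mtrg F\<rbrakk>
    \<Longrightarrow> comp_mor G F \<in> og_functors"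
  by (rule og_functorsI) (auto intro!: mar_mono)

lemma category_og_functors:
  "category \<lparr>obs = ogpds, arrs = og_functors, src = msrc, trg = mtrg, idt = id_mor, cmp = comp_mor\<rparr>"
  by (rule category_of_functors) (auto dest: ogpdsD)

section \<open>\<Lambda>-transformations\<close>

lemma lambdas_simps [simp]:
  assumes "\<alpha> \<in> lambdas"
  shows "lsrc \<alpha> \<in> og_functors" "ltrg \<alpha> \<in> og_functors" "lmid \<alpha> \<in> og_functors"
    "msrc (ltrg \<alpha>) = msrc (lsrc \<alpha>)" "mtrg (ltrg \<alpha>) = mtrg (lsrc \<alpha>)"
    "msrc (lmid \<alpha>) = msrc (lsrc \<alpha>)" "mtrg (lmid \<alpha>) = mtrg (lsrc \<alpha>)"
  using assms unfolding lambdas_def functor_le_def horizontal_trans_def parallel_def by auto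

lemma lcomp_simps [simp]:
  assumes "\<alpha> \<in> lambdas" "A \<in> obs (msrc (lsrc \<alpha>))" "mtrg (lsrc \<alpha>) = D"
  shows "lcomp \<alpha> A \<in> arrs D" "src D (lcomp \<alpha> A) = mob (lsrc \<alpha>) A"
    "trg D (lcomp \<alpha> A) = mob (lmid \<alpha>) A"
  using assms unfolding lambdas_def horizontal_trans_def Let_def by auto

lemma lcomp_natural:
  assumes "\<alpha> \<in> lambdas" "f \<in> arrs (msrc (lsrc \<alpha>))" "mtrg (lsrc \<alpha>) = D"
    "src (msrc (lsrc \<alpha>)) f = A" "trg (msrc (lsrc \<alpha>)) f = B"
  shows "cmp D (mar (lmid \<alpha>) f) (lcomp \<alpha> A) = cmp D (lcomp \<alpha> B) (mar (lsrc \<alpha>) f)"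
  using assms unfolding lambdas_def horizontal_trans_def Let_def by auto

lemma lcomp_mono:
  assumes "\<alpha> \<in> lambdas" "obj_le C A B" "msrc (lsrc \<alpha>) = C" "mtrg (lsrc \<alpha>) = D" "A \<in> obs C" "B \<in> obs C"
  shows "ale D (lcomp \<alpha> A) (lcomp \<alpha> B)"
  using assms unfolding lambdas_def horizontal_trans_def Let_def by auto

lemma lcomp_extensional: "\<alpha> \<in> lambdas \<Longrightarrow> lcomp \<alpha> \<in> extensional (obs (msrc (lsrc \<alpha>)))"
  unfolding lambdas_def horizontal_trans_def Let_def by auto

lemma lmid_mar_le [simp]:
  assumes "\<alpha> \<in> lambdas" "f \<in> arrs (msrc (lsrc \<alpha>))" "mtrg (lsrc \<alpha>) = D"
  shows "ale D (mar (lmid \<alpha>) f) (mar (ltrg \<alpha>) f)"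
  using assms lambdas_simps(6,7)[OF assms(1)] unfolding lambdas_def functor_le_def by auto

lemma lmid_mob_le [simp]:
  assumes "\<alpha> \<in> lambdas" "A \<in> obs (msrc (lsrc \<alpha>))" "mtrg (lsrc \<alpha>) = D"
  shows "obj_le D (mob (lmid \<alpha>) A) (mob (ltrg \<alpha>) A)"
  using assms lmid_mar_le[of \<alpha> "idt (msrc (lsrc \<alpha>)) A" D]
  by (simp add: obj_le_def del: lmid_mar_le)

text \<open>Recovers the intermediate double functor on arrows from the target functor and from its
  own values on objects.\<close>

lemma restr_ltrg:
  assumes "\<alpha> \<in> lambdas" "f \<in> arrs (msrc (lsrc \<alpha>))" "mtrg (lsrc \<alpha>) = D" "src (msrc (lsrc \<alpha>)) f = A"
  shows "restr D (mar (ltrg \<alpha>) f) (mob (lmid \<alpha>) A) = mar (lmid \<alpha>) f"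
proof -
  have "ordered_groupoid D" using assms by auto
  then show ?thesis using assms by (intro ordered_groupoid.restr_eqI) auto
qed

text \<open>Monotonicity of the components turned into an equation; this is what naturality of
  \<open>L2 \<alpha>\<close> amounts to at the arrow given by an inequality
  \<open>A \<le> B\<close>.\<close>

lemma restr_lcomp:
  assumes "\<alpha> \<in> lambdas" "obj_le C A B" "msrc (lsrc \<alpha>) = C" "mtrg (lsrc \<alpha>) = D" "A \<in> obs C" "B \<in> obs C"
  shows "restr D (lcomp \<alpha> B) (mob (lsrc \<alpha>) A) = lcomp \<alpha> A"
proof -
  have "ordered_groupoid D" using assms by auto
  then show ?thesis
    using assms by (intro ordered_groupoid.restr_eqI lcomp_mono) auto
qed

text \<open>\<open>mob (lmid \<alpha>) A\<close> is the target of the component at \<open>A\<close>;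
  with the objects known, \<open>restr_ltrg\<close> gives the arrows.\<close>

lemma lambdas_eqI:
  assumes a: "\<alpha> \<in> lambdas" "\<beta> \<in> lambdas" and s: "lsrc \<alpha> = lsrc \<beta>" "ltrg \<alpha> = ltrg \<beta>"
    and c: "\<And>A. A \<in> obs (msrc (lsrc \<alpha>)) \<Longrightarrow> lcomp \<alpha> A = lcomp \<beta> A"
  shows "\<alpha> = \<beta>"
proof -
  have lc: "lcomp \<alpha> = lcomp \<beta>"
    by (rule extensionalityI[of _ "obs (msrc (lsrc \<alpha>))"])
       (use assms lcomp_extensional[of \<alpha>] lcomp_extensional[of \<beta>] in simp_all)
  have mob: "mob (lmid \<alpha>) A = mob (lmid \<beta>) A" if "A \<in> obs (msrc (lsrc \<alpha>))" for A
    using lcomp_simps(3)[OF a(1) that refl] lcomp_simps(3)[OF a(2), of A] that s lc by simp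
  have "lmid \<alpha> = lmid \<beta>"
  proof (rule functor_mor_eqI)
    fix f assume f: "f \<in> arrs (msrc (lmid \<alpha>))"
    have "category (msrc (lsrc \<alpha>))" using a by simp
    then show "mar (lmid \<alpha>) f = mar (lmid \<beta>) f"
      using restr_ltrg[OF a(1) _ refl refl, of f] restr_ltrg[OF a(2) _ refl refl, of f] a s f mob
      by simp
  qed (use a s mob in simp_all)
  then show ?thesis using s lc by simp
qed

text \<open>The intermediate double functor of a \<open>\<Lambda>\<close>-transformation is forced by naturality and by its
  position below the target, so its functoriality need not be checked separately.\<close>

lemma lambdasI:
  assumes F: "lsrc \<alpha> = F" "F \<in> og_functors" and G: "ltrg \<alpha> = G" "G \<in> og_functors"
    and M: "lmid \<alpha> = M"
    and C: "msrc F = C" "msrc G = C" "msrc M = C" and D: "mtrg F = D" "mtrg G = D" "mtrg M = D"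
    and ext: "lcomp \<alpha> \<in> extensional (obs C)" "mob M \<in> extensional (obs C)"
      "mar M \<in> extensional (arrs C)"
    and comp: "\<And>A. A \<in> obs C \<Longrightarrow> lcomp \<alpha> A \<in> arrs D \<and>
      src D (lcomp \<alpha> A) = mob F A \<and> trg D (lcomp \<alpha> A) = mob M A"
    and mono: "\<And>A B. \<lbrakk>A \<in> obs C; B \<in> obs C; obj_le C A B\<rbrakk> \<Longrightarrow> ale D (lcomp \<alpha> A) (lcomp \<alpha> B)"
    and mar: "\<And>f. f \<in> arrs C \<Longrightarrow> mar M f \<in> arrs D \<and> src D (mar M f) = mob M (src C f) \<and>
      ale D (mar M f) (mar G f) \<and>
      cmp D (mar M f) (lcomp \<alpha> (src C f)) = cmp D (lcomp \<alpha> (trg C f)) (mar F f)"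
  shows "\<alpha> \<in> lambdas"
proof -
  interpret C: ordered_groupoid C using F C by auto
  interpret D: ordered_groupoid D using F D by auto
  have mob: "mob M A \<in> obs D" if "A \<in> obs C" for A
    using comp[OF that] D.trg_obs by metis
  \<comment> \<open>The target of \<open>mar M f\<close> is read off the naturality square, whose
    other side ends where the component at \<open>trg C f\<close> ends.\<close>
  have trg: "trg D (mar M f) = mob M (trg C f)" if f: "f \<in> arrs C" for f
  proof -
    have "trg D (mar M f) = trg D (cmp D (mar M f) (lcomp \<alpha> (src C f)))"
      using comp[of "src C f"] mar[OF f] f by (intro D.trg_cmp[symmetric]) simp_all
    also have "\<dots> = mob M (trg C f)" using comp mar[OF f] f F C D by simp
    finally show ?thesis .
  qed
  have le: "obj_le D (mob M A) (mob G A)" if A: "A \<in> obs C" for A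
    using D.ale_src[of "mar M (idt C A)" "mar G (idt C A)"] mar[of "idt C A"] A G C D by simp
  have fm: "functor_mor M"
    unfolding functor_mor_def C D
  proof (intro conjI ext cat_functor.intro C.category_axioms D.category_axioms cat_functor_axioms.intro)
    fix A assume A: "A \<in> obs C"
    \<comment> \<open>Each functor law for \<open>M\<close> equates two arrows that have the same
      source and lie below the same value of \<open>G\<close>.\<close>
    show "mar M (idt C A) = idt D (mob M A)"
      by (rule D.ale_same_src[where c = "mar G (idt C A)"])
         (use A mar[of "idt C A"] mob G C D le[OF A] in \<open>simp_all add: D.ale_idt\<close>)
  next
    fix g f assume f: "g \<in> arrs C" "f \<in> arrs C" "src C g = trg C f"
    show "mar M (cmp C g f) = cmp D (mar M g) (mar M f)"
    proof (rule D.ale_same_src[where c = "mar G (cmp C g f)"])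
      have "ale D (cmp D (mar M g) (mar M f)) (cmp D (mar G g) (mar G f))"
        using f mar trg G C D by (intro D.ale_cmp) simp_all
      then show "ale D (cmp D (mar M g) (mar M f)) (mar G (cmp C g f))"
        using f G C D by simp
      show "ale D (mar M (cmp C g f)) (mar G (cmp C g f))"
        using mar[of "cmp C g f"] f by simp
    qed (use f mar trg G C D in simp_all)
  qed (use mob mar trg in simp_all)
  have og: "M \<in> og_functors"
  proof (rule og_functorsI[OF fm])
    fix h k assume "h \<in> arrs (msrc M)" "k \<in> arrs (msrc M)" "ale (msrc M) h k"
    then have hk: "h \<in> arrs C" "k \<in> arrs C" "ale C h k" using C by auto
    \<comment> \<open>\<open>mar M h\<close> turns out to be the restriction \<open>?r\<close> of
      \<open>mar M k\<close>, since both lie below \<open>mar G k\<close>. The restriction exists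
      because the targets of the monotone components give the inequality between
      \<open>mob M (src C h)\<close> and \<open>mob M (src C k)\<close>.\<close>
    let ?r = "restr D (mar M k) (mob M (src C h))"
    have "obj_le C (src C h) (src C k)" using hk C.ale_src by simp
    then have "ale D (lcomp \<alpha> (src C h)) (lcomp \<alpha> (src C k))" using hk by (intro mono) simp_all
    then have "obj_le D (mob M (src C h)) (mob M (src C k))"
      using D.ale_trg[of "lcomp \<alpha> (src C h)" "lcomp \<alpha> (src C k)"] comp hk by simp
    then have r: "?r \<in> arrs D" "src D ?r = mob M (src C h)" "ale D ?r (mar M k)"
      using D.restr_prop[of "mar M k" "mob M (src C h)"] mar mob hk by auto
    have "?r = mar M h"
    proof (rule D.ale_same_src[where c = "mar G k"])
      show "ale D ?r (mar G k)"
        using r mar[OF hk(2)] hk G C D by (intro D.ale_trans[OF _ _ _ r(3)]) simp_all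
      have "ale D (mar G h) (mar G k)" using hk G C D by (intro mar_mono) simp_all
      then show "ale D (mar M h) (mar G k)"
        by (rule D.ale_trans[of _ "mar G h", rotated 4]) (use mar[OF hk(1)] hk G C D in simp_all)
    qed (use r mar[OF hk(1)] hk G C D in simp_all)
    then show "ale (mtrg M) (mar M h) (mar M k)" using r D by simp
  qed (use F C D in auto)
  show ?thesis
    unfolding lambdas_def functor_le_def horizontal_trans_def parallel_def Let_def
    using F G M C D og ext comp mono mar by auto
qed

section \<open>The left-cancellative category \<open>L0 H\<close>\<close>

lemma L0_sel [simp]: "obs (L0 H) = obs H"
  "src (L0 H) (pair h B) = src H h" "trg (L0 H) (pair h B) = B" "idt (L0 H) A = pair (idt H A) A"
  "cmp (L0 H) (pair k D) (pair h B) = pair (cmp H (restr H k (trg H h)) h) D"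
  "pair h B \<in> arrs (L0 H) \<longleftrightarrow> h \<in> arrs H \<and> B \<in> obs H \<and> obj_le H (trg H h) B"
  by (auto simp: L0_def)

lemma L0_arrE:
  assumes "p \<in> arrs (L0 H)"
  obtains h B where "p = pair h B" "h \<in> arrs H" "B \<in> obs H" "obj_le H (trg H h) B"
  using assms unfolding L0_def by auto

text \<open>The unit laws hold because an identity restricts to an identity; associativity holds
  because a restricted composite splits by \<open>restr_cmp\<close> and repeated restrictions merge
  by \<open>restr_restr\<close>.\<close>

lemma category_L0 [simp]:
  assumes "ordered_groupoid H"
  shows "category (L0 H)"
proof -
  interpret H: ordered_groupoid H by fact
  show ?thesis
  proof (rule category.intro)
    fix f assume "f \<in> arrs (L0 H)"
    then obtain h B where [simp]: "f = pair h B" "h \<in> arrs H" "B \<in> obs H" "obj_le H (trg H h) B"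
      by (rule L0_arrE)
    show "src (L0 H) f \<in> obs (L0 H)" "trg (L0 H) f \<in> obs (L0 H)" by simp_all
    show "cmp (L0 H) f (idt (L0 H) (src (L0 H) f)) = f" by (simp add: H.restr_src)
    show "cmp (L0 H) (idt (L0 H) (trg (L0 H) f)) f = f" by (simp add: H.restr_idt)
    fix g assume "g \<in> arrs (L0 H)" and s: "src (L0 H) g = trg (L0 H) f"
    then obtain k D where [simp]: "g = pair k D" "k \<in> arrs H" "D \<in> obs H" "obj_le H (trg H k) D"
      by (auto elim: L0_arrE)
    have [simp]: "src H k = B" using s by simp
    have [simp]: "obj_le H (trg H (restr H k (trg H h))) D"
      by (rule H.obj_le_trans[of _ "trg H k"]) simp_all
    show "cmp (L0 H) g f \<in> arrs (L0 H)" "src (L0 H) (cmp (L0 H) g f) = src (L0 H) f"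
      "trg (L0 H) (cmp (L0 H) g f) = trg (L0 H) g"
      by simp_all
    fix l assume "l \<in> arrs (L0 H)" and s: "src (L0 H) l = trg (L0 H) g"
    then obtain m E where [simp]: "l = pair m E" "m \<in> arrs H" "E \<in> obs H" "obj_le H (trg H m) E"
      by (auto elim: L0_arrE)
    have [simp]: "src H m = D" using s by simp
    show "cmp (L0 H) (cmp (L0 H) l g) f = cmp (L0 H) l (cmp (L0 H) g f)"
      by (simp add: H.restr_cmp H.restr_restr)
  qed simp_all
qed

text \<open>Equal composites force the two restrictions of \<open>k\<close> to have the same target,
  so they coincide by uniqueness of corestriction; being invertible, they cancel.\<close>

lemma left_cancellative_L0:
  assumes "ordered_groupoid H"
  shows "left_cancellative (L0 H)"
proof -
  interpret H: ordered_groupoid H by fact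
  show ?thesis
    unfolding left_cancellative_def mono_arr_def
  proof (intro ballI conjI impI)
    fix m f g assume "m \<in> arrs (L0 H)" "f \<in> arrs (L0 H)" "g \<in> arrs (L0 H)"
      and s: "src (L0 H) f = src (L0 H) g" "trg (L0 H) f = src (L0 H) m" "trg (L0 H) g = src (L0 H) m"
      and eq: "cmp (L0 H) m f = cmp (L0 H) m g"
    obtain k D where [simp]: "m = pair k D" "k \<in> arrs H" "D \<in> obs H" "obj_le H (trg H k) D"
      using \<open>m \<in> arrs (L0 H)\<close> by (rule L0_arrE)
    obtain h B where [simp]: "f = pair h B" "h \<in> arrs H" "B \<in> obs H" and le: "obj_le H (trg H h) B"
      using \<open>f \<in> arrs (L0 H)\<close> by (rule L0_arrE)
    obtain h' B' where [simp]: "g = pair h' B'" "h' \<in> arrs H" "B' \<in> obs H"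
      and le': "obj_le H (trg H h') B'"
      using \<open>g \<in> arrs (L0 H)\<close> by (rule L0_arrE)
    define r r' where r_def: "r = restr H k (trg H h)" and r'_def: "r' = restr H k (trg H h')"
    have [simp]: "src H k = B" "B' = B" "src H h = src H h'" using s by auto
    have [simp]: "obj_le H (trg H h) B" "obj_le H (trg H h') B" using le le' by simp_all
    have r [simp]: "r \<in> arrs H" "src H r = trg H h" "r' \<in> arrs H" "src H r' = trg H h'"
      and rk: "ale H r k" "ale H r' k"
      by (simp_all add: r_def r'_def)
    have e: "cmp H r h = cmp H r' h'" using eq by (simp add: r_def r'_def)
    have "trg H r = trg H (cmp H r h)" by simp
    also have "\<dots> = trg H r'" unfolding e by simp
    finally have "r = r'" using rk by (intro H.ale_same_trg[of r r' k]) simp_all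
    have "h = cmp H (inv_arr H r) (cmp H r h)" by simp
    also have "\<dots> = cmp H (inv_arr H r') (cmp H r' h')" unfolding e by (simp only: \<open>r = r'\<close>)
    also have "\<dots> = h'" by simp
    finally have "h = h'" .
    then show "f = g" by simp
  qed
qed

lemma small_cat_L0: "H \<in> ogpds \<Longrightarrow> small_cat (L0 H)"
proof -
  assume H: "H \<in> ogpds"
  have "small (arrs H)" "small (obs H)" using ogpdsD(2)[OF H] by (auto simp: small_cat_def)
  then have "small (arrs (L0 H))"
    by (rule small_subset[OF small_pairs]) (auto elim: L0_arrE)
  then show ?thesis using ogpdsD[OF H] by (simp add: small_cat_def)
qed

lemma L0_lc [simp]: "H \<in> ogpds \<Longrightarrow> L0 H \<in> lc_cats"
  unfolding lc_cats_def using small_cat_L0 left_cancellative_L0 ogpdsD by auto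

section \<open>L on 1-cells and 2-cells\<close>

lemma L1_sel [simp]: "msrc (L1 F) = L0 (msrc F)" "mtrg (L1 F) = L0 (mtrg F)" "mob (L1 F) = mob F"
  "\<lbrakk>h \<in> arrs (msrc F); B \<in> obs (msrc F); obj_le (msrc F) (trg (msrc F) h) B\<rbrakk>
    \<Longrightarrow> mar (L1 F) (pair h B) = pair (mar F h) (mob F B)"
  by (simp_all add: L1_def)

lemma L1_lc [simp]:
  assumes F: "F \<in> og_functors"
  shows "L1 F \<in> lc_functors"
proof (rule lc_functorsI)
  obtain C D where [simp]: "msrc F = C" "mtrg F = D" by blast
  interpret C: ordered_groupoid C using og_functors_groupoid[OF F] by simp
  interpret D: ordered_groupoid D using og_functors_groupoid[OF F] by simp
  show "functor_mor (L1 F)"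
    unfolding functor_mor_def L1_sel
  proof (intro conjI cat_functor.intro cat_functor_axioms.intro)
    show "mob F \<in> extensional (obs (L0 (msrc F)))"
      using F by (simp add: mob_extensional del: \<open>msrc F = C\<close>)
    show "mar (L1 F) \<in> extensional (arrs (L0 (msrc F)))"
      by (simp add: L1_def)
  next
    fix f assume "f \<in> arrs (L0 (msrc F))"
    then obtain h B where [simp]: "f = pair h B" "h \<in> arrs C" "B \<in> obs C" "obj_le C (trg C h) B"
      by (auto elim: L0_arrE)
    show "mar (L1 F) f \<in> arrs (L0 (mtrg F))" using F mob_mono[OF F, of C "trg C h" B D] by simp
    show "src (L0 (mtrg F)) (mar (L1 F) f) = mob F (src (L0 (msrc F)) f)"
      "trg (L0 (mtrg F)) (mar (L1 F) f) = mob F (trg (L0 (msrc F)) f)" using F by simp_all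
    fix g assume "g \<in> arrs (L0 (msrc F))" "src (L0 (msrc F)) g = trg (L0 (msrc F)) f"
    then obtain k E where [simp]: "g = pair k E" "k \<in> arrs C" "E \<in> obs C" "obj_le C (trg C k) E"
        "src C k = B"
      by (auto elim: L0_arrE)
    have [simp]: "obj_le C (trg C (restr C k (trg C h))) E"
      by (rule C.obj_le_trans[of _ "trg C k"]) simp_all
    show "mar (L1 F) (cmp (L0 (msrc F)) g f) = cmp (L0 (mtrg F)) (mar (L1 F) g) (mar (L1 F) f)"
      using F by (simp add: mar_restr)
  qed (use F in simp_all)
qed (use F in simp_all)

lemma L1_id: "C \<in> ogpds \<Longrightarrow> L1 (id_mor C) = id_mor (L0 C)"
  by (rule functor_mor_eqI) (auto elim!: L0_arrE dest: ogpdsD)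

lemma L1_comp: "\<lbrakk>F \<in> og_functors; G \<in> og_functors; msrc G = mtrg F\<rbrakk>
    \<Longrightarrow> L1 (comp_mor G F) = comp_mor (L1 G) (L1 F)"
  by (rule functor_mor_eqI) (auto elim!: L0_arrE simp: mob_mono)

lemma L2_sel [simp]: "nsrc (L2 \<alpha>) = L1 (lsrc \<alpha>)" "ntrg (L2 \<alpha>) = L1 (ltrg \<alpha>)"
  "A \<in> obs (msrc (lsrc \<alpha>)) \<Longrightarrow> ncomp (L2 \<alpha>) A = pair (lcomp \<alpha> A) (mob (ltrg \<alpha>) A)"
  by (simp_all add: L2_def)

text \<open>An arrow of \<open>L0\<close> is a groupoid arrow followed by an inequality. The square
  for the former is horizontal naturality, that for the latter is \<open>restr_lcomp\<close>;
  \<open>restr_ltrg\<close> replaces the restricted target functor by the intermediate one.\<close>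

lemma L2_lc [simp]:
  assumes a: "\<alpha> \<in> lambdas"
  shows "L2 \<alpha> \<in> lc_nats"
proof (rule lc_natsI)
  fix f assume "f \<in> arrs (msrc (nsrc (L2 \<alpha>)))"
  then obtain h B where f: "f = pair h B" "h \<in> arrs (msrc (lsrc \<alpha>))" "B \<in> obs (msrc (lsrc \<alpha>))"
    "obj_le (msrc (lsrc \<alpha>)) (trg (msrc (lsrc \<alpha>)) h) B"
    by (auto elim: L0_arrE)
  have "category (msrc (lsrc \<alpha>))" "category (mtrg (lsrc \<alpha>))" using a by simp_all
  then show "cmp (mtrg (nsrc (L2 \<alpha>))) (mar (ntrg (L2 \<alpha>)) f) (ncomp (L2 \<alpha>) (src (msrc (nsrc (L2 \<alpha>))) f)) =
         cmp (mtrg (nsrc (L2 \<alpha>))) (ncomp (L2 \<alpha>) (trg (msrc (nsrc (L2 \<alpha>))) f)) (mar (nsrc (L2 \<alpha>)) f)"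
    using a f by (simp add: restr_ltrg restr_lcomp lcomp_natural)
qed (use a in \<open>simp_all add: L2_def\<close>)

text \<open>Faithfulness on 2-cells between fixed 1-cells: a component of \<open>L2 \<alpha>\<close>
  is a pair containing that of \<alpha>, and components suffice by
  \<open>lambdas_eqI\<close>.\<close>

lemma L2_reflect:
  assumes "\<alpha> \<in> lambdas" "\<beta> \<in> lambdas" "lsrc \<alpha> = lsrc \<beta>" "ltrg \<alpha> = ltrg \<beta>" "L2 \<alpha> = L2 \<beta>"
  shows "\<alpha> = \<beta>"
proof (rule lambdas_eqI[OF assms(1-4)])
  fix A assume "A \<in> obs (msrc (lsrc \<alpha>))"
  then show "lcomp \<alpha> A = lcomp \<beta> A"
    using assms L2_sel(3)[of A \<alpha>] L2_sel(3)[of A \<beta>] by simp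
qed

lemma lambda_id_sel [simp]: "lsrc (lambda_id F) = F" "ltrg (lambda_id F) = F" "lmid (lambda_id F) = F"
  "A \<in> obs (msrc F) \<Longrightarrow> lcomp (lambda_id F) A = idt (mtrg F) (mob F A)"
  by (simp_all add: lambda_id_def)

lemma lambda_id_lambdas [simp]:
  assumes "F \<in> og_functors"
  shows "lambda_id F \<in> lambdas"
proof (rule lambdasI[OF _ assms _ assms, where C = "msrc F" and D = "mtrg F"])
  show "lcomp (lambda_id F) \<in> extensional (obs (msrc F))" by (simp add: lambda_id_def)
  show "mob F \<in> extensional (obs (msrc F))" "mar F \<in> extensional (arrs (msrc F))"
    using assms by (simp_all add: mob_extensional mar_extensional)
next
  fix A B assume "A \<in> obs (msrc F)" "B \<in> obs (msrc F)" "obj_le (msrc F) A B"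
  then show "ale (mtrg F) (lcomp (lambda_id F) A) (lcomp (lambda_id F) B)"
    using mob_mono[OF assms _ refl refl] assms by (simp add: obj_le_def)
qed (use assms in simp_all)

lemma L2_id: "F \<in> og_functors \<Longrightarrow> L2 (lambda_id F) = nat_id (L1 F)"
  by (rule lc_nats_eqI) simp_all

lemma lambda_vcomp_sel [simp]: "lsrc (lambda_vcomp \<gamma> \<alpha>) = lsrc \<alpha>" "ltrg (lambda_vcomp \<gamma> \<alpha>) = ltrg \<gamma>"
  "A \<in> obs (msrc (lsrc \<alpha>)) \<Longrightarrow> lcomp (lambda_vcomp \<gamma> \<alpha>) A =
     cmp (mtrg (lsrc \<alpha>)) (restr (mtrg (lsrc \<alpha>)) (lcomp \<gamma> A) (mob (lmid \<alpha>) A)) (lcomp \<alpha> A)"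
  by (simp_all add: lambda_vcomp_def Let_def)

lemma lambda_vcomp_lambdas [simp]:
  assumes a: "\<alpha> \<in> lambdas" and c: "\<gamma> \<in> lambdas" and s: "lsrc \<gamma> = ltrg \<alpha>"
  shows "lambda_vcomp \<gamma> \<alpha> \<in> lambdas"
proof -
  define C D where CD: "C = msrc (lsrc \<alpha>)" "D = mtrg (lsrc \<alpha>)"
  have [simp]: "msrc (lsrc \<alpha>) = C" "mtrg (lsrc \<alpha>) = D" by (simp_all add: CD)
  have [simp]: "msrc (ltrg \<gamma>) = C" "mtrg (ltrg \<gamma>) = D" "msrc (lmid \<gamma>) = C" "mtrg (lmid \<gamma>) = D"
    using lambdas_simps[OF c] a s by simp_all
  interpret C: ordered_groupoid C using og_functors_groupoid[OF lambdas_simps(1)[OF a]] by simp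
  interpret D: ordered_groupoid D using og_functors_groupoid[OF lambdas_simps(1)[OF a]] by simp
  define r where "r A = restr D (lcomp \<gamma> A) (mob (lmid \<alpha>) A)" for A
  have r: "r A \<in> arrs D" "src D (r A) = mob (lmid \<alpha>) A" "ale D (r A) (lcomp \<gamma> A)"
    "obj_le D (trg D (r A)) (mob (lmid \<gamma>) A)" if "A \<in> obs C" for A
    using a c s that by (simp_all add: r_def)
  \<comment> \<open>\<gamma> at \<open>A\<close> is a restriction of \<gamma> at \<open>B\<close>,
    so \<open>r A\<close> is one too; as \<open>mob (lmid \<alpha>) A\<close> lies below the source
    of \<open>r B\<close>, it is also a restriction of \<open>r B\<close>.\<close>
  have rmono: "ale D (r A) (r B)" if AB: "A \<in> obs C" "B \<in> obs C" "obj_le C A B" for A B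
  proof -
    have "obj_le D (mob (lmid \<alpha>) A) (mob (lmid \<alpha>) B)"
      using AB a by (intro mob_mono) auto
    moreover have "obj_le D (mob (lmid \<alpha>) B) (mob (lsrc \<gamma>) B)" using AB a s by simp
    ultimately have "obj_le D (mob (lmid \<alpha>) A) (src D (r B))"
      "r A = restr D (r B) (mob (lmid \<alpha>) A)"
      using r AB a c s restr_lcomp[OF c AB(3)] D.restr_restr[of "lcomp \<gamma> B" "mob (lmid \<alpha>) B" "mob (lmid \<alpha>) A"]
        D.restr_restr[of "lcomp \<gamma> B" "mob (lsrc \<gamma>) A" "mob (lmid \<alpha>) A"] mob_mono[of "lsrc \<gamma>" C A B D]
      by (simp_all add: r_def)
    then show ?thesis using r AB a by simp
  qed
  show ?thesis
  proof (rule lambdasI[OF refl _ refl _ refl])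
    show "lsrc (lambda_vcomp \<gamma> \<alpha>) \<in> og_functors" "ltrg (lambda_vcomp \<gamma> \<alpha>) \<in> og_functors"
      using a c by simp_all
    show "lcomp (lambda_vcomp \<gamma> \<alpha>) \<in> extensional (obs C)"
      "mob (lmid (lambda_vcomp \<gamma> \<alpha>)) \<in> extensional (obs C)"
      "mar (lmid (lambda_vcomp \<gamma> \<alpha>)) \<in> extensional (arrs C)"
      by (simp_all add: lambda_vcomp_def Let_def)
  next
    fix A assume A: "A \<in> obs C"
    show "lcomp (lambda_vcomp \<gamma> \<alpha>) A \<in> arrs D \<and>
         src D (lcomp (lambda_vcomp \<gamma> \<alpha>) A) = mob (lsrc (lambda_vcomp \<gamma> \<alpha>)) A \<and>
         trg D (lcomp (lambda_vcomp \<gamma> \<alpha>) A) = mob (lmid (lambda_vcomp \<gamma> \<alpha>)) A"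
      using A a r by (simp add: lambda_vcomp_def Let_def flip: r_def)
    fix B assume B: "B \<in> obs C" "obj_le C A B"
    show "ale D (lcomp (lambda_vcomp \<gamma> \<alpha>) A) (lcomp (lambda_vcomp \<gamma> \<alpha>) B)"
      using A B a r by (simp add: D.ale_cmp rmono lcomp_mono flip: r_def)
  next
    fix f assume f: "f \<in> arrs C"
    let ?A = "src C f" and ?B = "trg C f"
    let ?m = "restr D (mar (lmid \<gamma>) f) (trg D (r ?A))"
    have m: "?m \<in> arrs D" "src D ?m = trg D (r ?A)" "ale D ?m (mar (lmid \<gamma>) f)"
      using f r c by simp_all
    have le: "ale D ?m (mar (ltrg \<gamma>) f)"
      using f m c a s by (intro D.ale_trans[OF _ _ _ m(3)]) simp_all
    \<comment> \<open>The two composites have the same source and lie below the two equal sides of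
      the naturality square of \<gamma> at \<open>f\<close>. Composing with the component of
      \<alpha> then gives the square required by \<open>lambdasI\<close>.\<close>
    have "cmp D (r ?B) (mar (lmid \<alpha>) f) = cmp D ?m (r ?A)"
    proof (rule D.ale_same_src)
      show "ale D (cmp D (r ?B) (mar (lmid \<alpha>) f)) (cmp D (lcomp \<gamma> ?B) (mar (lsrc \<gamma>) f))"
        using f r a c s by (intro D.ale_cmp) simp_all
      have "ale D (cmp D ?m (r ?A)) (cmp D (mar (lmid \<gamma>) f) (lcomp \<gamma> ?A))"
        using f r m a c s by (intro D.ale_cmp) simp_all
      then show "ale D (cmp D ?m (r ?A)) (cmp D (lcomp \<gamma> ?B) (mar (lsrc \<gamma>) f))"
        using f a c s by (simp add: lcomp_natural)
    qed (use f r m a c s in simp_all)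
    then have "cmp D (cmp D (r ?B) (mar (lmid \<alpha>) f)) (lcomp \<alpha> ?A) = cmp D (cmp D ?m (r ?A)) (lcomp \<alpha> ?A)"
      by (rule arg_cong)
    then have eq: "cmp D ?m (cmp D (r ?A) (lcomp \<alpha> ?A)) = cmp D (cmp D (r ?B) (lcomp \<alpha> ?B)) (mar (lsrc \<alpha>) f)"
      using f r m a by (simp add: lcomp_natural)
    show "mar (lmid (lambda_vcomp \<gamma> \<alpha>)) f \<in> arrs D \<and>
         src D (mar (lmid (lambda_vcomp \<gamma> \<alpha>)) f) = mob (lmid (lambda_vcomp \<gamma> \<alpha>)) (src C f) \<and>
         ale D (mar (lmid (lambda_vcomp \<gamma> \<alpha>)) f) (mar (ltrg (lambda_vcomp \<gamma> \<alpha>)) f) \<and>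
         cmp D (mar (lmid (lambda_vcomp \<gamma> \<alpha>)) f) (lcomp (lambda_vcomp \<gamma> \<alpha>) (src C f)) =
         cmp D (lcomp (lambda_vcomp \<gamma> \<alpha>) (trg C f)) (mar (lsrc (lambda_vcomp \<gamma> \<alpha>)) f)"
      using f m le eq by (simp add: lambda_vcomp_def Let_def flip: r_def)
  qed (simp_all add: lambda_vcomp_def Let_def)
qed

text \<open>Composition in \<open>L0\<close> restricts its left factor to the target of the right
  one, and this is exactly the restriction made by \<open>lambda_vcomp\<close>.\<close>

lemma L2_vcomp:
  assumes a: "\<alpha> \<in> lambdas" and c: "\<gamma> \<in> lambdas" and s: "lsrc \<gamma> = ltrg \<alpha>"
  shows "L2 (lambda_vcomp \<gamma> \<alpha>) = nat_vcomp (L2 \<gamma>) (L2 \<alpha>)"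
proof (rule lc_nats_eqI)
  fix A assume "A \<in> obs (msrc (nsrc (L2 (lambda_vcomp \<gamma> \<alpha>))))"
  then show "ncomp (L2 (lambda_vcomp \<gamma> \<alpha>)) A = ncomp (nat_vcomp (L2 \<gamma>) (L2 \<alpha>)) A"
    using assms by simp
qed (use assms in simp_all)

section \<open>Whiskering and horizontal composition\<close>

lemma whisker_right_sel [simp]:
  "lsrc (lambda_whisker_right \<beta> F) = comp_mor (lsrc \<beta>) F"
  "ltrg (lambda_whisker_right \<beta> F) = comp_mor (ltrg \<beta>) F"
  "lmid (lambda_whisker_right \<beta> F) = comp_mor (lmid \<beta>) F"
  "A \<in> obs (msrc F) \<Longrightarrow> lcomp (lambda_whisker_right \<beta> F) A = lcomp \<beta> (mob F A)"
  by (simp_all add: lambda_whisker_right_def)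

lemma whisker_left_sel [simp]:
  "lsrc (lambda_whisker_left H \<alpha>) = comp_mor H (lsrc \<alpha>)"
  "ltrg (lambda_whisker_left H \<alpha>) = comp_mor H (ltrg \<alpha>)"
  "lmid (lambda_whisker_left H \<alpha>) = comp_mor H (lmid \<alpha>)"
  "A \<in> obs (msrc (lsrc \<alpha>)) \<Longrightarrow> lcomp (lambda_whisker_left H \<alpha>) A = mar H (lcomp \<alpha> A)"
  by (simp_all add: lambda_whisker_left_def)

lemma whisker_right_lambdas [simp]:
  assumes b: "\<beta> \<in> lambdas" and F: "F \<in> og_functors" and s: "msrc (lsrc \<beta>) = mtrg F"
  shows "lambda_whisker_right \<beta> F \<in> lambdas"
proof -
  have M: "functor_mor (comp_mor (lmid \<beta>) F)" using assms by simp
  show ?thesis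
  proof (rule lambdasI[OF whisker_right_sel(1) _ whisker_right_sel(2) _ whisker_right_sel(3)])
    show "lcomp (lambda_whisker_right \<beta> F) \<in> extensional (obs (msrc F))"
      by (simp add: lambda_whisker_right_def)
    show "mob (comp_mor (lmid \<beta>) F) \<in> extensional (obs (msrc F))"
      "mar (comp_mor (lmid \<beta>) F) \<in> extensional (arrs (msrc F))"
      using mob_extensional[OF M] mar_extensional[OF M] by simp_all
  next
    fix A B assume "A \<in> obs (msrc F)" "B \<in> obs (msrc F)" "obj_le (msrc F) A B"
    then show "ale (mtrg (lsrc \<beta>)) (lcomp (lambda_whisker_right \<beta> F) A) (lcomp (lambda_whisker_right \<beta> F) B)"
      using assms by (simp add: lcomp_mono[OF b _ s refl] mob_mono[OF F _ refl refl])
  next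
    fix f assume "f \<in> arrs (msrc F)"
    then show "mar (comp_mor (lmid \<beta>) F) f \<in> arrs (mtrg (lsrc \<beta>)) \<and>
         src (mtrg (lsrc \<beta>)) (mar (comp_mor (lmid \<beta>) F) f) = mob (comp_mor (lmid \<beta>) F) (src (msrc F) f) \<and>
         ale (mtrg (lsrc \<beta>)) (mar (comp_mor (lmid \<beta>) F) f) (mar (comp_mor (ltrg \<beta>) F) f) \<and>
         cmp (mtrg (lsrc \<beta>)) (mar (comp_mor (lmid \<beta>) F) f) (lcomp (lambda_whisker_right \<beta> F) (src (msrc F) f)) =
         cmp (mtrg (lsrc \<beta>)) (lcomp (lambda_whisker_right \<beta> F) (trg (msrc F) f)) (mar (comp_mor (lsrc \<beta>) F) f)"
      using assms by (simp add: lcomp_natural)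
  qed (use assms in simp_all)
qed

lemma whisker_left_lambdas [simp]:
  assumes a: "\<alpha> \<in> lambdas" and H: "H \<in> og_functors" and s: "msrc H = mtrg (lsrc \<alpha>)"
  shows "lambda_whisker_left H \<alpha> \<in> lambdas"
proof -
  have M: "functor_mor (comp_mor H (lmid \<alpha>))" using assms by simp
  show ?thesis
  proof (rule lambdasI[OF whisker_left_sel(1) _ whisker_left_sel(2) _ whisker_left_sel(3)])
    show "lcomp (lambda_whisker_left H \<alpha>) \<in> extensional (obs (msrc (lsrc \<alpha>)))"
      by (simp add: lambda_whisker_left_def)
    show "mob (comp_mor H (lmid \<alpha>)) \<in> extensional (obs (msrc (lsrc \<alpha>)))"
      "mar (comp_mor H (lmid \<alpha>)) \<in> extensional (arrs (msrc (lsrc \<alpha>)))"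
      using mob_extensional[OF M] mar_extensional[OF M] a by simp_all
  next
    fix A B assume "A \<in> obs (msrc (lsrc \<alpha>))" "B \<in> obs (msrc (lsrc \<alpha>))" "obj_le (msrc (lsrc \<alpha>)) A B"
    then show "ale (mtrg H) (lcomp (lambda_whisker_left H \<alpha>) A) (lcomp (lambda_whisker_left H \<alpha>) B)"
      using assms by (simp add: lcomp_mono[OF a _ refl refl] mar_mono[OF H _ s refl])
  next
    fix f assume f: "f \<in> arrs (msrc (lsrc \<alpha>))"
    let ?C = "msrc (lsrc \<alpha>)" and ?D = "mtrg (lsrc \<alpha>)"
    \<comment> \<open>The naturality square of \<alpha> transported by \<open>H\<close>; with
      \<open>mar_cmp\<close> switched off, the composite inside \<open>mar H\<close> is rewritten
      before \<open>H\<close> is distributed over it.\<close>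
    have "mar H (cmp ?D (mar (lmid \<alpha>) f) (lcomp \<alpha> (src ?C f))) = mar H (cmp ?D (lcomp \<alpha> (trg ?C f)) (mar (lsrc \<alpha>) f))"
      using f a by (simp add: lcomp_natural[OF a f] del: mar_cmp)
    then show "mar (comp_mor H (lmid \<alpha>)) f \<in> arrs (mtrg H) \<and>
         src (mtrg H) (mar (comp_mor H (lmid \<alpha>)) f) = mob (comp_mor H (lmid \<alpha>)) (src (msrc (lsrc \<alpha>)) f) \<and>
         ale (mtrg H) (mar (comp_mor H (lmid \<alpha>)) f) (mar (comp_mor H (ltrg \<alpha>)) f) \<and>
         cmp (mtrg H) (mar (comp_mor H (lmid \<alpha>)) f) (lcomp (lambda_whisker_left H \<alpha>) (src (msrc (lsrc \<alpha>)) f)) =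
         cmp (mtrg H) (lcomp (lambda_whisker_left H \<alpha>) (trg (msrc (lsrc \<alpha>)) f)) (mar (comp_mor H (lsrc \<alpha>)) f)"
      using assms f by simp (rule mar_mono[OF H _ s refl]; simp)
  qed (use assms in simp_all)
qed

lemma lambda_hcomp_lambdas [simp]:
  "\<lbrakk>\<alpha> \<in> lambdas; \<beta> \<in> lambdas; msrc (lsrc \<beta>) = mtrg (lsrc \<alpha>)\<rbrakk> \<Longrightarrow> lambda_hcomp \<beta> \<alpha> \<in> lambdas"
  unfolding lambda_hcomp_def by simp

lemma lambda_hcomp_sel [simp]:
  assumes "\<alpha> \<in> lambdas"
  shows "lsrc (lambda_hcomp \<beta> \<alpha>) = comp_mor (lsrc \<beta>) (lsrc \<alpha>)"
  "ltrg (lambda_hcomp \<beta> \<alpha>) = comp_mor (ltrg \<beta>) (ltrg \<alpha>)"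
  "A \<in> obs (msrc (lsrc \<alpha>)) \<Longrightarrow> lcomp (lambda_hcomp \<beta> \<alpha>) A =
    cmp (mtrg (lsrc \<beta>)) (restr (mtrg (lsrc \<beta>)) (lcomp \<beta> (mob (ltrg \<alpha>) A)) (mob (lsrc \<beta>) (mob (lmid \<alpha>) A)))
      (mar (lsrc \<beta>) (lcomp \<alpha> A))"
  using assms unfolding lambda_hcomp_def by simp_all

text \<open>Both horizontal composites place \<beta>, taken at the target of \<alpha>, after the
  image of \<alpha> under the source of \<beta>; composition in \<open>L0\<close> again supplies the
  restriction.\<close>

lemma L2_hcomp:
  assumes "\<alpha> \<in> lambdas" "\<beta> \<in> lambdas" "msrc (lsrc \<beta>) = mtrg (lsrc \<alpha>)"
  shows "L2 (lambda_hcomp \<beta> \<alpha>) = nat_hcomp (L2 \<beta>) (L2 \<alpha>)"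
proof (rule lc_nats_eqI)
  fix A assume "A \<in> obs (msrc (nsrc (L2 (lambda_hcomp \<beta> \<alpha>))))"
  then have A: "A \<in> obs (msrc (lsrc \<alpha>))" using assms by simp
  then show "ncomp (L2 (lambda_hcomp \<beta> \<alpha>)) A = ncomp (nat_hcomp (L2 \<beta>) (L2 \<alpha>)) A"
    using assms by simp
qed (use assms in \<open>simp_all add: L1_comp\<close>)

section \<open>The 2-category laws of \<open>oGpd\<close> and the 2-functor L\<close>

lemma category_lambdas:
  "category \<lparr>obs = og_functors, arrs = lambdas, src = lsrc, trg = ltrg, idt = lambda_id, cmp = lambda_vcomp\<rparr>"
proof (rule category.intro, simp_all)
  fix \<alpha> :: "'a lambda_trans" assume a: "\<alpha> \<in> lambdas"
  show "lambda_vcomp \<alpha> (lambda_id (lsrc \<alpha>)) = \<alpha>" "lambda_vcomp (lambda_id (ltrg \<alpha>)) \<alpha> = \<alpha>"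
    using a cmp_idt_right'[OF category_lc_nats, of "L2 \<alpha>"] cmp_idt_left'[OF category_lc_nats, of "L2 \<alpha>"]
    by (intro L2_reflect; simp add: L2_vcomp L2_id)+
  fix \<beta> \<gamma> :: "'a lambda_trans" assume "\<beta> \<in> lambdas" "\<gamma> \<in> lambdas" "lsrc \<alpha> = ltrg \<beta>" "lsrc \<beta> = ltrg \<gamma>"
  then show "lambda_vcomp (lambda_vcomp \<alpha> \<beta>) \<gamma> = lambda_vcomp \<alpha> (lambda_vcomp \<beta> \<gamma>)"
    using a category.cmp_assoc[OF category_lc_nats, of "L2 \<alpha>" "L2 \<beta>" "L2 \<gamma>"]
    by (intro L2_reflect; simp add: L2_vcomp)
qed

lemma two_category_oGpd: "two_category oGpd"
proof -
  interpret lc: two_category lcCat by (rule two_category_lcCat)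
  show ?thesis
    unfolding oGpd_def
  proof (rule two_category.intro, simp_all add: category_og_functors category_lambdas)
    fix \<alpha> :: "'a lambda_trans" assume a: "\<alpha> \<in> lambdas"
    show "lambda_hcomp \<alpha> (lambda_id (id_mor (msrc (lsrc \<alpha>)))) = \<alpha>"
      using a lc.hcmp_unit_right[of "L2 \<alpha>"]
      by (intro L2_reflect; simp add: lcCat_def L2_hcomp L2_id L1_id comp_mor_id_right)
    show "lambda_hcomp (lambda_id (id_mor (mtrg (lsrc \<alpha>)))) \<alpha> = \<alpha>"
      using a lc.hcmp_unit_left[of "L2 \<alpha>"]
      by (intro L2_reflect; simp add: lcCat_def L2_hcomp L2_id L1_id comp_mor_id_left)
  next
    fix \<gamma> \<beta> \<alpha> :: "'a lambda_trans"
    assume "\<gamma> \<in> lambdas \<and> \<beta> \<in> lambdas \<and> msrc (lsrc \<gamma>) = mtrg (lsrc \<beta>)"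
      "\<alpha> \<in> lambdas \<and> msrc (lsrc \<beta>) = mtrg (lsrc \<alpha>)"
    then show "lambda_hcomp (lambda_hcomp \<gamma> \<beta>) \<alpha> = lambda_hcomp \<gamma> (lambda_hcomp \<beta> \<alpha>)"
      using nat_hcomp_assoc[of "L2 \<alpha>" "L2 \<beta>" "L2 \<gamma>"]
      by (intro L2_reflect; simp add: L2_hcomp comp_mor_assoc)
  next
    fix g f :: "'a og_functor"
    assume "g \<in> og_functors" "f \<in> og_functors" "msrc g = mtrg f"
    then show "lambda_hcomp (lambda_id g) (lambda_id f) = lambda_id (comp_mor g f)"
      using lc.hcmp_idt2[of "L1 g" "L1 f"]
      by (intro L2_reflect; simp add: lcCat_def L2_hcomp L2_id L1_comp)
  next
    fix \<beta> \<alpha> \<beta>' \<alpha>' :: "'a lambda_trans"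
    assume a: "\<beta> \<in> lambdas \<and> \<alpha> \<in> lambdas \<and> msrc (lsrc \<beta>) = mtrg (lsrc \<alpha>)"
      "\<beta>' \<in> lambdas \<and> \<alpha>' \<in> lambdas"
      "lsrc \<beta>' = ltrg \<beta>" "lsrc \<alpha>' = ltrg \<alpha>"
    then show "lambda_hcomp (lambda_vcomp \<beta>' \<beta>) (lambda_vcomp \<alpha>' \<alpha>)
      = lambda_vcomp (lambda_hcomp \<beta>' \<alpha>') (lambda_hcomp \<beta> \<alpha>)"
      using nat_interchange[of "L2 \<alpha>" "L2 \<alpha>'" "L2 \<beta>" "L2 \<beta>'"]
      by (intro L2_reflect; simp add: L2_hcomp L2_vcomp)
  qed
qed

lemma two_functor_L: "two_functor oGpd lcCat L_functor"
proof -
  have 1: "cat_functor (cells01 oGpd) (cells01 lcCat) L0 L1"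
    using category_og_functors category_lc_functors
    by (simp add: cat_functor_def cat_functor_axioms_def oGpd_def lcCat_def L1_id L1_comp)
  have 2: "cat_functor (cells12 oGpd) (cells12 lcCat) L1 L2"
    using category_lambdas category_lc_nats
    by (simp add: cat_functor_def cat_functor_axioms_def oGpd_def lcCat_def L2_id L2_vcomp)
  show ?thesis
    using 1 2 two_category_oGpd two_category_lcCat
    by (simp add: two_functor_def two_functor_axioms_def L_functor_def)
       (simp add: oGpd_def lcCat_def L2_hcomp)
qed

section \<open>The ordered groupoid of spans\<close>

locale lc_category = category C for C :: "('u::universe, 'u) cat" +
  assumes lc: "C \<in> lc_cats"

lemma lc_categoryI: "C \<in> lc_cats \<Longrightarrow> lc_category C"
  by (simp add: lc_category_def lc_category_axioms_def)

context lc_category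
begin

lemma cat [simp]: "category C" by unfold_locales

lemma small_arrs: "small (arrs C)"
  using lc unfolding lc_cats_def small_cat_def by simp

text \<open>\<open>mono_arr\<close> asks for equal sources; here they are deduced from the equality
  of the composites.\<close>

lemma monic:
  assumes "cmp C m f = cmp C m g" "m \<in> arrs C" "f \<in> arrs C" "g \<in> arrs C"
    "trg C f = src C m" "trg C g = src C m"
  shows "f = g"
proof -
  have "src C f = src C (cmp C m f)" "src C g = src C (cmp C m g)" using assms(2-6) by simp_all
  then have "src C f = src C g" using assms(1) by simp
  moreover have "mono_arr C m" using lc assms(2) unfolding lc_cats_def left_cancellative_def by simp
  ultimately show ?thesis using assms unfolding mono_arr_def by blast
qed

text \<open>The class is contained in \<open>arrs C\<close>, hence small, so its code determines it.
  Classes are orbits under precomposition with isomorphisms, so they agree as soon as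
  \<open>m'\<close> lies in the class of \<open>m\<close>.\<close>

lemma subobj_eq_iff:
  assumes m: "m \<in> arrs C" "m' \<in> arrs C"
  shows "subobj C m = subobj C m' \<longleftrightarrow> (\<exists>k. iso C k \<and> trg C k = src C m \<and> m' = cmp C m k)"
proof -
  define S where "S m = {cmp C m k | k. iso C k \<and> trg C k = src C m}" for m
  have small: "small (S m)" if "m \<in> arrs C" for m
    by (rule small_subset[OF small_arrs]) (use that in \<open>auto simp: S_def iso_arrs\<close>)
  have "subobj C m = subobj C m' \<longleftrightarrow> S m = S m'"
    unfolding subobj_def S_def[symmetric] using code_inject[OF small[OF m(1)] small[OF m(2)]] by auto
  also have "\<dots> \<longleftrightarrow> (\<exists>k. iso C k \<and> trg C k = src C m \<and> m' = cmp C m k)"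
  proof
    assume "S m = S m'"
    moreover have "m' \<in> S m'"
      unfolding S_def using m by (intro CollectI exI[of _ "idt C (src C m')"]) simp
    ultimately show "\<exists>k. iso C k \<and> trg C k = src C m \<and> m' = cmp C m k" by (auto simp: S_def)
  next
    assume "\<exists>k. iso C k \<and> trg C k = src C m \<and> m' = cmp C m k"
    then obtain k where k: "iso C k" "trg C k = src C m" "m' = cmp C m k" by blast
    have "S m' \<subseteq> S m"
    proof
      fix x assume "x \<in> S m'"
      then obtain l where "iso C l" "trg C l = src C m'" "x = cmp C m' l" by (auto simp: S_def)
      then show "x \<in> S m" unfolding S_def
        using k m by (intro CollectI exI[of _ "cmp C k l"]) (simp add: iso_arrs)
    qed
    moreover have "S m \<subseteq> S m'"
    proof
      fix x assume "x \<in> S m"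
      then obtain l where "iso C l" "trg C l = src C m" "x = cmp C m l" by (auto simp: S_def)
      then show "x \<in> S m'" unfolding S_def
        using k m by (intro CollectI exI[of _ "cmp C (inv_arr C k) l"]) (simp add: iso_arrs)
    qed
    ultimately show "S m = S m'" by blast
  qed
  finally show ?thesis .
qed

text \<open>The argument for subobjects with one \<open>k\<close> acting on both legs; smallness
  comes from the set of pairs of arrows.\<close>

lemma span_eq_iff:
  assumes m: "m \<in> arrs C" "n \<in> arrs C" "src C m = src C n"
    and m': "m' \<in> arrs C" "n' \<in> arrs C" "src C m' = src C n'"
  shows "span C m n = span C m' n' \<longleftrightarrow>
    (\<exists>k. iso C k \<and> trg C k = src C m \<and> m' = cmp C m k \<and> n' = cmp C n k)"
proof -
  define S where "S m n = {pair (cmp C m k) (cmp C n k) | k. iso C k \<and> trg C k = src C m}" for m n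
  have small: "small (S m n)" if "m \<in> arrs C" "n \<in> arrs C" "src C m = src C n" for m n
    by (rule small_subset[OF small_pairs[OF small_arrs small_arrs]])
       (use that in \<open>auto simp: S_def iso_arrs\<close>)
  have "span C m n = span C m' n' \<longleftrightarrow> S m n = S m' n'"
    unfolding span_def S_def[symmetric] using code_inject[OF small[OF m] small[OF m']] by auto
  also have "\<dots> \<longleftrightarrow> (\<exists>k. iso C k \<and> trg C k = src C m \<and> m' = cmp C m k \<and> n' = cmp C n k)"
  proof
    assume "S m n = S m' n'"
    moreover have "pair m' n' \<in> S m' n'"
      unfolding S_def using m' by (intro CollectI exI[of _ "idt C (src C m')"]) simp
    ultimately have "pair m' n' \<in> S m n" by simp
    then show "\<exists>k. iso C k \<and> trg C k = src C m \<and> m' = cmp C m k \<and> n' = cmp C n k"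
      by (auto simp: S_def)
  next
    assume "\<exists>k. iso C k \<and> trg C k = src C m \<and> m' = cmp C m k \<and> n' = cmp C n k"
    then obtain k where k: "iso C k" "trg C k = src C m" "m' = cmp C m k" "n' = cmp C n k" by blast
    have "S m' n' \<subseteq> S m n"
    proof
      fix x assume "x \<in> S m' n'"
      then obtain l where "iso C l" "trg C l = src C m'" "x = pair (cmp C m' l) (cmp C n' l)"
        by (auto simp: S_def)
      then show "x \<in> S m n" unfolding S_def
        using k m by (intro CollectI exI[of _ "cmp C k l"]) (simp add: iso_arrs)
    qed
    moreover have "S m n \<subseteq> S m' n'"
    proof
      fix x assume "x \<in> S m n"
      then obtain l where "iso C l" "trg C l = src C m" "x = pair (cmp C m l) (cmp C n l)"
        by (auto simp: S_def)
      then show "x \<in> S m' n'" unfolding S_def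
        using k m by (intro CollectI exI[of _ "cmp C (inv_arr C k) l"]) (simp add: iso_arrs)
    qed
    ultimately show "S m n = S m' n'" by blast
  qed
  finally show ?thesis .
qed

lemma subobj_cmp_iso:
  "\<lbrakk>m \<in> arrs C; iso C k; trg C k = src C m\<rbrakk> \<Longrightarrow> subobj C (cmp C m k) = subobj C m"
  using subobj_eq_iff[of m "cmp C m k"] by (auto simp: iso_arrs)

lemma span_cmp_iso:
  "\<lbrakk>m \<in> arrs C; n \<in> arrs C; src C m = src C n; iso C k; trg C k = src C m\<rbrakk>
    \<Longrightarrow> span C (cmp C m k) (cmp C n k) = span C m n"
  using span_eq_iff[of m n "cmp C m k" "cmp C n k"] by (auto simp: iso_arrs)

lemma subobj_in_obs: "m \<in> arrs C \<Longrightarrow> subobj C m \<in> obs (G0 C)"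
  by (auto simp: G0_def)

lemma span_in_arrs: "\<lbrakk>m \<in> arrs C; n \<in> arrs C; src C m = src C n\<rbrakk> \<Longrightarrow> span C m n \<in> arrs (G0 C)"
  by (auto simp: G0_def is_span_def)

lemma src_span:
  assumes m: "m \<in> arrs C" "n \<in> arrs C" "src C m = src C n"
  shows "src (G0 C) (span C m n) = subobj C m"
proof -
  have "a = subobj C m" if "is_span C m' n'" "span C m n = span C m' n'" "a = subobj C m'" for a m' n'
    using that m span_eq_iff[of m n m' n'] subobj_cmp_iso by (auto simp: is_span_def)
  moreover have "is_span C m n" using m by (simp add: is_span_def)
  ultimately show ?thesis
    unfolding G0_def cat.simps ogpd.simps by (intro the_equality) blast+
qed

lemma trg_span:
  assumes m: "m \<in> arrs C" "n \<in> arrs C" "src C m = src C n"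
  shows "trg (G0 C) (span C m n) = subobj C n"
proof -
  have "a = subobj C n" if "is_span C m' n'" "span C m n = span C m' n'" "a = subobj C n'" for a m' n'
    using that m span_eq_iff[of m n m' n'] subobj_cmp_iso by (auto simp: is_span_def)
  moreover have "is_span C m n" using m by (simp add: is_span_def)
  ultimately show ?thesis
    unfolding G0_def cat.simps ogpd.simps by (intro the_equality) blast+
qed

lemma idt_subobj:
  assumes m: "m \<in> arrs C"
  shows "idt (G0 C) (subobj C m) = span C m m"
proof -
  have "x = span C m m" if "m' \<in> arrs C" "subobj C m = subobj C m'" "x = span C m' m'" for x m'
    using that m subobj_eq_iff[of m m'] span_cmp_iso[of m m] by auto
  then show ?thesis
    unfolding G0_def cat.simps ogpd.simps
    using m by (intro the_equality) blast+
qed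

text \<open>Composition on representatives whose middle legs coincide; \<open>arrs_srcE\<close>
  brings any composable pair into this form.\<close>

lemma cmp_span:
  assumes m: "k \<in> arrs C" "m \<in> arrs C" "n \<in> arrs C" "src C k = src C m" "src C m = src C n"
  shows "cmp (G0 C) (span C m n) (span C k m) = span C k n"
proof -
  let ?P = "\<lambda>z. \<exists>k' m1 m2 n' h. is_span C k' m1 \<and> is_span C m2 n' \<and>
        span C k m = span C k' m1 \<and> span C m n = span C m2 n' \<and>
        iso C h \<and> trg C h = src C m2 \<and> m1 = cmp C m2 h \<and> z = span C k' (cmp C n' h)"
  have "(THE z. ?P z) = span C k n"
  proof (rule the_equality)
    show "?P (span C k n)"
      by (rule exI[of _ k], rule exI[of _ m], rule exI[of _ m], rule exI[of _ n],
          rule exI[of _ "idt C (src C m)"]) (use m in \<open>simp add: is_span_def\<close>)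
    fix z assume "?P z"
    then obtain k' m1 m2 n' h where s: "is_span C k' m1" "is_span C m2 n'"
      "span C k m = span C k' m1" "span C m n = span C m2 n'"
      and h: "iso C h" "trg C h = src C m2" "m1 = cmp C m2 h" "z = span C k' (cmp C n' h)" by blast
    obtain i where i: "iso C i" "trg C i = src C k" "k' = cmp C k i" "m1 = cmp C m i"
      using s m span_eq_iff[of k m k' m1] by (auto simp: is_span_def)
    obtain j where j: "iso C j" "trg C j = src C m" "m2 = cmp C m j" "n' = cmp C n j"
      using s m span_eq_iff[of m n m2 n'] by (auto simp: is_span_def)
    have "trg C h = src C j" using h j m by (simp add: iso_arrs)
    \<comment> \<open>Both sides are \<open>m1\<close>. Cancelling \<open>m\<close> shows that the
      changes of representative made on the two spans match, so one isomorphism acts on both outer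
      legs.\<close>
    then have "cmp C m i = cmp C m (cmp C j h)" using i j h m by (simp add: iso_arrs)
    then have "i = cmp C j h" by (rule monic) (use i j h m \<open>trg C h = src C j\<close> in \<open>simp_all add: iso_arrs\<close>)
    then have "z = span C (cmp C k i) (cmp C n i)"
      using h i j m \<open>trg C h = src C j\<close> by (simp add: iso_arrs)
    then show "z = span C k n" using span_cmp_iso[of k n i] i m by simp
  qed
  then show ?thesis by (simp add: G0_def)
qed

lemma ale_span:
  assumes m: "m \<in> arrs C" "n \<in> arrs C" "src C m = src C n"
    and m': "m' \<in> arrs C" "n' \<in> arrs C" "src C m' = src C n'"
  shows "ale (G0 C) (span C m n) (span C m' n') \<longleftrightarrow>
    (\<exists>h \<in> arrs C. trg C h = src C m' \<and> m = cmp C m' h \<and> n = cmp C n' h)"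
proof
  assume "ale (G0 C) (span C m n) (span C m' n')"
  then obtain p q p' q' h where s: "is_span C p q" "is_span C p' q'" "span C m n = span C p q"
    "span C m' n' = span C p' q'" and h: "h \<in> arrs C" "trg C h = src C p'" "p = cmp C p' h" "q = cmp C q' h"
    by (auto simp: G0_def)
  obtain i where i: "iso C i" "trg C i = src C p" "m = cmp C p i" "n = cmp C q i"
    using s m span_eq_iff[of p q m n] by (auto simp: is_span_def)
  obtain j where j: "iso C j" "trg C j = src C m'" "p' = cmp C m' j" "q' = cmp C n' j"
    using s m' span_eq_iff[of m' n' p' q'] by (auto simp: is_span_def)
  \<comment> \<open>The given \<open>h\<close> compares other representatives; composing it with the
    changes of representative \<open>i\<close> and \<open>j\<close> moves it to the chosen
    ones.\<close>
  show "\<exists>h \<in> arrs C. trg C h = src C m' \<and> m = cmp C m' h \<and> n = cmp C n' h"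
    using i j h m' by (intro bexI[of _ "cmp C j (cmp C h i)"]) (simp_all add: iso_arrs)
next
  assume "\<exists>h \<in> arrs C. trg C h = src C m' \<and> m = cmp C m' h \<and> n = cmp C n' h"
  then obtain h where "h \<in> arrs C" "trg C h = src C m'" "m = cmp C m' h" "n = cmp C n' h" by blast
  note h = this
  show "ale (G0 C) (span C m n) (span C m' n')"
    unfolding G0_def cat.simps ogpd.simps
    by (rule exI[of _ m], rule exI[of _ n], rule exI[of _ m'], rule exI[of _ n'],
        rule exI[of _ h]) (use h assms in \<open>simp add: is_span_def\<close>)
qed

lemma obj_le_subobj:
  assumes m: "m \<in> arrs C" "m' \<in> arrs C"
  shows "obj_le (G0 C) (subobj C m) (subobj C m') \<longleftrightarrow>
    (\<exists>h \<in> arrs C. trg C h = src C m' \<and> m = cmp C m' h)"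
  using m by (simp add: obj_le_def idt_subobj ale_span)

lemma obsE:
  assumes "a \<in> obs (G0 C)"
  obtains m where "m \<in> arrs C" "a = subobj C m"
  using assms by (auto simp: G0_def)

lemma arrsE:
  assumes "x \<in> arrs (G0 C)"
  obtains m n where "m \<in> arrs C" "n \<in> arrs C" "src C m = src C n" "x = span C m n"
  using assms by (auto simp: G0_def is_span_def)

text \<open>Any representative of the source subobject can serve as the left leg, because the
  isomorphism relating it to another one can be applied to the right leg too.\<close>

lemma arrs_srcE:
  assumes x: "x \<in> arrs (G0 C)" and m: "m \<in> arrs C" "src (G0 C) x = subobj C m"
  obtains n where "n \<in> arrs C" "src C m = src C n" "x = span C m n"
proof -
  obtain p q where p: "p \<in> arrs C" "q \<in> arrs C" "src C p = src C q" "x = span C p q"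
    using x by (rule arrsE)
  then have "subobj C p = subobj C m" using m by (simp add: src_span)
  then obtain i where "iso C i" "trg C i = src C p" "m = cmp C p i"
    using subobj_eq_iff p m by blast
  then show ?thesis using p m span_cmp_iso[of p q i] by (intro that[of "cmp C q i"]) (simp_all add: iso_arrs)
qed

lemmas G0_simps = subobj_in_obs span_in_arrs src_span trg_span idt_subobj cmp_span

section \<open>\<open>G0 C\<close> as a small ordered groupoid\<close>

lemma category_G0: "category (G0 C)"
proof (rule category.intro)
  fix A assume "A \<in> obs (G0 C)"
  then obtain m where "m \<in> arrs C" "A = subobj C m" by (rule obsE)
  then show "idt (G0 C) A \<in> arrs (G0 C)" "src (G0 C) (idt (G0 C) A) = A" "trg (G0 C) (idt (G0 C) A) = A"
    by (simp_all add: G0_simps)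
next
  fix x assume "x \<in> arrs (G0 C)"
  then obtain k m where x: "k \<in> arrs C" "m \<in> arrs C" "src C k = src C m" "x = span C k m" by (rule arrsE)
  then show "src (G0 C) x \<in> obs (G0 C)" "trg (G0 C) x \<in> obs (G0 C)"
    "cmp (G0 C) x (idt (G0 C) (src (G0 C) x)) = x" "cmp (G0 C) (idt (G0 C) (trg (G0 C) x)) x = x"
    by (simp_all add: G0_simps)
  fix y assume "y \<in> arrs (G0 C)" "src (G0 C) y = trg (G0 C) x"
  then obtain n where y: "n \<in> arrs C" "src C m = src C n" "y = span C m n"
    using x by (auto simp: G0_simps elim: arrs_srcE)
  then show "cmp (G0 C) y x \<in> arrs (G0 C)" "src (G0 C) (cmp (G0 C) y x) = src (G0 C) x"
    "trg (G0 C) (cmp (G0 C) y x) = trg (G0 C) y"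
    using x by (simp_all add: G0_simps)
  fix z assume "z \<in> arrs (G0 C)" "src (G0 C) z = trg (G0 C) y"
  then obtain p where "p \<in> arrs C" "src C n = src C p" "z = span C n p"
    using x y by (auto simp: G0_simps elim: arrs_srcE)
  then show "cmp (G0 C) (cmp (G0 C) z y) x = cmp (G0 C) z (cmp (G0 C) y x)"
    using x y by (simp add: G0_simps)
qed

lemma is_inverse_span: "\<lbrakk>m \<in> arrs C; n \<in> arrs C; src C m = src C n\<rbrakk>
    \<Longrightarrow> is_inverse (G0 C) (span C m n) (span C n m)"
  by (simp add: is_inverse_def G0_simps)

lemma inv_span: "\<lbrakk>m \<in> arrs C; n \<in> arrs C; src C m = src C n\<rbrakk>
    \<Longrightarrow> inv_arr (G0 C) (span C m n) = span C n m"
  by (rule category.inv_arr_eqI[OF category_G0 is_inverse_span])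

lemma small_cat_G0: "small_cat (G0 C)"
proof -
  have "small (obs (G0 C))"
    by (rule small_subset[OF small_image[OF small_arrs, of "subobj C"]]) (auto simp: G0_def)
  moreover have "arrs (G0 C) \<subseteq>
      (\<lambda>p. span C (pfst p) (psnd p)) ` {pair x y | x y. x \<in> arrs C \<and> y \<in> arrs C}"
  proof
    fix x assume "x \<in> arrs (G0 C)"
    then obtain m n where "m \<in> arrs C" "n \<in> arrs C" "x = span C m n" by (rule arrsE)
    then show "x \<in> (\<lambda>p. span C (pfst p) (psnd p)) ` {pair x y | x y. x \<in> arrs C \<and> y \<in> arrs C}"
      by (intro image_eqI[of _ _ "pair m n"]) auto
  qed
  then have "small (arrs (G0 C))"
    using small_subset small_image small_pairs small_arrs by blast
  ultimately show ?thesis by (simp add: small_cat_def category_G0)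
qed

text \<open>Left cancellation enters in antisymmetry, in monotonicity of composition and in
  uniqueness of restrictions, each time because an arrow comparing two spans is determined by one
  leg.\<close>

lemma ordered_groupoid_G0: "ordered_groupoid (G0 C)"
proof (intro ordered_groupoid.intro category_G0 ordered_groupoid_axioms.intro)
  fix f assume "f \<in> arrs (G0 C)"
  then show "iso (G0 C) f"
    by (rule arrsE) (use is_inverse_span category.is_inverse_iso[OF category_G0] in blast)
next
  fix a assume "a \<in> arrs (G0 C)"
  then obtain m n where "m \<in> arrs C" "n \<in> arrs C" "src C m = src C n" "a = span C m n" by (rule arrsE)
  then show "ale (G0 C) a a" by (simp add: ale_span) (rule bexI[of _ "idt C (src C m)"]; simp)
next
  fix a b c assume "a \<in> arrs (G0 C)" "b \<in> arrs (G0 C)" "c \<in> arrs (G0 C)"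
    and le: "ale (G0 C) a b" "ale (G0 C) b c"
  obtain m1 n1 where a: "m1 \<in> arrs C" "n1 \<in> arrs C" "src C m1 = src C n1" "a = span C m1 n1"
    using \<open>a \<in> arrs (G0 C)\<close> by (rule arrsE)
  obtain m2 n2 where b: "m2 \<in> arrs C" "n2 \<in> arrs C" "src C m2 = src C n2" "b = span C m2 n2"
    using \<open>b \<in> arrs (G0 C)\<close> by (rule arrsE)
  obtain m3 n3 where c: "m3 \<in> arrs C" "n3 \<in> arrs C" "src C m3 = src C n3" "c = span C m3 n3"
    using \<open>c \<in> arrs (G0 C)\<close> by (rule arrsE)
  obtain h where h: "h \<in> arrs C" "trg C h = src C m2" "m1 = cmp C m2 h" "n1 = cmp C n2 h"
    using le(1) a b by (auto simp: ale_span)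
  obtain k where k: "k \<in> arrs C" "trg C k = src C m3" "m2 = cmp C m3 k" "n2 = cmp C n3 k"
    using le(2) b c by (auto simp: ale_span)
  have "trg C h = src C k" using h k c by simp
  then have "\<exists>h \<in> arrs C. trg C h = src C m3 \<and> m1 = cmp C m3 h \<and> n1 = cmp C n3 h"
    using h k c by (intro bexI[of _ "cmp C k h"]) simp_all
  then show "ale (G0 C) a c" using a c by (simp add: ale_span)
next
  fix a b assume "a \<in> arrs (G0 C)" "b \<in> arrs (G0 C)" and le: "ale (G0 C) a b" "ale (G0 C) b a"
  obtain m1 n1 where a: "m1 \<in> arrs C" "n1 \<in> arrs C" "src C m1 = src C n1" "a = span C m1 n1"
    using \<open>a \<in> arrs (G0 C)\<close> by (rule arrsE)
  obtain m2 n2 where b: "m2 \<in> arrs C" "n2 \<in> arrs C" "src C m2 = src C n2" "b = span C m2 n2"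
    using \<open>b \<in> arrs (G0 C)\<close> by (rule arrsE)
  obtain h where h: "h \<in> arrs C" "trg C h = src C m2" "m1 = cmp C m2 h" "n1 = cmp C n2 h"
    using le(1) a b by (auto simp: ale_span)
  obtain k where k: "k \<in> arrs C" "trg C k = src C m1" "m2 = cmp C m1 k" "n2 = cmp C n1 k"
    using le(2) a b by (auto simp: ale_span)
  have "src C h = src C m1" using h(3) h(1,2) b by simp
  moreover have "src C k = src C m2" using k(3) k(1,2) a by simp
  ultimately have hk: "trg C k = src C h" "trg C h = src C k" using h(2) k(2) by simp_all
  \<comment> \<open>Cancelling \<open>m2\<close> here and \<open>m1\<close> below makes
    \<open>h\<close> and \<open>k\<close> mutually inverse, so the two spans define the same
    class.\<close>
  have "cmp C m2 (cmp C h k) = cmp C (cmp C m2 h) k" using h(1,2) k(1) hk b by simp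
  also have "\<dots> = cmp C m2 (idt C (src C m2))"
    unfolding h(3)[symmetric] k(3)[symmetric] using b by simp
  finally have "cmp C h k = idt C (src C m2)"
    by (rule monic) (use h(1,2) k(1) hk b in simp_all)
  moreover have "cmp C m1 (cmp C k h) = cmp C (cmp C m1 k) h" using k(1,2) h(1) hk a by simp
  then have "cmp C m1 (cmp C k h) = cmp C m1 (idt C (src C m1))"
    unfolding h(3)[symmetric] k(3)[symmetric] using a by simp
  then have "cmp C k h = idt C (src C m1)"
    by (rule monic) (use k(1,2) h(1) hk a in simp_all)
  ultimately have "is_inverse C h k" using h(1,2) k(1,2) hk by (simp add: is_inverse_def)
  then have "iso C h" by (rule is_inverse_iso)
  then have "span C (cmp C m2 h) (cmp C n2 h) = span C m2 n2" using h(2) b by (intro span_cmp_iso) simp_all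
  then show "a = b" using h(3,4) a(4) b(4) by simp
next
  fix a b assume "a \<in> arrs (G0 C)" "b \<in> arrs (G0 C)" and le: "ale (G0 C) a b"
  obtain m1 n1 where a: "m1 \<in> arrs C" "n1 \<in> arrs C" "src C m1 = src C n1" "a = span C m1 n1"
    using \<open>a \<in> arrs (G0 C)\<close> by (rule arrsE)
  obtain m2 n2 where b: "m2 \<in> arrs C" "n2 \<in> arrs C" "src C m2 = src C n2" "b = span C m2 n2"
    using \<open>b \<in> arrs (G0 C)\<close> by (rule arrsE)
  show "ale (G0 C) (inv_arr (G0 C) a) (inv_arr (G0 C) b)"
    using le a b by (simp add: ale_span inv_span) blast
next
  fix a b c d assume *: "a \<in> arrs (G0 C)" "b \<in> arrs (G0 C)" "c \<in> arrs (G0 C)" "d \<in> arrs (G0 C)"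
    and le: "ale (G0 C) a b" "ale (G0 C) c d" and s: "src (G0 C) a = trg (G0 C) c" "src (G0 C) b = trg (G0 C) d"
  obtain k1 m1 where c: "k1 \<in> arrs C" "m1 \<in> arrs C" "src C k1 = src C m1" "c = span C k1 m1"
    using *(3) by (rule arrsE)
  obtain k2 m2 where d: "k2 \<in> arrs C" "m2 \<in> arrs C" "src C k2 = src C m2" "d = span C k2 m2"
    using *(4) by (rule arrsE)
  obtain n1 where a: "n1 \<in> arrs C" "src C m1 = src C n1" "a = span C m1 n1"
    by (rule arrs_srcE[OF *(1), of m1]) (use c s in \<open>simp_all add: trg_span\<close>)
  obtain n2 where b: "n2 \<in> arrs C" "src C m2 = src C n2" "b = span C m2 n2"
    by (rule arrs_srcE[OF *(2), of m2]) (use d s in \<open>simp_all add: trg_span\<close>)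
  obtain h where h: "h \<in> arrs C" "trg C h = src C m2" "m1 = cmp C m2 h" "n1 = cmp C n2 h"
    using le(1) a b c d by (auto simp: ale_span)
  obtain k where k: "k \<in> arrs C" "trg C k = src C k2" "k1 = cmp C k2 k" "m1 = cmp C m2 k"
    using le(2) c d by (auto simp: ale_span)
  \<comment> \<open>The two inequalities bring their own witnesses; these agree because both factor
    the shared leg \<open>m1\<close> through \<open>m2\<close>.\<close>
  have "cmp C m2 k = cmp C m2 h" using h k by simp
  then have "k = h" by (rule monic) (use h k d in simp_all)
  then have "\<exists>h \<in> arrs C. trg C h = src C k2 \<and> k1 = cmp C k2 h \<and> n1 = cmp C n2 h"
    using h k by blast
  then show "ale (G0 C) (cmp (G0 C) a c) (cmp (G0 C) b d)"
    using a b c d by (simp add: cmp_span ale_span)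
next
  fix f A assume f: "f \<in> arrs (G0 C)" and A: "A \<in> obs (G0 C)" and le: "obj_le (G0 C) A (src (G0 C) f)"
  obtain m n where mn: "m \<in> arrs C" "n \<in> arrs C" "src C m = src C n" "f = span C m n"
    using f by (rule arrsE)
  obtain p where p: "p \<in> arrs C" "A = subobj C p" using A by (rule obsE)
  obtain h where h: "h \<in> arrs C" "trg C h = src C m" "p = cmp C m h"
    using le mn p by (auto simp: src_span obj_le_subobj)
  show "\<exists>!g. g \<in> arrs (G0 C) \<and> src (G0 C) g = A \<and> ale (G0 C) g f"
  proof (rule ex1I)
    \<comment> \<open>The restriction precomposes both legs with \<open>h\<close>. Any other
      candidate arises from an arrow that factors \<open>p\<close> through \<open>m\<close> as well,
      hence from \<open>h\<close>.\<close>
    have "\<exists>h' \<in> arrs C. trg C h' = src C m \<and> cmp C m h = cmp C m h' \<and> cmp C n h = cmp C n h'"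
      using h by blast
    then show "span C (cmp C m h) (cmp C n h) \<in> arrs (G0 C) \<and>
      src (G0 C) (span C (cmp C m h) (cmp C n h)) = A \<and> ale (G0 C) (span C (cmp C m h) (cmp C n h)) f"
      using mn p h by (simp add: G0_simps ale_span)
    fix g assume g: "g \<in> arrs (G0 C) \<and> src (G0 C) g = A \<and> ale (G0 C) g f"
    obtain q where q: "q \<in> arrs C" "src C p = src C q" "g = span C p q"
      by (rule arrs_srcE[of g p]) (use g p in simp_all)
    obtain k where k: "k \<in> arrs C" "trg C k = src C m" "p = cmp C m k" "q = cmp C n k"
      using g q p mn by (auto simp: ale_span)
    have "cmp C m h = cmp C m k" using h k by simp
    then have "h = k" by (rule monic) (use h k mn in simp_all)
    then show "g = span C (cmp C m h) (cmp C n h)" using q k h by simp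
  qed
qed

lemma G0_ogpds: "G0 C \<in> ogpds"
  by (simp add: ogpds_def small_cat_G0 ordered_groupoid_G0)

lemma restr_span:
  assumes "m \<in> arrs C" "n \<in> arrs C" "src C m = src C n" "h \<in> arrs C" "trg C h = src C m"
  shows "restr (G0 C) (span C m n) (subobj C (cmp C m h)) = span C (cmp C m h) (cmp C n h)"
proof (rule ordered_groupoid.restr_eqI[OF ordered_groupoid_G0])
  have "\<exists>h' \<in> arrs C. trg C h' = src C m \<and> cmp C m h = cmp C m h' \<and> cmp C n h = cmp C n h'"
    using assms by blast
  then show "ale (G0 C) (span C (cmp C m h) (cmp C n h)) (span C m n)"
    using assms by (simp add: ale_span)
qed (use assms in \<open>simp_all add: G0_simps\<close>)

end

section \<open>The 2-functor G\<close>

text \<open>The operations \<open>\<phi>\<close> on arrows for which \<open>span_functor\<close> is well defined: precomposition in the source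
  category is turned into precomposition along a functor.\<close>

definition lifts_to_spans :: "'u::universe lc_functor \<Rightarrow> ('u \<Rightarrow> 'u) \<Rightarrow> bool" where
  "lifts_to_spans K \<phi> \<longleftrightarrow> K \<in> lc_functors \<and>
     (\<forall>m \<in> arrs (msrc K). \<phi> m \<in> arrs (mtrg K) \<and> src (mtrg K) (\<phi> m) = mob K (src (msrc K) m)) \<and>
     (\<forall>m \<in> arrs (msrc K). \<forall>h \<in> arrs (msrc K). trg (msrc K) h = src (msrc K) m \<longrightarrow>
       \<phi> (cmp (msrc K) m h) = cmp (mtrg K) (\<phi> m) (mar K h))"

lemma span_functor_sel [simp]:
  "msrc (span_functor C D \<phi>) = G0 C" "mtrg (span_functor C D \<phi>) = G0 D"
  by (simp_all add: span_functor_def)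

text \<open>One statement serves both \<open>G1\<close>, with \<open>mar K\<close> as \<phi>, and
  the intermediate functor of \<open>G2\<close>. Precomposition with \<open>h\<close> becomes
  precomposition with \<open>mar K h\<close>: for an isomorphism this keeps the class, for a general
  arrow it keeps the order.\<close>

lemma span_functor_values:
  assumes "lifts_to_spans K \<phi>"
  defines "C \<equiv> msrc K" and "D \<equiv> mtrg K"
  shows mob_span_functor: "m \<in> arrs C \<Longrightarrow> mob (span_functor C D \<phi>) (subobj C m) = subobj D (\<phi> m)"
    and mar_span_functor: "\<lbrakk>m \<in> arrs C; n \<in> arrs C; src C m = src C n\<rbrakk>
      \<Longrightarrow> mar (span_functor C D \<phi>) (span C m n) = span D (\<phi> m) (\<phi> n)"
    and span_functor_og: "span_functor C D \<phi> \<in> og_functors"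
proof -
  have K: "K \<in> lc_functors" and fm: "functor_mor K" and [simp]: "msrc K = C" "mtrg K = D"
    using assms(1) unfolding lifts_to_spans_def C_def D_def by simp_all
  interpret C: lc_category C using lc_functors_simps(2)[OF K] by (simp add: lc_categoryI)
  interpret D: lc_category D using lc_functors_simps(3)[OF K] by (simp add: lc_categoryI)
  have arr [simp]: "\<phi> m \<in> arrs D" "src D (\<phi> m) = mob K (src C m)" if "m \<in> arrs C" for m
    using assms(1) that by (simp_all add: lifts_to_spans_def)
  have cmp: "\<phi> (cmp C m h) = cmp D (\<phi> m) (mar K h)"
    if "m \<in> arrs C" "h \<in> arrs C" "trg C h = src C m" for m h
    using assms(1) that by (simp add: lifts_to_spans_def)
  show mob: "mob (span_functor C D \<phi>) (subobj C m) = subobj D (\<phi> m)" if m: "m \<in> arrs C" for m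
  proof -
    have "b = subobj D (\<phi> m)" if s: "m' \<in> arrs C" "subobj C m = subobj C m'" "b = subobj D (\<phi> m')" for b m'
    proof -
      obtain k where "iso C k" "trg C k = src C m" "m' = cmp C m k"
        using s m C.subobj_eq_iff by blast
      then show ?thesis using s m fm by (simp add: cmp C.iso_arrs D.subobj_cmp_iso)
    qed
    then have "(THE b. \<exists>m' \<in> arrs C. subobj C m = subobj C m' \<and> b = subobj D (\<phi> m')) = subobj D (\<phi> m)"
      using m by (intro the_equality) blast+
    then show ?thesis using m by (simp add: span_functor_def C.subobj_in_obs)
  qed
  show mar: "mar (span_functor C D \<phi>) (span C m n) = span D (\<phi> m) (\<phi> n)"
    if m: "m \<in> arrs C" "n \<in> arrs C" "src C m = src C n" for m n
  proof -
    have "y = span D (\<phi> m) (\<phi> n)"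
      if s: "is_span C m' n'" "span C m n = span C m' n'" "y = span D (\<phi> m') (\<phi> n')" for y m' n'
    proof -
      obtain k where "iso C k" "trg C k = src C m" "m' = cmp C m k" "n' = cmp C n k"
        using s m C.span_eq_iff[of m n m' n'] by (auto simp: is_span_def)
      then show ?thesis using s m fm by (simp add: cmp C.iso_arrs D.span_cmp_iso)
    qed
    moreover have "is_span C m n" using m by (simp add: is_span_def)
    ultimately have "(THE y. \<exists>m' n'. is_span C m' n' \<and> span C m n = span C m' n' \<and> y = span D (\<phi> m') (\<phi> n'))
        = span D (\<phi> m) (\<phi> n)"
      by (intro the_equality) blast+
    then show ?thesis using m by (simp add: span_functor_def C.span_in_arrs)
  qed
  show "span_functor C D \<phi> \<in> og_functors"
  proof (rule og_functorsI)
    show "functor_mor (span_functor C D \<phi>)"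
      unfolding functor_mor_def span_functor_sel
    proof (intro conjI cat_functor.intro cat_functor_axioms.intro C.category_G0 D.category_G0)
      show "mob (span_functor C D \<phi>) \<in> extensional (obs (G0 C))"
        "mar (span_functor C D \<phi>) \<in> extensional (arrs (G0 C))"
        by (simp_all add: span_functor_def)
    next
      fix A assume "A \<in> obs (G0 C)"
      then obtain m where "m \<in> arrs C" "A = subobj C m" by (rule C.obsE)
      then show "mob (span_functor C D \<phi>) A \<in> obs (G0 D)"
        "mar (span_functor C D \<phi>) (idt (G0 C) A) = idt (G0 D) (mob (span_functor C D \<phi>) A)"
        by (simp_all add: mob mar C.G0_simps D.G0_simps)
    next
      fix x assume "x \<in> arrs (G0 C)"
      then obtain k m where x: "k \<in> arrs C" "m \<in> arrs C" "src C k = src C m" "x = span C k m"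
        by (rule C.arrsE)
      then show "mar (span_functor C D \<phi>) x \<in> arrs (G0 D)"
        "src (G0 D) (mar (span_functor C D \<phi>) x) = mob (span_functor C D \<phi>) (src (G0 C) x)"
        "trg (G0 D) (mar (span_functor C D \<phi>) x) = mob (span_functor C D \<phi>) (trg (G0 C) x)"
        by (simp_all add: mob mar C.G0_simps D.G0_simps)
      fix y assume y: "y \<in> arrs (G0 C)" "src (G0 C) y = trg (G0 C) x"
      obtain n where "n \<in> arrs C" "src C m = src C n" "y = span C m n"
        by (rule C.arrs_srcE[OF y(1), of m]) (use x y in \<open>simp_all add: C.trg_span\<close>)
      then show "mar (span_functor C D \<phi>) (cmp (G0 C) y x)
          = cmp (G0 D) (mar (span_functor C D \<phi>) y) (mar (span_functor C D \<phi>) x)"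
        using x by (simp add: mar C.G0_simps D.G0_simps)
    qed
    fix x y assume "x \<in> arrs (msrc (span_functor C D \<phi>))" "y \<in> arrs (msrc (span_functor C D \<phi>))"
      and le: "ale (msrc (span_functor C D \<phi>)) x y"
    then obtain m n m' n' where x: "m \<in> arrs C" "n \<in> arrs C" "src C m = src C n" "x = span C m n"
      and y: "m' \<in> arrs C" "n' \<in> arrs C" "src C m' = src C n'" "y = span C m' n'"
      unfolding span_functor_sel by (elim C.arrsE)
    then obtain h where "h \<in> arrs C" "trg C h = src C m'" "m = cmp C m' h" "n = cmp C n' h"
      using le by (auto simp: C.ale_span)
    then have "\<exists>h \<in> arrs D. trg D h = src D (\<phi> m') \<and> \<phi> m = cmp D (\<phi> m') h \<and> \<phi> n = cmp D (\<phi> n') h"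
      using x y fm by (intro bexI[of _ "mar K h"]) (simp_all add: cmp)
    then show "ale (mtrg (span_functor C D \<phi>)) (mar (span_functor C D \<phi>) x) (mar (span_functor C D \<phi>) y)"
      using x y by (simp add: mar D.ale_span)
  qed (use C.G0_ogpds D.G0_ogpds in simp_all)
qed

section \<open>G on 1-cells and 2-cells\<close>

lemma lifts_mar: "K \<in> lc_functors \<Longrightarrow> lifts_to_spans K (mar K)"
  by (simp add: lifts_to_spans_def)

lemma G1_sel [simp]: "msrc (G1 K) = G0 (msrc K)" "mtrg (G1 K) = G0 (mtrg K)"
  by (simp_all add: G1_def)

lemma mob_G1 [simp]: "\<lbrakk>K \<in> lc_functors; msrc K = C; m \<in> arrs C\<rbrakk>
    \<Longrightarrow> mob (G1 K) (subobj C m) = subobj (mtrg K) (mar K m)"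
  using mob_span_functor[OF lifts_mar] by (auto simp: G1_def)

lemma mar_G1 [simp]: "\<lbrakk>K \<in> lc_functors; msrc K = C; m \<in> arrs C; n \<in> arrs C; src C m = src C n\<rbrakk>
    \<Longrightarrow> mar (G1 K) (span C m n) = span (mtrg K) (mar K m) (mar K n)"
  using mar_span_functor[OF lifts_mar] by (auto simp: G1_def)

lemma G1_og [simp]: "K \<in> lc_functors \<Longrightarrow> G1 K \<in> og_functors"
  using span_functor_og[OF lifts_mar] by (simp add: G1_def)

lemma G0_og [simp]: "C \<in> lc_cats \<Longrightarrow> G0 C \<in> ogpds"
  by (rule lc_category.G0_ogpds[OF lc_categoryI])

lemmas subobj_simps [simp] =
  lc_category.G0_simps[OF lc_categoryI]

lemma G1_id:
  assumes C: "C \<in> lc_cats"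
  shows "G1 (id_mor C) = id_mor (G0 C)"
proof (rule functor_mor_eqI)
  fix a assume "a \<in> obs (msrc (G1 (id_mor C)))"
  then show "mob (G1 (id_mor C)) a = mob (id_mor (G0 C)) a"
    using C by (auto elim!: lc_category.obsE[OF lc_categoryI[OF C]])
next
  fix x assume "x \<in> arrs (msrc (G1 (id_mor C)))"
  then show "mar (G1 (id_mor C)) x = mar (id_mor (G0 C)) x"
    using C by (auto elim!: lc_category.arrsE[OF lc_categoryI[OF C]])
qed (use C lc_category.category_G0[OF lc_categoryI] in simp_all)

lemma G1_comp:
  assumes F: "F \<in> lc_functors" and G: "G \<in> lc_functors" "msrc G = mtrg F"
  shows "G1 (comp_mor G F) = comp_mor (G1 G) (G1 F)"
proof (rule functor_mor_eqI)
  have C: "lc_category (msrc F)" using F by (simp add: lc_categoryI)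
  show "mob (G1 (comp_mor G F)) a = mob (comp_mor (G1 G) (G1 F)) a"
    if a: "a \<in> obs (msrc (G1 (comp_mor G F)))" for a
  proof -
    obtain m where "m \<in> arrs (msrc F)" "a = subobj (msrc F) m"
      by (rule lc_category.obsE[OF C]) (use a in auto)
    then show ?thesis using assms by simp
  qed
  show "mar (G1 (comp_mor G F)) x = mar (comp_mor (G1 G) (G1 F)) x"
    if x: "x \<in> arrs (msrc (G1 (comp_mor G F)))" for x
  proof -
    obtain m n where "m \<in> arrs (msrc F)" "n \<in> arrs (msrc F)" "src (msrc F) m = src (msrc F) n"
      "x = span (msrc F) m n"
      by (rule lc_category.arrsE[OF C]) (use x in auto)
    then show ?thesis using assms by simp
  qed
qed (use assms in simp_all)

text \<open>The local \<phi> of \<open>G2\<close>, named so that the results on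
  \<open>lifts_to_spans\<close> can be applied to it.\<close>

definition nat_mid :: "'u::universe nat_trans \<Rightarrow> 'u \<Rightarrow> 'u" where
  "nat_mid \<theta> m = cmp (mtrg (nsrc \<theta>)) (mar (ntrg \<theta>) m) (ncomp \<theta> (src (msrc (nsrc \<theta>)) m))"

lemma nat_mid_arr [simp]:
  assumes "\<theta> \<in> lc_nats" "m \<in> arrs (msrc (nsrc \<theta>))" "mtrg (nsrc \<theta>) = D"
  shows "nat_mid \<theta> m \<in> arrs D" "src D (nat_mid \<theta> m) = mob (nsrc \<theta>) (src (msrc (nsrc \<theta>)) m)"
  using assms(1,2) unfolding assms(3)[symmetric] by (simp_all add: nat_mid_def)

text \<open>Naturality of \<theta> at \<open>h\<close> moves the component past \<open>h\<close>,
  turning the value of the target functor at \<open>h\<close> into that of the source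
  functor.\<close>

lemma lifts_nat_mid:
  assumes "\<theta> \<in> lc_nats"
  shows "lifts_to_spans (nsrc \<theta>) (nat_mid \<theta>)"
  using assms by (simp add: lifts_to_spans_def) (simp add: nat_mid_def ncomp_natural ncomp_natural_assoc)

lemma G2_sel [simp]: "lsrc (G2 \<theta>) = G1 (nsrc \<theta>)" "ltrg (G2 \<theta>) = G1 (ntrg \<theta>)"
  by (simp_all add: G2_def Let_def)

lemma lmid_G2: "lmid (G2 \<theta>) = span_functor (msrc (nsrc \<theta>)) (mtrg (nsrc \<theta>)) (nat_mid \<theta>)"
  by (simp add: G2_def Let_def nat_mid_def[abs_def])

lemma mob_lmid_G2 [simp]: "\<lbrakk>\<theta> \<in> lc_nats; msrc (nsrc \<theta>) = C; m \<in> arrs C\<rbrakk>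
    \<Longrightarrow> mob (lmid (G2 \<theta>)) (subobj C m) = subobj (mtrg (nsrc \<theta>)) (nat_mid \<theta> m)"
  using mob_span_functor[OF lifts_nat_mid] by (auto simp: lmid_G2)

text \<open>Changing \<open>m\<close> by an isomorphism \<open>k\<close> precomposes both legs with
  the isomorphism \<open>mar (nsrc \<theta>) k\<close>, so the class does not depend on the
  representative.\<close>

lemma lcomp_G2 [simp]:
  assumes th: "\<theta> \<in> lc_nats" and C: "msrc (nsrc \<theta>) = C" and m: "m \<in> arrs C"
  shows "lcomp (G2 \<theta>) (subobj C m) = span (mtrg (nsrc \<theta>)) (mar (nsrc \<theta>) m) (nat_mid \<theta> m)"
proof -
  let ?D = "mtrg (nsrc \<theta>)" and ?s = "\<lambda>m. span (mtrg (nsrc \<theta>)) (mar (nsrc \<theta>) m) (nat_mid \<theta> m)"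
  have K: "nsrc \<theta> \<in> lc_functors" "functor_mor (nsrc \<theta>)" using th by simp_all
  interpret C: lc_category C using K C by (intro lc_categoryI) auto
  interpret D: lc_category ?D using K by (intro lc_categoryI) auto
  have "x = ?s m" if m': "m' \<in> arrs C" "subobj C m = subobj C m'" "x = ?s m'" for x m'
  proof -
    obtain k where k: "iso C k" "trg C k = src C m" "m' = cmp C m k"
      using m' m C.subobj_eq_iff by blast
    then have "nat_mid \<theta> m' = cmp ?D (nat_mid \<theta> m) (mar (nsrc \<theta>) k)"
      using lifts_nat_mid[OF th] m C by (simp add: lifts_to_spans_def C.iso_arrs)
    then show ?thesis using k m' m th C K by (simp add: C.iso_arrs D.span_cmp_iso)
  qed
  then have "(THE x. \<exists>m' \<in> arrs C. subobj C m = subobj C m' \<and> x = ?s m') = ?s m"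
    using m by (intro the_equality) blast+
  then show ?thesis using m C by (simp add: G2_def Let_def C.subobj_in_obs nat_mid_def)
qed

text \<open>By \<open>cmp_span\<close> both ways round the naturality square at
  \<open>[m, n]\<close> give the span with legs \<open>mar K m\<close> and
  \<open>nat_mid \<theta> n\<close>.\<close>

lemma G2_lambdas [simp]:
  assumes th: "\<theta> \<in> lc_nats"
  shows "G2 \<theta> \<in> lambdas"
proof -
  obtain K K' C D where KK [simp]: "nsrc \<theta> = K" "ntrg \<theta> = K'" "msrc K = C" "mtrg K = D" by blast
  have KK' [simp]: "msrc K' = C" "mtrg K' = D" using lc_nats_simps[OF th] by simp_all
  have K [simp]: "K \<in> lc_functors" "functor_mor K" "K' \<in> lc_functors" "functor_mor K'"
    using lc_nats_simps[OF th] by auto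
  have "C \<in> lc_cats" "D \<in> lc_cats" using lc_functors_simps[OF K(1)] by auto
  then interpret C: lc_category C + D: lc_category D by (simp_all add: lc_categoryI)
  have M: "lmid (G2 \<theta>) \<in> og_functors" "msrc (lmid (G2 \<theta>)) = G0 C" "mtrg (lmid (G2 \<theta>)) = G0 D"
    and mar_M: "\<lbrakk>m \<in> arrs C; n \<in> arrs C; src C m = src C n\<rbrakk>
      \<Longrightarrow> mar (lmid (G2 \<theta>)) (span C m n) = span D (nat_mid \<theta> m) (nat_mid \<theta> n)" for m n
    using span_functor_og[OF lifts_nat_mid[OF th]] mar_span_functor[OF lifts_nat_mid[OF th]]
    by (simp_all add: lmid_G2)
  show ?thesis
  proof (rule lambdasI[OF G2_sel(1) _ G2_sel(2) _ refl, where C = "G0 C" and D = "G0 D"])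
    show "lcomp (G2 \<theta>) \<in> extensional (obs (G0 C))"
      by (simp add: G2_def Let_def)
    show "mob (lmid (G2 \<theta>)) \<in> extensional (obs (G0 C))" "mar (lmid (G2 \<theta>)) \<in> extensional (arrs (G0 C))"
      using mob_extensional[of "lmid (G2 \<theta>)"] mar_extensional[of "lmid (G2 \<theta>)"] M by simp_all
  next
    fix A assume "A \<in> obs (G0 C)"
    then obtain m where "m \<in> arrs C" "A = subobj C m" by (rule C.obsE)
    then show "lcomp (G2 \<theta>) A \<in> arrs (G0 D) \<and> src (G0 D) (lcomp (G2 \<theta>) A) = mob (G1 (nsrc \<theta>)) A \<and>
        trg (G0 D) (lcomp (G2 \<theta>) A) = mob (lmid (G2 \<theta>)) A"
      using th by (simp add: D.G0_simps)
  next
    fix A B assume "A \<in> obs (G0 C)" "B \<in> obs (G0 C)" and le: "obj_le (G0 C) A B"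
    then obtain m m' where m: "m \<in> arrs C" "A = subobj C m" "m' \<in> arrs C" "B = subobj C m'"
      by (elim C.obsE)
    then obtain h where h: "h \<in> arrs C" "trg C h = src C m'" "m = cmp C m' h"
      using le by (auto simp: C.obj_le_subobj)
    then have "nat_mid \<theta> m = cmp D (nat_mid \<theta> m') (mar K h)"
      using lifts_nat_mid[OF th] m by (simp add: lifts_to_spans_def)
    then have "\<exists>k \<in> arrs D. trg D k = src D (mar K m') \<and> mar K m = cmp D (mar K m') k \<and>
        nat_mid \<theta> m = cmp D (nat_mid \<theta> m') k"
      using h m by (intro bexI[of _ "mar K h"]) simp_all
    then show "ale (G0 D) (lcomp (G2 \<theta>) A) (lcomp (G2 \<theta>) B)"
      using m th by (simp add: D.ale_span)
  next
    fix f assume "f \<in> arrs (G0 C)"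
    then obtain m n where m: "m \<in> arrs C" "n \<in> arrs C" "src C m = src C n" "f = span C m n"
      by (rule C.arrsE)
    \<comment> \<open>The component of \<theta> at the common source is the arrow through which both
      legs factor; it puts the intermediate functor below \<open>G1 K'\<close>.\<close>
    have "\<exists>k \<in> arrs D. trg D k = src D (mar K' m) \<and> nat_mid \<theta> m = cmp D (mar K' m) k \<and>
        nat_mid \<theta> n = cmp D (mar K' n) k"
      using m th by (intro bexI[of _ "ncomp \<theta> (src C m)"]) (simp_all add: nat_mid_def)
    then show "mar (lmid (G2 \<theta>)) f \<in> arrs (G0 D) \<and>
         src (G0 D) (mar (lmid (G2 \<theta>)) f) = mob (lmid (G2 \<theta>)) (src (G0 C) f) \<and>
         ale (G0 D) (mar (lmid (G2 \<theta>)) f) (mar (G1 (ntrg \<theta>)) f) \<and>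
         cmp (G0 D) (mar (lmid (G2 \<theta>)) f) (lcomp (G2 \<theta>) (src (G0 C) f)) =
         cmp (G0 D) (lcomp (G2 \<theta>) (trg (G0 C) f)) (mar (G1 (nsrc \<theta>)) f)"
      using m th by (simp add: mar_M C.G0_simps D.G0_simps D.ale_span)
  qed (use M in simp_all)
qed

lemma lambdas_G0_eqI:
  assumes "\<alpha> \<in> lambdas" "\<beta> \<in> lambdas" "lsrc \<alpha> = lsrc \<beta>" "ltrg \<alpha> = ltrg \<beta>"
    and "msrc (lsrc \<alpha>) = G0 C" "C \<in> lc_cats"
    and "\<And>m. m \<in> arrs C \<Longrightarrow> lcomp \<alpha> (subobj C m) = lcomp \<beta> (subobj C m)"
  shows "\<alpha> = \<beta>"
  using assms(1-4)
proof (rule lambdas_eqI)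
  fix A assume "A \<in> obs (msrc (lsrc \<alpha>))"
  then obtain m where "m \<in> arrs C" "A = subobj C m"
    using assms(5) by (auto elim: lc_category.obsE[OF lc_categoryI[OF assms(6)]])
  then show "lcomp \<alpha> A = lcomp \<beta> A" using assms(7) by simp
qed

lemma restr_span [simp]:
  assumes "D \<in> lc_cats" "m \<in> arrs D" "n \<in> arrs D" "src D m = src D n" "h \<in> arrs D" "trg D h = src D m"
  shows "restr (G0 D) (span D m n) (subobj D (cmp D m h)) = span D (cmp D m h) (cmp D n h)"
  using assms lc_category.restr_span lc_categoryI by blast

lemma G2_id: "K \<in> lc_functors \<Longrightarrow> G2 (nat_id K) = lambda_id (G1 K)"
  by (rule lambdas_G0_eqI[where C = "msrc K"]) (simp_all add: nat_mid_def)

text \<open>Restriction of a span is precomposition of both legs, here with the component of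
  \<theta>; this inserts \<theta> under \<phi> in the right leg, just as in the component of
  \<open>nat_vcomp \<phi> \<theta>\<close>.\<close>

lemma G2_vcomp:
  assumes a: "\<theta> \<in> lc_nats" "\<phi> \<in> lc_nats" "nsrc \<phi> = ntrg \<theta>"
  shows "G2 (nat_vcomp \<phi> \<theta>) = lambda_vcomp (G2 \<phi>) (G2 \<theta>)"
proof (rule lambdas_G0_eqI[where C = "msrc (nsrc \<theta>)"])
  fix m assume m: "m \<in> arrs (msrc (nsrc \<theta>))"
  have "msrc (ntrg \<phi>) = msrc (nsrc \<theta>)" "mtrg (ntrg \<phi>) = mtrg (nsrc \<theta>)"
    using lc_nats_simps(3,4)[OF a(2)] a(1,3) by auto
  then show "lcomp (G2 (nat_vcomp \<phi> \<theta>)) (subobj (msrc (nsrc \<theta>)) m)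
    = lcomp (lambda_vcomp (G2 \<phi>) (G2 \<theta>)) (subobj (msrc (nsrc \<theta>)) m)"
    using m a by (simp add: nat_mid_def)
qed (use a in simp_all)

lemma G2_hcomp:
  assumes a: "\<theta> \<in> lc_nats" "\<phi> \<in> lc_nats" "msrc (nsrc \<phi>) = mtrg (nsrc \<theta>)"
  shows "G2 (nat_hcomp \<phi> \<theta>) = lambda_hcomp (G2 \<phi>) (G2 \<theta>)"
proof (rule lambdas_G0_eqI[where C = "msrc (nsrc \<theta>)"])
  fix m assume m: "m \<in> arrs (msrc (nsrc \<theta>))"
  then show "lcomp (G2 (nat_hcomp \<phi> \<theta>)) (subobj (msrc (nsrc \<theta>)) m)
    = lcomp (lambda_hcomp (G2 \<phi>) (G2 \<theta>)) (subobj (msrc (nsrc \<theta>)) m)"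
    using a by (simp add: nat_mid_def)
qed (use a in \<open>simp_all add: G1_comp\<close>)

lemma two_functor_G: "two_functor lcCat oGpd G_functor"
proof -
  have 1: "cat_functor (cells01 lcCat) (cells01 oGpd) G0 G1"
    using category_og_functors category_lc_functors
    by (simp add: cat_functor_def cat_functor_axioms_def oGpd_def lcCat_def G1_id G1_comp)
  have 2: "cat_functor (cells12 lcCat) (cells12 oGpd) G1 G2"
    using category_lambdas category_lc_nats
    by (simp add: cat_functor_def cat_functor_axioms_def oGpd_def lcCat_def G2_id G2_vcomp)
  show ?thesis
    using 1 2 two_category_oGpd two_category_lcCat
    by (simp add: two_functor_def two_functor_axioms_def G_functor_def)
       (simp add: oGpd_def lcCat_def G2_hcomp)
qed

section \<open>The 2-adjunction\<close>

definition adj_unit :: "('u::universe, 'u) cat \<Rightarrow> 'u lc_functor" where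
  "adj_unit C = \<lparr>msrc = C, mtrg = L0 (G0 C), mob = (\<lambda>A \<in> obs C. subobj C (idt C A)),
     mar = (\<lambda>f \<in> arrs C. pair (span C (idt C (src C f)) f) (subobj C (idt C (trg C f))))\<rparr>"

lemma adj_unit_sel [simp]: "msrc (adj_unit C) = C" "mtrg (adj_unit C) = L0 (G0 C)"
  "A \<in> obs C \<Longrightarrow> mob (adj_unit C) A = subobj C (idt C A)"
  by (simp_all add: adj_unit_def)

lemma mar_adj_unit: "f \<in> arrs C \<Longrightarrow>
    mar (adj_unit C) f = pair (span C (idt C (src C f)) f) (subobj C (idt C (trg C f)))"
  by (simp add: adj_unit_def)

lemma (in lc_category) obj_le_subobj_idt:
  assumes "f \<in> arrs C"
  shows "obj_le (G0 C) (subobj C f) (subobj C (idt C (trg C f)))"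
proof -
  have "\<exists>h \<in> arrs C. trg C h = src C (idt C (trg C f)) \<and> f = cmp C (idt C (trg C f)) h"
    using assms by (intro bexI[of _ f]) simp_all
  then show ?thesis using assms by (simp add: obj_le_subobj)
qed

text \<open>The restriction that occurs when the unit values at \<open>f\<close> and
  \<open>g\<close> are composed in \<open>L0 (G0 C)\<close>; placed after \<open>[1, f]\<close> it
  gives \<open>[1, g f]\<close>.\<close>

lemma (in lc_category) restr_span_idt:
  "\<lbrakk>f \<in> arrs C; g \<in> arrs C; src C g = trg C f\<rbrakk>
    \<Longrightarrow> restr (G0 C) (span C (idt C (trg C f)) g) (subobj C f) = span C f (cmp C g f)"
  using restr_span[of "idt C (trg C f)" g f] by simp

lemma adj_unit_lc [simp]:
  assumes C: "C \<in> lc_cats"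
  shows "adj_unit C \<in> lc_functors"
proof (rule lc_functorsI)
  interpret C: lc_category C using C by (rule lc_categoryI)
  show "functor_mor (adj_unit C)"
    unfolding functor_mor_def adj_unit_sel
  proof (intro conjI cat_functor.intro cat_functor_axioms.intro)
    show "mob (adj_unit C) \<in> extensional (obs C)" "mar (adj_unit C) \<in> extensional (arrs C)"
      by (simp_all add: adj_unit_def)
  qed (use C C.ordered_groupoid_G0 in \<open>simp_all add: mar_adj_unit C.G0_simps C.obj_le_subobj_idt C.restr_span_idt\<close>)
qed (use C in simp_all)

lemma mar_L1_unit:
  assumes "C \<in> lc_cats" "F \<in> og_functors" "msrc F = G0 C" "f \<in> arrs C"
  shows "mar (L1 F) (mar (adj_unit C) f)
    = pair (mar F (span C (idt C (src C f)) f)) (mob F (subobj C (idt C (trg C f))))"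
proof -
  interpret C: lc_category C using assms(1) by (rule lc_categoryI)
  show ?thesis using assms by (simp add: mar_adj_unit C.obj_le_subobj_idt)
qed

lemma unit_natural1:
  assumes F: "F \<in> lc_functors"
  shows "comp_mor (L1 (G1 F)) (adj_unit (msrc F)) = comp_mor (adj_unit (mtrg F)) F"
proof (rule functor_mor_eqI)
  fix f assume "f \<in> arrs (msrc (comp_mor (L1 (G1 F)) (adj_unit (msrc F))))"
  then show "mar (comp_mor (L1 (G1 F)) (adj_unit (msrc F))) f = mar (comp_mor (adj_unit (mtrg F)) F) f"
    using F by (simp add: mar_L1_unit) (simp add: mar_adj_unit)
qed (use F in simp_all)

text \<open>At an identity \<open>nat_mid \<theta>\<close> is the component of \<theta>, so
  \<open>L2 (G2 \<theta>)\<close> at \<open>[1]\<close> has the span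
  \<open>[1, ncomp \<theta> A]\<close>, which is the unit applied to that component.\<close>

lemma unit_natural2:
  assumes th: "\<theta> \<in> lc_nats"
  shows "nat_hcomp (L2 (G2 \<theta>)) (nat_id (adj_unit (msrc (nsrc \<theta>))))
    = nat_hcomp (nat_id (adj_unit (mtrg (nsrc \<theta>)))) \<theta>"
proof (rule lc_nats_eqI)
  fix A assume "A \<in> obs (msrc (nsrc (nat_hcomp (L2 (G2 \<theta>)) (nat_id (adj_unit (msrc (nsrc \<theta>)))))))"
  then have A: "A \<in> obs (msrc (nsrc \<theta>))" using th by simp
  then have "nat_mid \<theta> (idt (msrc (nsrc \<theta>)) A) = ncomp \<theta> A"
    using th by (simp add: nat_mid_def)
  moreover have "ncomp (nat_hcomp (L2 (G2 \<theta>)) (nat_id (adj_unit (msrc (nsrc \<theta>))))) A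
    = ncomp (L2 (G2 \<theta>)) (subobj (msrc (nsrc \<theta>)) (idt (msrc (nsrc \<theta>)) A))"
    \<comment> \<open>\<open>L0_sel(4)\<close> would expand identities of \<open>L0\<close> into
      pairs; kept folded, they are cancelled by the unit laws.\<close>
    using A th by (simp del: L2_sel(3) L0_sel(4))
  moreover have "ncomp (nat_hcomp (nat_id (adj_unit (mtrg (nsrc \<theta>)))) \<theta>) A
    = mar (adj_unit (mtrg (nsrc \<theta>))) (ncomp \<theta> A)"
    using A th by (simp del: L0_sel(4))
  ultimately show "ncomp (nat_hcomp (L2 (G2 \<theta>)) (nat_id (adj_unit (msrc (nsrc \<theta>))))) A
    = ncomp (nat_hcomp (nat_id (adj_unit (mtrg (nsrc \<theta>)))) \<theta>) A"
    using A th by (simp add: mar_adj_unit)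
qed (use th unit_natural1[of "nsrc \<theta>"] unit_natural1[of "ntrg \<theta>"] in \<open>simp_all add: comp_mor_id_left\<close>)

text \<open>The legs of a span in \<open>L0 H\<close> contain groupoid arrows \<open>h\<close> and
  \<open>k\<close> with a common source, so \<open>k\<close> after the inverse of \<open>h\<close>
  runs between the two objects that the legs name as subobjects.\<close>

definition adj_counit :: "('u::universe, 'u) ogpd \<Rightarrow> 'u og_functor" where
  "adj_counit H = \<lparr>msrc = G0 (L0 H), mtrg = H,
     mob = (\<lambda>a \<in> obs (G0 (L0 H)). THE b. \<exists>p \<in> arrs (L0 H). a = subobj (L0 H) p \<and> b = trg H (pfst p)),
     mar = (\<lambda>x \<in> arrs (G0 (L0 H)). THE k. \<exists>p q. is_span (L0 H) p q \<and> x = span (L0 H) p q \<and>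
        k = cmp H (pfst q) (inv_arr H (pfst p)))\<rparr>"

lemma adj_counit_sel [simp]: "msrc (adj_counit H) = G0 (L0 H)" "mtrg (adj_counit H) = H"
  by (simp_all add: adj_counit_def)

locale small_ogpd = ordered_groupoid H for H :: "('u::universe, 'u) ogpd" +
  assumes ogpds: "H \<in> ogpds"

lemma small_ogpdI: "H \<in> ogpds \<Longrightarrow> small_ogpd H"
  by (simp add: small_ogpd_def small_ogpd_axioms_def ogpdsD)

text \<open>Composing with the inverse gives the identity at \<open>B\<close>, so \<open>B\<close>
  is the target of a restriction of \<open>h\<close> and hence lies below \<open>trg H h\<close>;
  the converse inequality is part of the arrow.\<close>

lemma (in small_ogpd) iso_L0:
  assumes "iso (L0 H) (pair h B)"
  shows "trg H h = B"
proof -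
  obtain q where q: "is_inverse (L0 H) (pair h B) q" using assms by (auto simp: iso_def)
  then have h: "h \<in> arrs H" "B \<in> obs H" "obj_le H (trg H h) B" by (simp_all add: is_inverse_def)
  obtain k A where "q = pair k A" "k \<in> arrs H" "A \<in> obs H" "obj_le H (trg H k) A"
    using q by (auto simp: is_inverse_def elim: L0_arrE)
  with q have k: "k \<in> arrs H" "obj_le H (trg H k) (src H h)" "cmp H (restr H h (trg H k)) k = idt H B"
    by (simp_all add: is_inverse_def)
  then have "trg H (restr H h (trg H k)) = trg H (idt H B)" using h by (simp flip: k(3))
  then have "obj_le H B (trg H h)" using h k obj_le_trg_restr[of h "trg H k"] by simp
  then show ?thesis using h by (intro obj_le_antisym) simp_all
qed

text \<open>A change of representative replaces \<open>h\<close> and \<open>k\<close> by their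
  composites with one groupoid arrow \<open>l\<close>. This keeps the targets, and \<open>l\<close>
  cancels in \<open>k\<close> after the inverse of \<open>h\<close>.\<close>

lemma (in small_ogpd) adj_counit_values:
  shows mob_adj_counit: "\<lbrakk>h \<in> arrs H; B \<in> obs H; obj_le H (trg H h) B\<rbrakk>
      \<Longrightarrow> mob (adj_counit H) (subobj (L0 H) (pair h B)) = trg H h"
    and mar_adj_counit: "\<lbrakk>h \<in> arrs H; B \<in> obs H; obj_le H (trg H h) B;
      k \<in> arrs H; D \<in> obs H; obj_le H (trg H k) D; src H h = src H k\<rbrakk>
      \<Longrightarrow> mar (adj_counit H) (span (L0 H) (pair h B) (pair k D)) = cmp H k (inv_arr H h)"
proof -
  interpret L: lc_category "L0 H" using ogpds by (intro lc_categoryI) simp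
  \<comment> \<open>By \<open>iso_L0\<close> an isomorphism into \<open>src H h\<close> is a
    groupoid arrow \<open>l\<close> with exactly that target, so composing with it involves no
    proper restriction.\<close>
  have comp_iso: "\<exists>l. l \<in> arrs H \<and> trg H l = src H h \<and> j = pair l (src H h) \<and>
      (\<forall>h' B'. h' \<in> arrs H \<longrightarrow> src H h' = src H h \<longrightarrow> cmp (L0 H) (pair h' B') j = pair (cmp H h' l) B')"
    if j: "iso (L0 H) j" "trg (L0 H) j = src H h" for j h
  proof -
    have "j \<in> arrs (L0 H)" using j L.iso_arrs by blast
    then obtain l A where l: "j = pair l A" "l \<in> arrs H" by (rule L0_arrE)
    then show ?thesis using j iso_L0[of l A] by (auto simp: restr_src)
  qed
  show "mob (adj_counit H) (subobj (L0 H) (pair h B)) = trg H h"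
    if h: "h \<in> arrs H" "B \<in> obs H" "obj_le H (trg H h) B" for h B
  proof -
    have "b = trg H h"
      if p: "p \<in> arrs (L0 H)" "subobj (L0 H) (pair h B) = subobj (L0 H) p" "b = trg H (pfst p)" for b p
    proof -
      obtain j where j: "iso (L0 H) j" "trg (L0 H) j = src H h" "p = cmp (L0 H) (pair h B) j"
        using p h L.subobj_eq_iff[of "pair h B" p] by auto
      then show ?thesis using p h comp_iso[OF j(1,2)] by auto
    qed
    moreover have "pair h B \<in> arrs (L0 H)" "trg H h = trg H (pfst (pair h B))" using h by simp_all
    ultimately have "(THE b. \<exists>p \<in> arrs (L0 H). subobj (L0 H) (pair h B) = subobj (L0 H) p \<and>
      b = trg H (pfst p)) = trg H h"
      by (intro the_equality) blast+
    then show ?thesis using h by (simp add: adj_counit_def L.subobj_in_obs)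
  qed
  show "mar (adj_counit H) (span (L0 H) (pair h B) (pair k D)) = cmp H k (inv_arr H h)"
    if h: "h \<in> arrs H" "B \<in> obs H" "obj_le H (trg H h) B"
      and k: "k \<in> arrs H" "D \<in> obs H" "obj_le H (trg H k) D" "src H h = src H k" for h B k D
  proof -
    have "c = cmp H k (inv_arr H h)"
      if s: "is_span (L0 H) p q" "span (L0 H) (pair h B) (pair k D) = span (L0 H) p q"
        "c = cmp H (pfst q) (inv_arr H (pfst p))" for c p q
    proof -
      obtain j where j: "iso (L0 H) j" "trg (L0 H) j = src H h" "p = cmp (L0 H) (pair h B) j"
        "q = cmp (L0 H) (pair k D) j"
        using s h k L.span_eq_iff[of "pair h B" "pair k D" p q] by (auto simp: is_span_def)
      obtain l where l: "l \<in> arrs H" "trg H l = src H h" "p = pair (cmp H h l) B" "q = pair (cmp H k l) D"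
        using comp_iso[OF j(1,2)] j(3,4) h k by auto
      then show ?thesis using s(3) h k by simp
    qed
    moreover have "is_span (L0 H) (pair h B) (pair k D)" using h k by (simp add: is_span_def)
    moreover have "cmp H k (inv_arr H h) = cmp H (pfst (pair k D)) (inv_arr H (pfst (pair h B)))" by simp
    ultimately have "(THE c. \<exists>p q. is_span (L0 H) p q \<and> span (L0 H) (pair h B) (pair k D) = span (L0 H) p q \<and>
      c = cmp H (pfst q) (inv_arr H (pfst p))) = cmp H k (inv_arr H h)"
      by (intro the_equality) blast+
    then show ?thesis using h k by (simp add: adj_counit_def L.span_in_arrs)
  qed
qed

lemma adj_counit_simps [simp]:
  assumes "H \<in> ogpds" "h \<in> arrs H" "B \<in> obs H" "obj_le H (trg H h) B"
  shows "mob (adj_counit H) (subobj (L0 H) (pair h B)) = trg H h"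
    "\<lbrakk>k \<in> arrs H; D \<in> obs H; obj_le H (trg H k) D; src H h = src H k\<rbrakk>
      \<Longrightarrow> mar (adj_counit H) (span (L0 H) (pair h B) (pair k D)) = cmp H k (inv_arr H h)"
  using assms by (simp_all add: small_ogpd.mob_adj_counit small_ogpd.mar_adj_counit small_ogpdI)

lemma G0_L0_obsE:
  assumes "H \<in> ogpds" "a \<in> obs (G0 (L0 H))"
  obtains h B where "h \<in> arrs H" "B \<in> obs H" "obj_le H (trg H h) B" "a = subobj (L0 H) (pair h B)"
  using lc_category.obsE[OF lc_categoryI[OF L0_lc[OF assms(1)]] assms(2)] by (metis L0_arrE)

lemma G0_L0_arrsE:
  assumes "H \<in> ogpds" "x \<in> arrs (G0 (L0 H))"
  obtains h B k D where "h \<in> arrs H" "B \<in> obs H" "obj_le H (trg H h) B"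
    "k \<in> arrs H" "D \<in> obs H" "obj_le H (trg H k) D" "src H h = src H k"
    "x = span (L0 H) (pair h B) (pair k D)"
proof -
  obtain p q where pq: "p \<in> arrs (L0 H)" "q \<in> arrs (L0 H)" "src (L0 H) p = src (L0 H) q"
    "x = span (L0 H) p q"
    by (rule lc_category.arrsE[OF lc_categoryI[OF L0_lc[OF assms(1)]] assms(2)])
  show ?thesis
    by (rule L0_arrE[OF pq(1)], rule L0_arrE[OF pq(2)]) (use pq(3,4) in \<open>auto intro: that\<close>)
qed

lemma adj_counit_og [simp]:
  assumes H: "H \<in> ogpds"
  shows "adj_counit H \<in> og_functors"
proof (rule og_functorsI)
  interpret H: ordered_groupoid H using H by (rule ogpdsD)
  interpret L: lc_category "L0 H" using H by (intro lc_categoryI) simp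
  show "functor_mor (adj_counit H)"
    unfolding functor_mor_def adj_counit_sel
  proof (intro conjI cat_functor.intro cat_functor_axioms.intro L.category_G0 H.category_axioms)
    show "mob (adj_counit H) \<in> extensional (obs (G0 (L0 H)))"
      "mar (adj_counit H) \<in> extensional (arrs (G0 (L0 H)))"
      by (simp_all add: adj_counit_def)
  next
    fix A assume "A \<in> obs (G0 (L0 H))"
    then obtain h B where "h \<in> arrs H" "B \<in> obs H" "obj_le H (trg H h) B" "A = subobj (L0 H) (pair h B)"
      by (rule G0_L0_obsE[OF H])
    then show "mob (adj_counit H) A \<in> obs H"
      "mar (adj_counit H) (idt (G0 (L0 H)) A) = idt H (mob (adj_counit H) A)"
      using H by (simp_all add: L.G0_simps)
  next
    fix x assume "x \<in> arrs (G0 (L0 H))"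
    then obtain h B k D where x: "h \<in> arrs H" "B \<in> obs H" "obj_le H (trg H h) B"
      "k \<in> arrs H" "D \<in> obs H" "obj_le H (trg H k) D" "src H h = src H k"
      "x = span (L0 H) (pair h B) (pair k D)"
      by (rule G0_L0_arrsE[OF H])
    then show "mar (adj_counit H) x \<in> arrs H"
      "src H (mar (adj_counit H) x) = mob (adj_counit H) (src (G0 (L0 H)) x)"
      "trg H (mar (adj_counit H) x) = mob (adj_counit H) (trg (G0 (L0 H)) x)"
      using H by (simp_all add: L.G0_simps)
    fix y assume y: "y \<in> arrs (G0 (L0 H))" "src (G0 (L0 H)) y = trg (G0 (L0 H)) x"
    \<comment> \<open>The left leg of \<open>y\<close> is chosen equal to the right leg of
      \<open>x\<close>, so that \<open>k\<close> and its inverse cancel in the composite of the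
      values.\<close>
    obtain q where q: "q \<in> arrs (L0 H)" "src (L0 H) (pair k D) = src (L0 H) q" "y = span (L0 H) (pair k D) q"
      by (rule L.arrs_srcE[OF y(1), of "pair k D"]) (use x y in \<open>simp_all add: L.trg_span\<close>)
    obtain l E where "q = pair l E" "l \<in> arrs H" "E \<in> obs H" "obj_le H (trg H l) E"
      using q(1) by (rule L0_arrE)
    then show "mar (adj_counit H) (cmp (G0 (L0 H)) y x) = cmp H (mar (adj_counit H) y) (mar (adj_counit H) x)"
      using x q H by (simp add: L.cmp_span)
  qed
  fix x y assume "x \<in> arrs (msrc (adj_counit H))" "y \<in> arrs (msrc (adj_counit H))"
    and le: "ale (msrc (adj_counit H)) x y"
  then have xy: "x \<in> arrs (G0 (L0 H))" "y \<in> arrs (G0 (L0 H))" "ale (G0 (L0 H)) x y" by simp_all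
  obtain h B k D where x: "h \<in> arrs H" "B \<in> obs H" "obj_le H (trg H h) B"
    "k \<in> arrs H" "D \<in> obs H" "obj_le H (trg H k) D" "src H h = src H k"
    "x = span (L0 H) (pair h B) (pair k D)"
    using xy(1) by (rule G0_L0_arrsE[OF H])
  obtain h' B' k' D' where y: "h' \<in> arrs H" "B' \<in> obs H" "obj_le H (trg H h') B'"
    "k' \<in> arrs H" "D' \<in> obs H" "obj_le H (trg H k') D'" "src H h' = src H k'"
    "y = span (L0 H) (pair h' B') (pair k' D')"
    using xy(2) by (rule G0_L0_arrsE[OF H])
  obtain j where j: "j \<in> arrs (L0 H)" "trg (L0 H) j = src H h'"
    "pair h B = cmp (L0 H) (pair h' B') j" "pair k D = cmp (L0 H) (pair k' D') j"
    using xy(3) x y by (auto simp: L.ale_span)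
  obtain l A where l: "j = pair l A" "l \<in> arrs H" "A \<in> obs H" "obj_le H (trg H l) A"
    using j(1) by (rule L0_arrE)
  \<comment> \<open>The witness \<open>j\<close> of the inequality contains \<open>l\<close>, and
    \<open>h\<close>, \<open>k\<close> are \<open>r\<close>, \<open>s\<close> after
    \<open>l\<close>. So \<open>l\<close> cancels in the value at \<open>x\<close>, leaving
    \<open>s\<close> after the inverse of \<open>r\<close>, which monotonicity bounds by the value
    at \<open>y\<close>.\<close>
  define r s where "r = restr H h' (trg H l)" and "s = restr H k' (trg H l)"
  have A: "A = src H h'" using j l by simp
  have r: "r \<in> arrs H" "src H r = trg H l" "ale H r h'" "s \<in> arrs H" "src H s = trg H l" "ale H s k'"
    using y l A by (simp_all add: r_def s_def)
  have "h = cmp H r l" "k = cmp H s l" using j(3,4) l by (simp_all add: r_def s_def)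
  then have "cmp H k (inv_arr H h) = cmp H s (inv_arr H r)" using r l by simp
  moreover have "ale H (cmp H s (inv_arr H r)) (cmp H k' (inv_arr H h'))"
    using r y by (intro H.ale_cmp H.ale_inv) simp_all
  ultimately show "ale (mtrg (adj_counit H)) (mar (adj_counit H) x) (mar (adj_counit H) y)"
    using x y H by simp
qed (use H in simp_all)

lemma counit_natural1:
  assumes F: "F \<in> og_functors"
  shows "comp_mor F (adj_counit (msrc F)) = comp_mor (adj_counit (mtrg F)) (G1 (L1 F))"
proof (rule functor_mor_eqI)
  show "mob (comp_mor F (adj_counit (msrc F))) a = mob (comp_mor (adj_counit (mtrg F)) (G1 (L1 F))) a"
    if a: "a \<in> obs (msrc (comp_mor F (adj_counit (msrc F))))" for a
  proof -
    obtain h B where "h \<in> arrs (msrc F)" "B \<in> obs (msrc F)" "obj_le (msrc F) (trg (msrc F) h) B"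
      "a = subobj (L0 (msrc F)) (pair h B)"
      by (rule G0_L0_obsE[of "msrc F" a]) (use a F in auto)
    then show ?thesis using F mob_mono[OF F, of "msrc F" "trg (msrc F) h" B] by simp
  qed
  show "mar (comp_mor F (adj_counit (msrc F))) x = mar (comp_mor (adj_counit (mtrg F)) (G1 (L1 F))) x"
    if x: "x \<in> arrs (msrc (comp_mor F (adj_counit (msrc F))))" for x
  proof -
    obtain h B k D where "h \<in> arrs (msrc F)" "B \<in> obs (msrc F)" "obj_le (msrc F) (trg (msrc F) h) B"
      "k \<in> arrs (msrc F)" "D \<in> obs (msrc F)" "obj_le (msrc F) (trg (msrc F) k) D"
      "src (msrc F) h = src (msrc F) k"
      "x = span (L0 (msrc F)) (pair h B) (pair k D)"
      by (rule G0_L0_arrsE[of "msrc F" x]) (use x F in auto)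
    then show ?thesis
      using F mob_mono[OF F, of "msrc F" "trg (msrc F) h" B] mob_mono[OF F, of "msrc F" "trg (msrc F) k" D]
      by simp
  qed
qed (use F in simp_all)

text \<open>At the subobject of \<open>(h, B)\<close> both sides are \<alpha> at
  \<open>trg H h\<close>: on the right the counit receives a span whose right leg is this component
  after \<open>mar F h\<close> and whose left leg is \<open>mar F h\<close>, which cancels.\<close>

lemma counit_natural2:
  assumes a: "\<alpha> \<in> lambdas"
  shows "lambda_hcomp \<alpha> (lambda_id (adj_counit (msrc (lsrc \<alpha>))))
    = lambda_hcomp (lambda_id (adj_counit (mtrg (lsrc \<alpha>)))) (G2 (L2 \<alpha>))"
proof (rule lambdas_G0_eqI[where C = "L0 (msrc (lsrc \<alpha>))"])
  obtain F G H J where FG [simp]: "lsrc \<alpha> = F" "ltrg \<alpha> = G" "msrc F = H" "mtrg F = J" by blast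
  have [simp]: "msrc G = H" "mtrg G = J" "msrc (lmid \<alpha>) = H" "mtrg (lmid \<alpha>) = J"
    using lambdas_simps[OF a] by simp_all
  have F [simp]: "F \<in> og_functors" "G \<in> og_functors" "functor_mor F" "functor_mor G" "functor_mor (lmid \<alpha>)"
    using lambdas_simps[OF a] by auto
  have HJ [simp]: "H \<in> ogpds" "J \<in> ogpds" using og_functors_simps[OF F(1)] by simp_all
  interpret H: ordered_groupoid H by (rule ogpdsD) simp
  interpret J: ordered_groupoid J by (rule ogpdsD) simp
  fix m assume "m \<in> arrs (L0 (msrc (lsrc \<alpha>)))"
  then obtain h B where m: "m = pair h B" "h \<in> arrs H" "B \<in> obs H" "obj_le H (trg H h) B"
    by (auto elim: L0_arrE)
  \<comment> \<open>Restriction turns the target functor into the intermediate one, and naturality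
    of \<alpha> at \<open>h\<close> then moves the component to the target of
    \<open>h\<close>.\<close>
  have mid: "nat_mid (L2 \<alpha>) m = pair (cmp J (lcomp \<alpha> (trg H h)) (mar F h)) (mob G B)"
    using m a restr_ltrg[OF a, of h J "src H h"] lcomp_natural[OF a, of h J "src H h" "trg H h"]
    by (simp add: nat_mid_def)
  have le: "obj_le J (mob F (trg H h)) (mob F B)" "obj_le J (mob G (trg H h)) (mob G B)"
    using m by (simp_all add: mob_mono)
  have le': "obj_le J (mob (lmid \<alpha>) (trg H h)) (mob G B)"
    by (rule J.obj_le_trans[OF _ le(2)]) (use a m lmid_mob_le[OF a, of "trg H h" J] in simp_all)
  show "lcomp (lambda_hcomp \<alpha> (lambda_id (adj_counit (msrc (lsrc \<alpha>))))) (subobj (L0 (msrc (lsrc \<alpha>))) m)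
    = lcomp (lambda_hcomp (lambda_id (adj_counit (mtrg (lsrc \<alpha>)))) (G2 (L2 \<alpha>))) (subobj (L0 (msrc (lsrc \<alpha>))) m)"
    using m a le le' lmid_mob_le[OF a, of "trg H h" J] by (simp add: mid[unfolded m(1)] J.restr_src J.restr_idt)
qed (use a counit_natural1[of "lsrc \<alpha>"] counit_natural1[of "ltrg \<alpha>"] in
    \<open>simp_all add: comp_mor_id_left\<close>)

text \<open>The unit sends the legs of \<open>[m, n]\<close> to \<open>[1, m]\<close> and
  \<open>[1, n]\<close>; the counit forms \<open>[1, n]\<close> after the inverse
  \<open>[m, 1]\<close>, which is \<open>[m, n]\<close> again.\<close>

lemma triangle_G:
  assumes C: "C \<in> lc_cats"
  shows "comp_mor (adj_counit (G0 C)) (G1 (adj_unit C)) = id_mor (G0 C)"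
proof (rule functor_mor_eqI)
  interpret C: lc_category C using C by (rule lc_categoryI)
  show "mob (comp_mor (adj_counit (G0 C)) (G1 (adj_unit C))) a = mob (id_mor (G0 C)) a"
    if a: "a \<in> obs (msrc (comp_mor (adj_counit (G0 C)) (G1 (adj_unit C))))" for a
  proof -
    obtain m where "m \<in> arrs C" "a = subobj C m" by (rule C.obsE[of a]) (use a in auto)
    then show ?thesis using C by (simp add: mar_adj_unit C.obj_le_subobj_idt)
  qed
  show "mar (comp_mor (adj_counit (G0 C)) (G1 (adj_unit C))) x = mar (id_mor (G0 C)) x"
    if x: "x \<in> arrs (msrc (comp_mor (adj_counit (G0 C)) (G1 (adj_unit C))))" for x
  proof -
    obtain m n where "m \<in> arrs C" "n \<in> arrs C" "src C m = src C n" "x = span C m n"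
      by (rule C.arrsE[of x]) (use x in auto)
    then show ?thesis using C by (simp add: mar_adj_unit C.obj_le_subobj_idt C.inv_span)
  qed
qed (use C in simp_all)

text \<open>The unit turns \<open>(h, B)\<close> into a span whose left leg is an identity, and the
  counit composes \<open>h\<close> with the inverse of that identity.\<close>

lemma triangle_L:
  assumes H: "H \<in> ogpds"
  shows "comp_mor (L1 (adj_counit H)) (adj_unit (L0 H)) = id_mor (L0 H)"
proof (rule functor_mor_eqI)
  interpret H: ordered_groupoid H using H by (rule ogpdsD)
  show "mar (comp_mor (L1 (adj_counit H)) (adj_unit (L0 H))) f = mar (id_mor (L0 H)) f"
    if f: "f \<in> arrs (msrc (comp_mor (L1 (adj_counit H)) (adj_unit (L0 H))))" for f
  proof -
    obtain h B where "f = pair h B" "h \<in> arrs H" "B \<in> obs H" "obj_le H (trg H h) B"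
      using f by (auto elim: L0_arrE)
    then show ?thesis using H by (simp add: mar_L1_unit)
  qed
qed (use H in \<open>simp_all add: ogpdsD\<close>)

section \<open>Identity and composite 2-functors, and the resulting 2-adjunction\<close>

lemma cat_functor_id: "category C \<Longrightarrow> cat_functor C C id id"
  by (simp add: cat_functor_def cat_functor_axioms_def)

lemma cat_functor_comp:
  assumes "cat_functor C D Fo Fa" "cat_functor D E Go Ga"
  shows "cat_functor C E (Go \<circ> Fo) (Ga \<circ> Fa)"
proof -
  interpret F: cat_functor C D Fo Fa by fact
  interpret G: cat_functor D E Go Ga by fact
  show ?thesis
    by unfold_locales (simp_all add: F.map_obs F.map_arrs F.map_src F.map_trg F.map_idt F.map_cmp
        G.map_obs G.map_arrs G.map_src G.map_trg G.map_idt G.map_cmp)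
qed

lemma two_functor_id: "two_category K \<Longrightarrow> two_functor K K id_two_fun"
  by (simp add: two_functor_def two_functor_axioms_def id_two_fun_def cat_functor_id
      two_category.category01 two_category.category12)

lemma two_functor_comp:
  assumes "two_functor K M F" "two_functor M N G"
  shows "two_functor K N (comp_two_fun G F)"
proof -
  interpret F: two_functor K M F by fact
  interpret G: two_functor M N G by fact
  interpret F1: cat_functor "cells01 K" "cells01 M" "map0 F" "map1 F" by (rule F.functor01)
  interpret F2: cat_functor "cells12 K" "cells12 M" "map1 F" "map2 F" by (rule F.functor12)
  \<comment> \<open>Horizontal composability is a condition on the 1-cells bounding the 2-cells; it
    is preserved because \<open>functor01\<close> and \<open>functor12\<close> share
    \<open>map1 F\<close>.\<close>
  have hc: "hcomposable M (map2 F \<beta>) (map2 F \<alpha>)" if c: "hcomposable K \<beta> \<alpha>" for \<alpha> \<beta>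
  proof -
    have "src2 K \<beta> \<in> cells1 K" "src2 K \<alpha> \<in> cells1 K"
      using c F2.C.src_obs unfolding F.K.obs_cells12 by auto
    then show ?thesis
      using c by (simp add: F2.map_arrs F2.map_src F1.map_src F1.map_trg)
  qed
  have "map2 G (map2 F (hcmp K \<beta> \<alpha>)) = hcmp N (map2 G (map2 F \<beta>)) (map2 G (map2 F \<alpha>))"
    if c: "hcomposable K \<beta> \<alpha>" for \<alpha> \<beta>
    unfolding F.map_hcmp[OF c] by (rule G.map_hcmp[OF hc[OF c]])
  then show ?thesis
    unfolding two_functor_def two_functor_axioms_def comp_two_fun_def
    using cat_functor_comp[OF F.functor01 G.functor01] cat_functor_comp[OF F.functor12 G.functor12]
      F.K.two_category_axioms G.M.two_category_axioms
    by simp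
qed

lemma two_adjunction_G_L: "two_adjunction lcCat oGpd G_functor L_functor adj_unit adj_counit"
proof -
  note G = two_functor_G and L = two_functor_L
  have unit: "two_natural lcCat lcCat id_two_fun (comp_two_fun L_functor G_functor) adj_unit"
    unfolding two_natural_def
    by (intro conjI two_functor_id two_category_lcCat two_functor_comp[OF G L])
       (simp add: two_natural_axioms_def lcCat_def id_two_fun_def comp_two_fun_def L_functor_def
         G_functor_def unit_natural1 unit_natural2)
  have counit: "two_natural oGpd oGpd (comp_two_fun G_functor L_functor) id_two_fun adj_counit"
    unfolding two_natural_def
    by (intro conjI two_functor_id two_category_oGpd two_functor_comp[OF L G])
       (simp add: two_natural_axioms_def oGpd_def id_two_fun_def comp_two_fun_def L_functor_def
         G_functor_def counit_natural1 counit_natural2)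
  show ?thesis
    unfolding two_adjunction_def using G L unit counit
    by (simp add: two_adjunction_axioms_def)
       (simp add: lcCat_def oGpd_def L_functor_def G_functor_def triangle_G triangle_L)
qed

theorem theorem5p1:
  "two_functor (oGpd :: (('u::universe, 'u) ogpd, 'u og_functor, 'u lambda_trans) two_cat)
     lcCat L_functor \<and>
   two_functor (lcCat :: (('u, 'u) cat, 'u lc_functor, 'u nat_trans) two_cat)
     oGpd G_functor \<and>
   (\<exists>\<eta> \<epsilon>. two_adjunction (lcCat :: (('u, 'u) cat, 'u lc_functor, 'u nat_trans) two_cat)
     (oGpd :: (('u, 'u) ogpd, 'u og_functor, 'u lambda_trans) two_cat)
     G_functor L_functor \<eta> \<epsilon>)"
  using two_functor_L two_functor_G two_adjunction_G_L by blast

end
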